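(* Let $n\geq 1$ be an integer and let $L,M,V>0$. Define $$\mathcal{F}_{[L,M,V]}=\left\{u\in \mathbf{L}^1([0,L]^n,\mathbb{R})~\Big|~\|u\|_{\mathbf{L}^{\infty}([0,L]^{n})}\leq M,\ |Du|((0,L)^n)\leq V \right\}.$$ Then for every $0<\varepsilon< \frac{ML^n}{8}$, $$\frac{\log_2(e)}{8}\cdot \left\lfloor\frac{VL}{2^{n+2}\varepsilon}\right\rfloor^n~\leq~\mathcal{H}_{\varepsilon}\left(\mathcal{F}_{[L,M,V]}~\Big|~\mathbf{L}^1([0,L]^n)\right)~\leq~\Gamma_{[n,L,M,V]}\cdot \frac{1}{\varepsilon^n},$$ where $$\Gamma_{[n,L,M,V]}~=~\frac{8}{\sqrt{n}}\left(4\sqrt{n}\,LV\right)^n+\left(\frac{2^{n+7}V}{M}+8\right)\cdot \left(\frac{ML^n}{8}\right)^n.$$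
   Context: **$\varepsilon$-entropy.** Let $(X,d)$ be a metric space and $E$ a precompact subset of $X$. For $\varepsilon>0$, $\mathcal{N}_{\varepsilon}(E\,|\,X)$ denotes the minimal number of sets in an $\varepsilon$-covering of $E$, i.e. a covering of $E$ by subsets of $X$ with diameter no greater than $2\varepsilon$. The $\varepsilon$-entropy of $E$ is $\mathcal{H}_{\varepsilon}(E\,|\,X)=\log_2\mathcal{N}_{\varepsilon}(E\,|\,X)$. Here $X=\mathbf{L}^1([0,L]^n)=\mathbf{L}^1([0,L]^n,\mathbb{R})$, the space of (equivalence classes of) Lebesgue-summable real functions, with the metric induced by the usual norm $\|\cdot\|_{\mathbf{L}^1}$. **Total variation.** For an open set $\Omega\subset\mathbb{R}^n$ and $u\in\mathbf{L}^1(\Omega,\mathbb{R})$, $u$ is of bounded variation on $\Omega$ if its distributional derivative is representable by a finite ($\mathbb{R}^n$-valued) Radon measure $Du=(D_1u,\dots,D_nu)$ in $\Omega$, and $$|Du|(\Omega)=\sup\left\{\int_{\Omega}u\,\mathrm{div}(\phi)\,dx~\Big|~\phi\in\mathcal{C}_c^1(\Omega,\mathbb{R}^n),\ \|\phi\|_{\mathbf{L}^{\infty}(\Omega)}\leq 1\right\},$$ where the sup norm of $\phi$ is taken with respect to the Euclidean norm on $\mathbb{R}^n$. The condition $|Du|(\Omega)\leq V$ includes that $u$ is of bounded variation on $\Omega$. **Other notation.** $\|\cdot\|_{\mathbf{L}^\infty}$ is the essential supremum norm; $\lfloor x\rfloor=\max\{z\in\mathbb{Z}\mid z\leq x\}$;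 $e$ is the base of natural logarithms. *)

theory Defs
  imports "HOL-Analysis.Analysis" "HOL-Probability.Essential_Supremum" "HOL-Library.Extended_Nat"
begin

section \<open>Entropy in a metric space\<close>

text \<open>A set has diameter at most \<open>2 * \<epsilon>\<close> iff all its pairwise distances are at most \<open>2 * \<epsilon>\<close>.\<close>

definition eps_covering :: "'a metric \<Rightarrow> real \<Rightarrow> 'a set \<Rightarrow> 'a set set \<Rightarrow> bool" where
  "eps_covering X \<epsilon> E C \<longleftrightarrow>
     C \<subseteq> Pow (mspace X) \<and> E \<subseteq> \<Union>C \<and> (\<forall>A\<in>C. \<forall>x\<in>A. \<forall>y\<in>A. mdist X x y \<le> 2 * \<epsilon>)"

text \<open>The value is \<open>\<infinity>\<close> iff \<open>E\<close> has no finite covering of this kind. For precompact \<open>E\<close>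
  it is a natural number, and the infimum (over natural numbers) is attained. A finite upper
  bound for the entropy thus includes that a finite covering exists.\<close>

definition covering_number :: "'a metric \<Rightarrow> real \<Rightarrow> 'a set \<Rightarrow> enat" where
  "covering_number X \<epsilon> E = (INF C \<in> {C. finite C \<and> eps_covering X \<epsilon> E C}. enat (card C))"

definition eps_entropy :: "'a metric \<Rightarrow> real \<Rightarrow> 'a set \<Rightarrow> ereal" where
  "eps_entropy X \<epsilon> E =
     (case covering_number X \<epsilon> E of enat N \<Rightarrow> ereal (log 2 (real N)) | \<infinity> \<Rightarrow> \<infinity>)"


section \<open>The metric space of equivalence classes of integrable functions\<close>

definition L1_rel :: "'a measure \<Rightarrow> (('a \<Rightarrow> real) \<times> ('a \<Rightarrow> real)) set" where
  "L1_rel \<mu> = {(f, g). integrable \<mu> f \<and> integrable \<mu> g \<and> (AE x in \<mu>. f x = g x)}"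

definition L1_class :: "'a measure \<Rightarrow> ('a \<Rightarrow> real) \<Rightarrow> ('a \<Rightarrow> real) set" where
  "L1_class \<mu> f = L1_rel \<mu> `` {f}"

definition L1_space :: "'a measure \<Rightarrow> ('a \<Rightarrow> real) set set" where
  "L1_space \<mu> = {f. integrable \<mu> f} // L1_rel \<mu>"

text \<open>On \<open>L1_space\<close> the choice of representatives is immaterial, see \<open>L1_dist_class\<close>.\<close>

definition L1_dist :: "'a measure \<Rightarrow> ('a \<Rightarrow> real) set \<Rightarrow> ('a \<Rightarrow> real) set \<Rightarrow> real" where
  "L1_dist \<mu> A B = (LINT x|\<mu>. \<bar>(SOME f. f \<in> A) x - (SOME g. g \<in> B) x\<bar>)"

definition L1_metric :: "'a measure \<Rightarrow> ('a \<Rightarrow> real) set metric" where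
  "L1_metric \<mu> = metric (L1_space \<mu>, L1_dist \<mu>)"

lemma equiv_L1_rel: "equiv {f. integrable \<mu> f} (L1_rel \<mu>)"
proof (rule equivI)
  show "L1_rel \<mu> \<subseteq> {f. integrable \<mu> f} \<times> {f. integrable \<mu> f}"
    by (auto simp: L1_rel_def)
  show "refl_on {f. integrable \<mu> f} (L1_rel \<mu>)"
    by (auto simp: refl_on_def L1_rel_def)
  show "sym (L1_rel \<mu>)"
    by (auto simp: sym_def L1_rel_def elim: eventually_mono)
  show "trans (L1_rel \<mu>)"
    unfolding trans_def L1_rel_def by (auto elim: eventually_elim2)
qed

lemma L1_classE:
  assumes "A \<in> L1_space \<mu>"
  obtains f where "integrable \<mu> f" "A = L1_class \<mu> f"
  using assms unfolding L1_space_def L1_class_def by (auto elim: quotientE)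

lemma L1_class_in_space: "integrable \<mu> f \<Longrightarrow> L1_class \<mu> f \<in> L1_space \<mu>"
  unfolding L1_space_def L1_class_def by (auto intro: quotientI)

lemma L1_class_eq_iff:
  assumes "integrable \<mu> f" "integrable \<mu> g"
  shows "L1_class \<mu> f = L1_class \<mu> g \<longleftrightarrow> (AE x in \<mu>. f x = g x)"
  using eq_equiv_class_iff[OF equiv_L1_rel, of f \<mu> g] assms
  by (auto simp: L1_class_def L1_rel_def)

lemma L1_dist_class:
  assumes f: "integrable \<mu> f" and g: "integrable \<mu> g"
  shows "L1_dist \<mu> (L1_class \<mu> f) (L1_class \<mu> g) = (LINT x|\<mu>. \<bar>f x - g x\<bar>)"
proof -
  have rep: "(SOME h'. h' \<in> L1_class \<mu> h) \<in> L1_class \<mu> h" if "integrable \<mu> h" for h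
    by (rule someI[of _ h]) (use that in \<open>auto simp: L1_class_def L1_rel_def\<close>)
  define f' where "f' = (SOME h. h \<in> L1_class \<mu> f)"
  define g' where "g' = (SOME h. h \<in> L1_class \<mu> g)"
  have f': "integrable \<mu> f'" "AE x in \<mu>. f x = f' x"
    using rep[OF f] by (auto simp: f'_def L1_class_def L1_rel_def)
  have g': "integrable \<mu> g'" "AE x in \<mu>. g x = g' x"
    using rep[OF g] by (auto simp: g'_def L1_class_def L1_rel_def)
  have "(LINT x|\<mu>. \<bar>f' x - g' x\<bar>) = (LINT x|\<mu>. \<bar>f x - g x\<bar>)"
  proof (rule integral_cong_AE)
    show "(\<lambda>x. \<bar>f' x - g' x\<bar>) \<in> borel_measurable \<mu>" "(\<lambda>x. \<bar>f x - g x\<bar>) \<in> borel_measurable \<mu>"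
      using f g f' g' by (auto intro!: borel_measurable_abs borel_measurable_diff)
    show "AE x in \<mu>. \<bar>f' x - g' x\<bar> = \<bar>f x - g x\<bar>"
      using f'(2) g'(2) by eventually_elim simp
  qed
  then show ?thesis by (simp add: L1_dist_def f'_def g'_def)
qed

lemma Metric_space_L1: "Metric_space (L1_space \<mu>) (L1_dist \<mu>)"
proof
  show "0 \<le> L1_dist \<mu> A B" for A B by (simp add: L1_dist_def)
  show "L1_dist \<mu> A B = L1_dist \<mu> B A" for A B
    by (simp add: L1_dist_def abs_minus_commute)
  show "L1_dist \<mu> A B = 0 \<longleftrightarrow> A = B" if AB: "A \<in> L1_space \<mu>" "B \<in> L1_space \<mu>" for A B
  proof -
    obtain f g where fg: "integrable \<mu> f" "A = L1_class \<mu> f" "integrable \<mu> g" "B = L1_class \<mu> g"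
      using AB by (metis L1_classE)
    have "integrable \<mu> (\<lambda>x. \<bar>f x - g x\<bar>)" using fg by auto
    from integral_nonneg_eq_0_iff_AE[OF this]
    show ?thesis using fg by (simp add: L1_dist_class L1_class_eq_iff)
  qed
  show "L1_dist \<mu> A C \<le> L1_dist \<mu> A B + L1_dist \<mu> B C"
    if ABC: "A \<in> L1_space \<mu>" "B \<in> L1_space \<mu>" "C \<in> L1_space \<mu>" for A B C
  proof -
    obtain f g h where *: "integrable \<mu> f" "A = L1_class \<mu> f" "integrable \<mu> g" "B = L1_class \<mu> g"
      "integrable \<mu> h" "C = L1_class \<mu> h"
      using ABC by (metis L1_classE)
    have "(LINT x|\<mu>. \<bar>f x - h x\<bar>) \<le> (LINT x|\<mu>. \<bar>f x - g x\<bar> + \<bar>g x - h x\<bar>)"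
      by (rule integral_mono) (use * in auto)
    also have "\<dots> = (LINT x|\<mu>. \<bar>f x - g x\<bar>) + (LINT x|\<mu>. \<bar>g x - h x\<bar>)"
      by (rule Bochner_Integration.integral_add) (use * in auto)
    finally show ?thesis using * by (simp add: L1_dist_class)
  qed
qed

lemma mspace_L1_metric [simp]: "mspace (L1_metric \<mu>) = L1_space \<mu>"
  and mdist_L1_metric [simp]: "mdist (L1_metric \<mu>) = L1_dist \<mu>"
  using Metric_space.mspace_metric[OF Metric_space_L1]
    Metric_space.mdist_metric[OF Metric_space_L1]
  by (simp_all add: L1_metric_def)


section \<open>Functions of bounded variation\<close>

definition Linf_norm :: "'a measure \<Rightarrow> ('a \<Rightarrow> 'b::real_normed_vector) \<Rightarrow> ereal" where
  "Linf_norm \<mu> f = esssup \<mu> (\<lambda>x. ereal (norm (f x)))"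

primrec Ck :: "nat \<Rightarrow> ('a::euclidean_space \<Rightarrow> 'b::euclidean_space) \<Rightarrow> bool" where
  "Ck 0 f \<longleftrightarrow> continuous_on UNIV f"
| "Ck (Suc k) f \<longleftrightarrow>
     (\<forall>x. f differentiable at x) \<and> (\<forall>v. Ck k (\<lambda>x. frechet_derivative f (at x) v))"

text \<open>Functions with compact support in the open set \<open>\<Omega>\<close> are identified with their
  extensions by zero to the whole space.\<close>

definition Cck :: "nat \<Rightarrow> 'a::euclidean_space set \<Rightarrow> ('a \<Rightarrow> 'b::euclidean_space) set" where
  "Cck k \<Omega> = {\<phi>. Ck k \<phi> \<and> compact (closure {x. \<phi> x \<noteq> 0}) \<and> closure {x. \<phi> x \<noteq> 0} \<subseteq> \<Omega>}"

definition Cc_infinity :: "'a::euclidean_space set \<Rightarrow> ('a \<Rightarrow> 'b::euclidean_space) set" where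
  "Cc_infinity \<Omega> = (\<Inter>k. Cck k \<Omega>)"

definition partial_deriv :: "'n::finite \<Rightarrow> (real^'n \<Rightarrow> real) \<Rightarrow> real^'n \<Rightarrow> real" where
  "partial_deriv i \<phi> x = frechet_derivative \<phi> (at x) (axis i 1)"

definition divergence :: "(real^'n \<Rightarrow> real^'n) \<Rightarrow> real^'n \<Rightarrow> real" where
  "divergence \<phi> x = (\<Sum>i\<in>UNIV. partial_deriv i (\<lambda>y. \<phi> y $ i) x)"

text \<open>The distributional derivative of \<open>u\<close> in \<open>\<Omega>\<close> is the finite vector measure whose \<open>i\<close>-th
  component is the finite signed measure \<open>P i - N i\<close>: by the Jordan decomposition every finite
  signed measure is a difference of two finite measures. On an open subset of Euclidean space all
  finite Borel measures are Radon measures.\<close>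

definition represents_deriv ::
  "(real^'n) set \<Rightarrow> (real^'n \<Rightarrow> real) \<Rightarrow> ('n \<Rightarrow> (real^'n) measure) \<Rightarrow> ('n \<Rightarrow> (real^'n) measure) \<Rightarrow> bool"
where
  "represents_deriv \<Omega> u P N \<longleftrightarrow>
     (\<forall>i. finite_measure (P i) \<and> sets (P i) = sets (restrict_space borel \<Omega>) \<and>
          finite_measure (N i) \<and> sets (N i) = sets (restrict_space borel \<Omega>) \<and>
          (\<forall>\<phi> \<in> Cc_infinity \<Omega>.
             (LINT x|lebesgue_on \<Omega>. u x * partial_deriv i \<phi> x)
               = - ((LINT x|P i. \<phi> x) - (LINT x|N i. \<phi> x))))"

definition bounded_variation_on :: "(real^'n) set \<Rightarrow> (real^'n \<Rightarrow> real) \<Rightarrow> bool" where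
  "bounded_variation_on \<Omega> u \<longleftrightarrow>
     integrable (lebesgue_on \<Omega>) u \<and> (\<exists>P N. represents_deriv \<Omega> u P N)"

definition total_variation :: "(real^'n) set \<Rightarrow> (real^'n \<Rightarrow> real) \<Rightarrow> ereal" where
  "total_variation \<Omega> u =
     (SUP \<phi> \<in> {\<phi> \<in> Cck 1 \<Omega>. Linf_norm (lebesgue_on \<Omega>) \<phi> \<le> 1}.
        ereal (LINT x|lebesgue_on \<Omega>. u x * divergence \<phi> x))"


section \<open>The class of functions and the constant\<close>

definition closed_cube :: "real \<Rightarrow> (real^'n) set" where
  "closed_cube L = {x. \<forall>i. 0 \<le> x $ i \<and> x $ i \<le> L}"

definition open_cube :: "real \<Rightarrow> (real^'n) set" where
  "open_cube L = {x. \<forall>i. 0 < x $ i \<and> x $ i < L}"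

abbreviation L1_cube :: "real \<Rightarrow> (real^'n \<Rightarrow> real) set metric" where
  "L1_cube L \<equiv> L1_metric (lebesgue_on (closed_cube L))"

text \<open>All conditions on \<open>u\<close> depend only on its equivalence class.\<close>

definition BV_class :: "real \<Rightarrow> real \<Rightarrow> real \<Rightarrow> (real^'n \<Rightarrow> real) set set" where
  "BV_class L M V =
     {L1_class (lebesgue_on (closed_cube L)) u | u.
        integrable (lebesgue_on (closed_cube L)) u \<and>
        Linf_norm (lebesgue_on (closed_cube L)) u \<le> ereal M \<and>
        bounded_variation_on (open_cube L) u \<and>
        total_variation (open_cube L) u \<le> ereal V}"

definition Gamma_const :: "nat \<Rightarrow> real \<Rightarrow> real \<Rightarrow> real \<Rightarrow> real" where
  "Gamma_const n L M V =
     8 / sqrt (real n) * (4 * sqrt (real n) * L * V) ^ n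
       + (2 ^ (n + 7) * V / M + 8) * (M * L ^ n / 8) ^ n"

end

theory Submission
  imports Defs
begin

text \<open>
  Upper bound. Cut the cube into \<open>N ^ n\<close> equal cells. Testing \<open>Du\<close> with products of one-dimensional
  bumps shows that the averages of \<open>u\<close> over neighbouring cells have total difference at most
  \<open>(L / N) powr (1 - n) * sqrt n * V\<close>. Applied to finer and finer grids, where halving the cells in one
  direction changes the cell averages only by such differences, the same estimate gives a Poincare
  inequality: replacing \<open>u\<close> by its averages costs at most \<open>sqrt n * V * L / N\<close> in the \<open>L1\<close> norm.
  The averages, rounded to a mesh \<open>h\<close>, are encoded by the value at the origin and the increments along
  a spanning tree of the grid; the increments have bounded \<open>l1\<close> norm, so few codes occur, and two
  functions with the same code are at distance at most \<open>2 * \<epsilon>\<close>.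

  Lower bound. Multiples of indicators of unions of cells lie in the class. Their \<open>L1\<close> distance is a
  multiple of the Hamming distance of the sets of cells, so a set of diameter \<open>2 * \<epsilon>\<close> contains at most
  \<open>2 ^ m * exp (- m / 8)\<close> of the \<open>2 ^ m\<close> functions, where \<open>m = N ^ n\<close>.
\<close>


section \<open>Cells of a grid\<close>

text \<open>A function of bounded variation is met only through test functions, and one direction at
  a time: a field with \<open>n\<close> components bounded by 1 has Euclidean norm at most sqrt n,
  so the directional bounds add up to \<open>sqrt n * V\<close>. This is the sqrt n next to
  \<open>L * V\<close> in \<open>Gamma_const\<close>. The upper bound pays for two parts of a code.
  The value at the origin costs the logarithm of a multiple of
  \<open>M * L ^ n / \<epsilon>\<close>; the increments cost a multiple of \<open>N ^ n\<close>
  bits, with \<open>N\<close> of the order \<open>sqrt n * V * L / \<epsilon>\<close>. The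
  assumption on \<open>\<epsilon>\<close> enters twice. In the upper bound it makes
  \<open>M * L ^ n / \<epsilon>\<close> at least 8, enough to dominate that logarithm. In the lower
  bound it keeps the height \<open>8 * \<epsilon> / L ^ n\<close> of the step functions below
  \<open>M\<close>. That height is dictated by the Hamming cube: diameter
  \<open>2 * \<epsilon>\<close> has to mean a quarter of the cells, the radius at which a Chernoff
  bound gives the factor \<open>exp (- m / 8)\<close>.\<close>

definition cell :: "real \<Rightarrow> ('n \<Rightarrow> nat) \<Rightarrow> ('n \<Rightarrow> nat) \<Rightarrow> (real^'n) set" where
  "cell L m k = {x. \<forall>i. \<lfloor>real (m i) * x $ i / L\<rfloor> = int (k i)}"

text \<open>The number of cells may depend on the direction because grids are halved in one
  direction at a time.\<close>

definition grid :: "('n::finite \<Rightarrow> nat) \<Rightarrow> ('n \<Rightarrow> nat) set" where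
  "grid m = {k. \<forall>i. k i < m i}"

lemma grid_eq_PiE: "grid m = (\<Pi>\<^sub>E i\<in>UNIV. {..<m i})"
  by (auto simp: grid_def PiE_def Pi_def)

lemma finite_grid [simp]: "finite (grid m)"
  by (simp add: grid_eq_PiE finite_PiE)

lemma card_grid: "card (grid m) = (\<Prod>i\<in>UNIV. m i)"
  by (simp add: grid_eq_PiE card_PiE)

text \<open>With this distributive law a sum of product test functions over all cells is bounded
  coordinate by coordinate, with no loss in the number of cells.\<close>

lemma sum_grid_prod:
  fixes f :: "'n::finite \<Rightarrow> nat \<Rightarrow> real"
  shows "(\<Sum>k\<in>grid m. \<Prod>i\<in>UNIV. f i (k i)) = (\<Prod>i\<in>UNIV. \<Sum>j<m i. f i j)"
  by (simp add: grid_eq_PiE prod_sum_PiE)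

lemma cell_unique: "x \<in> cell L m k \<Longrightarrow> x \<in> cell L m k' \<Longrightarrow> k = k'"
  by (auto simp: cell_def fun_eq_iff)

text \<open>Floors make the cells half-open, so they are disjoint exactly and not merely up to null
  sets.\<close>

lemma disjoint_cells: "disjoint_family_on (cell L m) A"
  unfolding disjoint_family_on_def using cell_unique by blast

lemma cell_borel [measurable]: "cell L m k \<in> sets borel"
proof -
  have "cell L m k = {x \<in> space borel. \<forall>i. \<lfloor>real (m i) * x $ i / L\<rfloor> = int (k i)}"
    by (simp add: cell_def)
  also have "\<dots> \<in> sets borel"
    by measurable
  finally show ?thesis .
qed

lemma cell_bounds:
  assumes "L > 0" "m i > 0" "x \<in> cell L m k"
  shows "L * real (k i) / m i \<le> x $ i" "x $ i < L * (real (k i) + 1) / m i"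
proof -
  have "\<lfloor>real (m i) * x $ i / L\<rfloor> = int (k i)"
    using assms by (simp add: cell_def)
  then have "real (k i) \<le> real (m i) * x $ i / L" "real (m i) * x $ i / L < real (k i) + 1"
    by linarith+
  then show "L * real (k i) / m i \<le> x $ i" "x $ i < L * (real (k i) + 1) / m i"
    using assms by (simp_all add: field_simps)
qed

lemma cell_box:
  fixes k m :: "'n::finite \<Rightarrow> nat"
  assumes "L > 0" "\<forall>i. m i > 0"
  shows "box (\<chi> i. L * real (k i) / m i) (\<chi> i. L * (real (k i) + 1) / m i) \<subseteq> cell L m k"
    and "cell L m k \<subseteq> cbox (\<chi> i. L * real (k i) / m i) (\<chi> i. L * (real (k i) + 1) / m i)"
proof -
  show "cell L m k \<subseteq> cbox (\<chi> i. L * real (k i) / m i) (\<chi> i. L * (real (k i) + 1) / m i)"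
    using cell_bounds[OF assms(1) assms(2)[rule_format]] by (fastforce simp: mem_box_cart less_imp_le)
  show "box (\<chi> i. L * real (k i) / m i) (\<chi> i. L * (real (k i) + 1) / m i) \<subseteq> cell L m k"
  proof
    fix x :: "real^'n"
    assume x: "x \<in> box (\<chi> i. L * real (k i) / m i) (\<chi> i. L * (real (k i) + 1) / m i)"
    have "\<lfloor>real (m i) * x $ i / L\<rfloor> = int (k i)" for i
    proof -
      have "L * real (k i) / m i < x $ i" "x $ i < L * (real (k i) + 1) / m i"
        using x by (auto simp: mem_box_cart)
      then have "real (k i) \<le> real (m i) * x $ i / L" "real (m i) * x $ i / L < real (k i) + 1"
        using assms(1) assms(2)[rule_format, of i] by (simp_all add: field_simps)
      then show ?thesis by (intro floor_unique) auto
    qed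
    then show "x \<in> cell L m k" by (simp add: cell_def)
  qed
qed

text \<open>The cell lies between an open and a closed box of equal volume.\<close>

lemma emeasure_cell:
  fixes k m :: "'n::finite \<Rightarrow> nat"
  assumes "L > 0" "\<forall>i. m i > 0"
  shows "emeasure lborel (cell L m k) = ennreal (\<Prod>i\<in>UNIV. L / m i)"
proof -
  let ?a = "(\<chi> i. L * real (k i) / m i) :: real^'n" and ?b = "(\<chi> i. L * (real (k i) + 1) / m i) :: real^'n"
  have d: "?b $ i - ?a $ i = L / m i" for i
    by (simp add: add_divide_distrib ring_distribs)
  have le: "?a \<bullet> b \<le> ?b \<bullet> b" if "b \<in> Basis" for b
    using that assms(1) by (auto simp: Basis_vec_def inner_axis divide_right_mono)
  have p: "(\<Prod>b\<in>Basis. (?b - ?a) \<bullet> b) = (\<Prod>i\<in>UNIV. L / m i)"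
  proof -
    have B: "(Basis :: (real^'n) set) = (\<lambda>i. axis i 1) ` UNIV"
      by (auto simp: Basis_vec_def)
    have "inj (\<lambda>i. axis i (1::real) :: real^'n)" by (auto simp: inj_on_def axis_eq_axis)
    then show ?thesis unfolding B
      by (simp add: prod.reindex inner_axis ring_distribs add_divide_distrib)
  qed
  have "emeasure lborel (box ?a ?b) = ennreal (\<Prod>i\<in>UNIV. L / m i)"
    using le p by (subst emeasure_lborel_box) auto
  moreover have "emeasure lborel (cbox ?a ?b) = ennreal (\<Prod>i\<in>UNIV. L / m i)"
    using le p by (subst emeasure_lborel_cbox) auto
  moreover have "emeasure lborel (box ?a ?b) \<le> emeasure lborel (cell L m k)"
    "emeasure lborel (cell L m k) \<le> emeasure lborel (cbox ?a ?b)"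
    using cell_box[OF assms, of k] by (auto intro!: emeasure_mono)
  ultimately show ?thesis by (metis antisym)
qed

lemma measure_cell:
  fixes k m :: "'n::finite \<Rightarrow> nat"
  assumes "L > 0" "\<forall>i. m i > 0"
  shows "measure lebesgue (cell L m k) = (\<Prod>i\<in>UNIV. L / m i)"
  using emeasure_cell[OF assms, of k] assms(1)
  by (simp add: measure_def prod_nonneg)

lemma cell_lmeasurable:
  fixes k m :: "'n::finite \<Rightarrow> nat"
  assumes "L > 0" "\<forall>i. m i > 0"
  shows "cell L m k \<in> lmeasurable"
  using emeasure_cell[OF assms, of k] by (simp add: fmeasurable_def)

lemma Union_cells:
  fixes m :: "'n::finite \<Rightarrow> nat"
  assumes "L > 0" "\<forall>i. m i > 0"
  shows "(\<Union>k\<in>grid m. cell L m k) = {x. \<forall>i. 0 \<le> x $ i \<and> x $ i < L}"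
proof (intro equalityI subsetI)
  fix x :: "real^'n" assume "x \<in> (\<Union>k\<in>grid m. cell L m k)"
  then obtain k where k: "k \<in> grid m" "x \<in> cell L m k" by auto
  have "0 \<le> x $ i \<and> x $ i < L" for i
  proof -
    have "L * real (k i) / m i \<le> x $ i" "x $ i < L * (real (k i) + 1) / m i"
      using cell_bounds[OF assms(1) assms(2)[rule_format] k(2)] by auto
    moreover have "L * (real (k i) + 1) / m i \<le> L"
    proof -
      have "real (k i) + 1 \<le> real (m i)" using k(1) by (simp add: grid_def) (metis Suc_leI add.commute of_nat_Suc of_nat_le_iff)
      then have "L * (real (k i) + 1) \<le> L * real (m i)" using assms(1) by simp
      then show ?thesis using assms(2)[rule_format, of i] by (simp add: pos_divide_le_eq)
    qed
    moreover have "0 \<le> L * real (k i) / m i" using assms(1) by simp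
    ultimately show ?thesis by linarith
  qed
  then show "x \<in> {x. \<forall>i. 0 \<le> x $ i \<and> x $ i < L}" by auto
next
  fix x :: "real^'n" assume x: "x \<in> {x. \<forall>i. 0 \<le> x $ i \<and> x $ i < L}"
  define k where "k i = nat \<lfloor>real (m i) * x $ i / L\<rfloor>" for i
  have "int (k i) = \<lfloor>real (m i) * x $ i / L\<rfloor> \<and> k i < m i" for i
  proof -
    have "0 \<le> real (m i) * x $ i / L" using x assms by simp
    moreover have "real (m i) * x $ i / L < real (m i)" using x assms by (simp add: field_simps)
    ultimately show ?thesis unfolding k_def by (simp add: floor_less_iff nat_less_iff)
  qed
  then show "x \<in> (\<Union>k\<in>grid m. cell L m k)"
    by (intro UN_I[of k]) (auto simp: grid_def cell_def)
qed

lemma cell_subset_cube: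
  assumes "L > 0" "\<forall>i. m i > 0" "k \<in> grid m"
  shows "cell L m k \<subseteq> closed_cube L"
proof -
  have "cell L m k \<subseteq> {x. \<forall>i. 0 \<le> x $ i \<and> x $ i < L}"
    unfolding Union_cells[OF assms(1,2), symmetric] using assms(3) by blast
  then show ?thesis by (auto simp: closed_cube_def less_imp_le)
qed

section \<open>The open and closed cubes and the null set between them\<close>

lemma open_cube_box: "open_cube L = box 0 (\<chi> i. L)"
  by (auto simp: open_cube_def mem_box_cart)

lemma closed_cube_cbox: "closed_cube L = cbox 0 (\<chi> i. L)"
  by (auto simp: closed_cube_def mem_box_cart)

lemma cube_sets [measurable, simp]: "closed_cube L \<in> sets borel" "open_cube L \<in> sets borel"
  by (simp_all add: open_cube_box closed_cube_cbox)

lemma cube_lmeasurable [simp]: "closed_cube L \<in> lmeasurable" "open_cube L \<in> lmeasurable"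
  by (simp_all add: open_cube_box closed_cube_cbox)

lemma negligible_cube_diff: "negligible (closed_cube L - open_cube L :: (real^'n) set)"
  unfolding open_cube_box closed_cube_cbox
  by (rule negligible_frontier_interval)

lemma AE_open_cube: "AE x in lebesgue. x \<in> closed_cube L \<longleftrightarrow> x \<in> (open_cube L :: (real^'n) set)"
proof -
  have "AE x in lebesgue. x \<notin> (closed_cube L - open_cube L :: (real^'n) set)"
    using negligible_cube_diff by (metis AE_not_in negligible_iff_null_sets)
  then show ?thesis by eventually_elim (auto simp: open_cube_def closed_cube_def less_imp_le)
qed

text \<open>The cells cover only the half-open cube. It lies between the open and the closed cube,
  so the missing upper faces form a null set.\<close>

lemma integral_cube_cells:
  fixes m :: "'n::finite \<Rightarrow> nat" and u :: "real^'n \<Rightarrow> real"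
  assumes L: "L > 0" and m: "\<forall>i. m i > 0"
    and u: "set_integrable lebesgue (closed_cube L) u"
  shows "(LINT x:closed_cube L|lebesgue. u x) = (\<Sum>k\<in>grid m. LINT x:cell L m k|lebesgue. u x)"
proof -
  have U: "(\<Union>k\<in>grid m. cell L m k) \<subseteq> closed_cube L"
    using cell_subset_cube[OF L m] by blast
  have iu: "set_integrable lebesgue (cell L m k) u" if "k \<in> grid m" for k
    using set_integrable_subset[OF u _ cell_subset_cube[OF L m that]] by simp
  have "(LINT x:closed_cube L|lebesgue. u x) = (LINT x:(\<Union>k\<in>grid m. cell L m k)|lebesgue. u x)"
  proof (rule set_integral_cong_set)
    have "open_cube L \<subseteq> (\<Union>k\<in>grid m. cell L m k)"
      unfolding Union_cells[OF L m] by (auto simp: open_cube_def less_imp_le)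
    with U show "AE x in lebesgue. x \<in> (\<Union>k\<in>grid m. cell L m k) \<longleftrightarrow> x \<in> closed_cube L"
      by (intro eventually_mono[OF AE_open_cube]) blast
    have "set_integrable lebesgue (\<Union>k\<in>grid m. cell L m k) u"
      by (rule set_integrable_subset[OF u _ U]) auto
    then show "set_borel_measurable lebesgue (\<Union>k\<in>grid m. cell L m k) u"
      "set_borel_measurable lebesgue (closed_cube L) u"
      using u by (auto simp: set_integrable_def set_borel_measurable_def)
  qed
  also have "\<dots> = (\<Sum>k\<in>grid m. LINT x:cell L m k|lebesgue. u x)"
    using iu by (intro set_integral_finite_Union disjoint_cells) auto
  finally show ?thesis .
qed

section \<open>Test functions\<close>

lemma Ck_1_iff:
  "Ck 1 f \<longleftrightarrow> (\<forall>x. f differentiable at x) \<and> (\<forall>v. continuous_on UNIV (\<lambda>x. frechet_derivative f (at x) v))"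
  by (simp add: One_nat_def)

text \<open>\<open>Ck\<close> refers to \<open>frechet_derivative\<close>, which is a choice; by
  uniqueness any explicitly given derivative may be used in its place.\<close>

lemma Ck_1I:
  assumes "\<And>x. (f has_derivative D x) (at x)" "\<And>v. continuous_on UNIV (\<lambda>x. D x v)"
  shows "Ck 1 f"
proof -
  have "frechet_derivative f (at x) = D x" for x
    using assms(1)[of x] by (metis frechet_derivative_at)
  then show ?thesis
    using assms unfolding Ck_1_iff by (auto simp: differentiable_def)
qed

lemma Ck_1_has_derivative:
  "Ck 1 f \<Longrightarrow> (f has_derivative frechet_derivative f (at x)) (at x)"
  by (simp add: Ck_1_iff frechet_derivative_works[symmetric])

lemma Ck_1_continuous: "Ck 1 f \<Longrightarrow> continuous_on UNIV f"
  by (auto simp: Ck_1_iff intro!: differentiable_imp_continuous_on simp: differentiable_on_def)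

lemma Ck_1_continuous_deriv: "Ck 1 f \<Longrightarrow> continuous_on UNIV (\<lambda>x. frechet_derivative f (at x) v)"
  by (simp add: Ck_1_iff)

lemma Ck_1_const: "Ck 1 (\<lambda>x. c)"
  by (rule Ck_1I[where D = "\<lambda>x v. 0"]) (auto intro!: derivative_eq_intros)

lemma Ck_1_add:
  assumes "Ck 1 f" "Ck 1 g" shows "Ck 1 (\<lambda>x. f x + g x)"
  using assms
  by (intro Ck_1I[where D = "\<lambda>x v. frechet_derivative f (at x) v + frechet_derivative g (at x) v"])
     (auto intro!: has_derivative_add continuous_on_add Ck_1_has_derivative Ck_1_continuous_deriv)

lemma Ck_1_mult:
  fixes f g :: "'a::euclidean_space \<Rightarrow> real"
  assumes "Ck 1 f" "Ck 1 g" shows "Ck 1 (\<lambda>x. f x * g x)"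
proof (rule Ck_1I)
  fix x
  show "((\<lambda>x. f x * g x) has_derivative
      (\<lambda>v. f x * frechet_derivative g (at x) v + frechet_derivative f (at x) v * g x)) (at x)"
    by (rule has_derivative_mult; rule Ck_1_has_derivative; fact)
next
  fix v
  show "continuous_on UNIV (\<lambda>x. f x * frechet_derivative g (at x) v + frechet_derivative f (at x) v * g x)"
    by (rule continuous_on_add; rule continuous_on_mult; rule Ck_1_continuous_deriv Ck_1_continuous; fact)
qed

lemma Ck_1_sum:
  "(\<And>k. k \<in> A \<Longrightarrow> Ck 1 (f k)) \<Longrightarrow> Ck 1 (\<lambda>x. \<Sum>k\<in>A. f k x)"
  by (induction A rule: infinite_finite_induct) (auto intro: Ck_1_add Ck_1_const simp del: Ck.simps One_nat_def)

lemma Ck_1_prod: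
  fixes f :: "'k \<Rightarrow> 'a::euclidean_space \<Rightarrow> real"
  shows "(\<And>k. k \<in> A \<Longrightarrow> Ck 1 (f k)) \<Longrightarrow> Ck 1 (\<lambda>x. \<Prod>k\<in>A. f k x)"
  by (induction A rule: infinite_finite_induct) (auto intro: Ck_1_mult Ck_1_const simp del: Ck.simps One_nat_def)

lemma Ck_1_coordinate:
  fixes g :: "real \<Rightarrow> real"
  assumes g: "\<And>y. (g has_real_derivative g' y) (at y)" and g': "continuous_on UNIV g'"
  shows "Ck 1 (\<lambda>x :: real^'n. g (c * x $ j - d))"
proof (rule Ck_1I)
  fix x :: "real^'n"
  have "((\<lambda>x :: real^'n. c * x $ j - d) has_derivative (\<lambda>v. c * v $ j)) (at x)"
    by (auto intro!: derivative_eq_intros bounded_linear.has_derivative[OF bounded_linear_vec_nth])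
  from has_derivative_compose[OF this g[of "c * x $ j - d", unfolded has_field_derivative_def]]
  show "((\<lambda>x :: real^'n. g (c * x $ j - d)) has_derivative (\<lambda>v. g' (c * x $ j - d) * (c * v $ j))) (at x)" .
next
  fix v :: "real^'n"
  show "continuous_on UNIV (\<lambda>x :: real^'n. g' (c * x $ j - d) * (c * v $ j))"
    by (intro continuous_intros continuous_on_compose2[OF g']) auto
qed

lemma partial_deriv_line:
  assumes "\<psi> differentiable at x"
  shows "((\<lambda>t. \<psi> (x + t *\<^sub>R axis i 1)) has_real_derivative partial_deriv i \<psi> x) (at 0)"
proof -
  have h: "(\<psi> has_derivative frechet_derivative \<psi> (at x)) (at (x + 0 *\<^sub>R axis i 1))"
    using assms by (simp add: frechet_derivative_works)
  have "((\<lambda>t. x + t *\<^sub>R axis i 1) has_derivative (\<lambda>t. t *\<^sub>R axis i 1)) (at 0)"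
    by (auto intro!: derivative_eq_intros)
  from has_derivative_compose[OF this h]
  have "((\<lambda>t. \<psi> (x + t *\<^sub>R axis i 1)) has_derivative (\<lambda>t. frechet_derivative \<psi> (at x) (t *\<^sub>R axis i 1))) (at 0)" .
  moreover have "frechet_derivative \<psi> (at x) (t *\<^sub>R axis i 1) = partial_deriv i \<psi> x * t" for t
    using linear_scale[OF linear_frechet_derivative[OF assms]] by (simp add: partial_deriv_def)
  ultimately show ?thesis by (simp add: has_field_derivative_def)
qed

text \<open>Reduces partial derivatives of product test functions to the calculus of one variable,
  where only the factor in direction \<open>i\<close> moves.\<close>

lemma partial_deriv_line_unique:
  assumes "\<psi> differentiable at x"
    "((\<lambda>t. \<psi> (x + t *\<^sub>R axis i 1)) has_real_derivative d) (at 0)"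
  shows "partial_deriv i \<psi> x = d"
  using partial_deriv_line[OF assms(1)] assms(2) by (rule DERIV_unique)

lemma Ck_1_partial_deriv: "Ck 1 \<psi> \<Longrightarrow> continuous_on UNIV (partial_deriv i \<psi>)"
  using Ck_1_continuous_deriv[of \<psi> "axis i 1"] by (simp add: partial_deriv_def[abs_def])

lemma Ck_1_differentiable: "Ck 1 f \<Longrightarrow> f differentiable at x"
  by (simp add: Ck_1_iff)

text \<open>Truncated powers of degree at least 2 are differentiable also at 0, where the difference
  quotient is a truncated power of positive degree. Their shifts combine into piecewise polynomial
  bumps with explicit antiderivatives.\<close>

lemma DERIV_max_power:
  "((\<lambda>z. max 0 z ^ Suc (Suc k)) has_real_derivative real (Suc (Suc k)) * max 0 x ^ Suc k) (at x)"
proof (cases "x = 0")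
  case True
  have "((\<lambda>h. max 0 h ^ Suc k) \<longlongrightarrow> max 0 0 ^ Suc k) (at (0::real))"
    by (intro tendsto_intros)
  then have "((\<lambda>h. max 0 h ^ Suc k) \<longlongrightarrow> 0) (at (0::real))" by simp
  then have "((\<lambda>h. (max 0 (0 + h) ^ Suc (Suc k) - max 0 0 ^ Suc (Suc k)) / h) \<longlongrightarrow> 0) (at (0::real))"
  proof (rule Lim_transform_eventually)
    show "\<forall>\<^sub>F h in at (0::real). max 0 h ^ Suc k = (max 0 (0 + h) ^ Suc (Suc k) - max 0 0 ^ Suc (Suc k)) / h"
      by (auto simp: eventually_at_filter max_def)
  qed
  then show ?thesis using True by (simp add: DERIV_def)
next
  case False
  show ?thesis
  proof (cases "x > 0")
    case True
    have "((\<lambda>z. z ^ Suc (Suc k)) has_real_derivative real (Suc (Suc k)) * max 0 x ^ Suc k) (at x)"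
      using DERIV_pow[of "Suc (Suc k)" x] True by (simp only: max.absorb2 less_imp_le diff_Suc_1 diff_Suc_Suc diff_zero)
    then show ?thesis
      by (rule has_field_derivative_transform_within_open[of _ _ _ "{0<..}"]) (use True in auto)
  next
    case f: False
    have "((\<lambda>z. 0) has_real_derivative real (Suc (Suc k)) * max 0 x ^ Suc k) (at x)"
      using f by (auto intro!: derivative_eq_intros)
    then show ?thesis
      by (rule has_field_derivative_transform_within_open[of _ _ _ "{..<0}"]) (use f False in auto)
  qed
qed

text \<open>\<open>\<beta> p\<close> is a plateau that tends to the indicator of (0, 1), and
  \<open>\<Theta> p\<close> is an antiderivative of it. Both are provided because
  \<open>\<Theta> p z - \<Theta> p (z - 1)\<close> is a hat over two neighbouring unit intervals
  whose derivative is the difference of their plateaus.\<close>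

lemma bump_exists:
  obtains \<beta> \<beta>' \<Theta> :: "nat \<Rightarrow> real \<Rightarrow> real" and a :: "nat \<Rightarrow> real"
  where "\<And>p y. (\<beta> p has_real_derivative \<beta>' p y) (at y)" "\<And>p. continuous_on UNIV (\<beta>' p)"
    "\<And>p y. (\<Theta> p has_real_derivative \<beta> p y) (at y)"
    "\<And>p y. 0 \<le> \<beta> p y" "\<And>p y. \<beta> p y \<le> 1" "\<And>p. a p > 0" "\<And>p. a p < 1 / 2"
    "\<And>p y. y < a p \<Longrightarrow> \<beta> p y = 0" "\<And>p y. y > 1 - a p \<Longrightarrow> \<beta> p y = 0"
    "\<And>p y. 0 \<le> \<Theta> p y" "\<And>p y. \<Theta> p y \<le> 1" "\<And>p y. y < a p \<Longrightarrow> \<Theta> p y = 0"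
    "\<And>p y. y > 1 - a p \<Longrightarrow> \<Theta> p y = \<Theta> p 1"
    "\<And>y. 0 < y \<Longrightarrow> y < 1 \<Longrightarrow> (\<lambda>p. \<beta> p y) \<longlonglongrightarrow> 1"
proof -
  define S1 :: "real \<Rightarrow> real" where "S1 z = 4 * max 0 z ^ Suc 0 - 8 * max 0 (z - 1/2) ^ Suc 0 + 4 * max 0 (z - 1) ^ Suc 0" for z
  define S :: "real \<Rightarrow> real" where "S z = 2 * max 0 z ^ Suc (Suc 0) - 4 * max 0 (z - 1/2) ^ Suc (Suc 0) + 2 * max 0 (z - 1) ^ Suc (Suc 0)" for z
  define T :: "real \<Rightarrow> real" where "T z = 2/3 * (max 0 z ^ Suc (Suc (Suc 0)) - 2 * max 0 (z - 1/2) ^ Suc (Suc (Suc 0)) + max 0 (z - 1) ^ Suc (Suc (Suc 0)))" for z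
  \<comment> \<open>\<open>S\<close> is a \<open>C1\<close> ramp from 0 to 1 over the unit interval, with derivative \<open>S1\<close> and antiderivative \<open>T\<close>.\<close>
  have shift: "((\<lambda>z. max 0 (z - c) ^ Suc (Suc k)) has_real_derivative real (Suc (Suc k)) * max 0 (x - c) ^ Suc k) (at x)" for k c x
  proof -
    have "((\<lambda>z. z - c) has_real_derivative 1) (at x)"
      by (auto intro!: derivative_eq_intros)
    from DERIV_chain2[OF DERIV_max_power this] show ?thesis by (simp only: mult_1_right)
  qed
  have S: "(S has_real_derivative S1 z) (at z)" for z
    unfolding S_def S1_def
    by (rule derivative_eq_intros DERIV_max_power shift refl | simp)+
  have T: "(T has_real_derivative S z) (at z)" for z
    unfolding T_def S_def
    by (rule derivative_eq_intros DERIV_max_power shift refl | simp)+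
  have S1_cont: "continuous_on UNIV S1"
    unfolding S1_def by (intro continuous_intros)
  have S1_nonneg: "S1 z \<ge> 0" for z
    by (auto simp: S1_def max_def)
  have S_mono: "S x \<le> S y" if "x \<le> y" for x y
    using DERIV_nonneg_imp_nondecreasing[OF that, of S] S S1_nonneg by blast
  have S0: "S z = 0" if "z \<le> 0" for z using that by (simp add: S_def max_def)
  have S1': "S z = 1" if "z \<ge> 1" for z using that
    by (simp add: S_def max_def) (simp add: power2_eq_square algebra_simps)
  have S_nonneg: "S z \<ge> 0" for z
    using S_mono[of "min z 0" z] S0[of "min z 0"] by auto
  have S_le: "S z \<le> 1" for z
    using S_mono[of z "max z 1"] S1'[of "max z 1"] by auto
  have T0: "T z = 0" if "z \<le> 0" for z using that by (simp add: T_def max_def)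
  \<comment> \<open>\<open>\<beta> p\<close> will rise on [1/q, 2/q] and fall on [1 - 2/q, 1 - 1/q];
    for q at least 4 these ramps do not cross.\<close>
  define q where "q p = real p + 4" for p :: nat
  have q: "q p \<ge> 4" for p by (simp add: q_def)
  have qa: "1 / q p > 0" "1 / q p < 1 / 2" for p
    using q[of p] by (simp_all add: field_simps)
  define \<beta> where "\<beta> p y = S (q p * y - 1) - S (q p * y - (q p - 2))" for p y
  define \<beta>' where "\<beta>' p y = q p * S1 (q p * y - 1) - q p * S1 (q p * y - (q p - 2))" for p y
  define \<Theta> where "\<Theta> p y = T (q p * y - 1) / q p - T (q p * y - (q p - 2)) / q p" for p y
  have lin: "((\<lambda>y. c * y - d) has_real_derivative c) (at y)" for c d y :: real
    by (auto intro!: derivative_eq_intros)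
  have b': "(\<beta> p has_real_derivative \<beta>' p y) (at y)" for p y
    unfolding \<beta>_def \<beta>'_def
    by (auto intro!: derivative_eq_intros DERIV_chain2[OF S lin])
  have b'c: "continuous_on UNIV (\<beta>' p)" for p
    unfolding \<beta>'_def by (intro continuous_intros continuous_on_compose2[OF S1_cont]) auto
  have Th: "(\<Theta> p has_real_derivative \<beta> p y) (at y)" for p y
    unfolding \<Theta>_def \<beta>_def using q[of p]
    by (auto intro!: derivative_eq_intros DERIV_chain2[OF T lin])
  have b0: "0 \<le> \<beta> p y" for p y
    unfolding \<beta>_def using S_mono[of "q p * y - (q p - 2)" "q p * y - 1"] q[of p] by simp
  have b1: "\<beta> p y \<le> 1" for p y
    unfolding \<beta>_def using S_le[of "q p * y - 1"] S_nonneg[of "q p * y - (q p - 2)"] by simp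
  have bl: "\<beta> p y = 0" if "y < 1 / q p" for p y
  proof -
    have "q p * y < 1" using that q[of p] by (simp add: field_simps)
    then show ?thesis unfolding \<beta>_def using q[of p] by (simp add: S0)
  qed
  have br: "\<beta> p y = 0" if "y > 1 - 1 / q p" for p y
  proof -
    have "q p * y > q p - 1" using that q[of p] by (simp add: field_simps)
    then show ?thesis unfolding \<beta>_def using q[of p] by (simp add: S1')
  qed
  have Thm: "\<Theta> p x \<le> \<Theta> p y" if "x \<le> y" for p x y
    using DERIV_nonneg_imp_nondecreasing[OF that, of "\<Theta> p"] Th b0 by blast
  have Thl: "\<Theta> p y = 0" if "y < 1 / q p" for p y
  proof -
    have "q p * y < 1" using that q[of p] by (simp add: field_simps)
    then show ?thesis unfolding \<Theta>_def using q[of p] by (simp add: T0)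
  qed
  have Thc: "\<Theta> p x = \<Theta> p y" if "x \<le> y" "x > 1 - 1 / q p" for p x y
  proof (rule antisym)
    show "\<Theta> p x \<le> \<Theta> p y" by (rule Thm[OF that(1)])
    show "\<Theta> p x \<ge> \<Theta> p y"
    proof (rule DERIV_nonpos_imp_nonincreasing[OF that(1)])
      fix z assume "x \<le> z"
      with that have "\<beta> p z = 0" by (intro br) auto
      then show "\<exists>d. (\<Theta> p has_real_derivative d) (at z) \<and> d \<le> 0"
        using Th by force
    qed
  qed
  have Thr: "\<Theta> p y = \<Theta> p 1" if "y > 1 - 1 / q p" for p y
    using Thc[of 1 y] Thc[of y 1] that q[of p] by (cases "y \<le> 1") auto
  have Th1: "\<Theta> p 1 \<le> 1" for p
  proof -
    have "\<Theta> p 1 - 1 \<le> \<Theta> p 0 - 0"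
    proof (rule DERIV_nonpos_imp_nonincreasing[of 0 1 "\<lambda>y. \<Theta> p y - y"])
      fix z :: real
      have "((\<lambda>y. \<Theta> p y - y) has_real_derivative \<beta> p z - 1) (at z)"
        by (auto intro!: derivative_eq_intros Th)
      then show "\<exists>d. ((\<lambda>y. \<Theta> p y - y) has_real_derivative d) (at z) \<and> d \<le> 0"
        using b1[of p z] by (intro exI[of _ "\<beta> p z - 1"]) auto
    qed simp
    moreover have "\<Theta> p 0 = 0" using Thl[of 0 p] q[of p] by auto
    ultimately show ?thesis by simp
  qed
  have Th0: "0 \<le> \<Theta> p y" for p y
  proof (cases "y \<le> 0")
    case True
    then have "y < 1 / q p" using qa(1)[of p] by linarith
    then show ?thesis using Thl by simp
  next
    case False
    then have "\<Theta> p 0 \<le> \<Theta> p y" by (intro Thm) simp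
    then show ?thesis using Thl[of 0 p] qa(1)[of p] by simp
  qed
  have Thle: "\<Theta> p y \<le> 1" for p y
  proof (cases "y \<le> 1")
    case True
    then show ?thesis using Thm[of y 1 p] Th1[of p] by simp
  next
    case False
    then have "y > 1 - 1 / q p" using qa(1)[of p] by linarith
    then show ?thesis using Thr Th1[of p] by simp
  qed
  have lim: "(\<lambda>p. \<beta> p y) \<longlonglongrightarrow> 1" if y: "0 < y" "y < 1" for y
  proof (rule tendsto_eventually)
    \<comment> \<open>For \<open>p\<close> from this \<open>N\<close> on, the point \<open>y\<close>
      lies between the two ramps, so the plateau value 1 is attained and not only
      approached.\<close>
    obtain N :: nat where N: "N > 2 / y + 2 / (1 - y)" using reals_Archimedean2 by blast
    have "\<beta> p y = 1" if "p \<ge> N" for p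
    proof -
      have 1: "2 / y > 0" "2 / (1 - y) > 0" using y by auto
      have qp: "q p \<ge> real N" using that by (simp add: q_def)
      have "q p > 2 / y" "q p > 2 / (1 - y)" using N qp 1 by linarith+
      then have "q p * y > 2" "q p * (1 - y) > 2" using y by (simp_all add: field_simps)
      then show ?thesis unfolding \<beta>_def by (simp add: S1' S0 algebra_simps)
    qed
    then show "\<forall>\<^sub>F p in sequentially. \<beta> p y = 1" by (auto simp: eventually_sequentially)
  qed
  show ?thesis
    by (rule that[of \<beta> \<beta>' \<Theta> "\<lambda>p. 1 / q p"]; fact)
qed

section \<open>Differences of neighbouring cell averages\<close>

text \<open>\<open>W\<close> bounds the variation \<open>\<bar>D\<^sub>i u\<bar>\<close> of a single partial derivative on the open cube.\<close>

definition dir_var_le :: "'n::finite \<Rightarrow> real \<Rightarrow> (real^'n \<Rightarrow> real) \<Rightarrow> real \<Rightarrow> bool" where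
  "dir_var_le i L u W \<longleftrightarrow> (\<forall>\<psi>\<in>Cck 1 (open_cube L). (\<forall>x. \<bar>\<psi> x\<bar> \<le> 1) \<longrightarrow>
     (LINT x:open_cube L|lebesgue. u x * partial_deriv i \<psi> x) \<le> W)"

text \<open>The open cell in the rescaled coordinates in which the bumps live. The bumps vanish at 0
  and 1, so their products converge to its indicator everywhere, with no exceptional set.\<close>

definition ocell :: "real \<Rightarrow> ('n \<Rightarrow> nat) \<Rightarrow> ('n \<Rightarrow> nat) \<Rightarrow> (real^'n) set" where
  "ocell L m k = {x. \<forall>j. 0 < real (m j) / L * x $ j - real (k j) \<and> real (m j) / L * x $ j - real (k j) < 1}"

lemma ocell_box:
  fixes k m :: "'n::finite \<Rightarrow> nat"
  assumes "L > 0" "\<forall>i. m i > 0"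
  shows "ocell L m k = box (\<chi> i. L * real (k i) / m i) (\<chi> i. L * (real (k i) + 1) / m i)"
proof -
  have "(0 < real (m j) / L * x $ j - real (k j) \<and> real (m j) / L * x $ j - real (k j) < 1) \<longleftrightarrow>
    (L * real (k j) / m j < x $ j \<and> x $ j < L * (real (k j) + 1) / m j)" for j and x :: "real^'n"
    using assms(1) assms(2)[rule_format, of j] by (simp add: pos_divide_less_eq pos_less_divide_eq less_diff_eq diff_less_eq mult.commute add.commute)
  then show ?thesis by (simp add: ocell_def set_eq_iff mem_box_cart)
qed

lemma ocell_sets [measurable]:
  fixes k m :: "'n::finite \<Rightarrow> nat"
  assumes "L > 0" "\<forall>i. m i > 0"
  shows "ocell L m k \<in> sets lebesgue"
  by (simp add: ocell_box[OF assms])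

lemma AE_ocell:
  fixes k m :: "'n::finite \<Rightarrow> nat"
  assumes "L > 0" "\<forall>i. m i > 0"
  shows "AE x in lebesgue. x \<in> cell L m k \<longleftrightarrow> x \<in> ocell L m k"
proof -
  let ?a = "(\<chi> i. L * real (k i) / m i) :: real^'n" and ?b = "(\<chi> i. L * (real (k i) + 1) / m i) :: real^'n"
  have "AE x in lebesgue. x \<notin> cbox ?a ?b - box ?a ?b"
    by (rule AE_not_in) (simp only: negligible_iff_null_sets[symmetric] negligible_frontier_interval)
  then show ?thesis
    by (rule eventually_mono) (use cell_box[OF assms, of k] ocell_box[OF assms, of k] in blast)
qed

text \<open>The two cell indicators differ, up to smoothing, by the \<open>i\<close>-th derivative of a hat function in
  direction \<open>i\<close> times cut-offs in the other directions. The hat functions of the cells along a line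
  telescope, so their signed sum is a test function bounded by a constant.\<close>

lemma shift_difference_le:
  fixes u :: "real^'n \<Rightarrow> real" and m :: "'n::finite \<Rightarrow> nat"
  assumes L: "L > 0" and m: "\<forall>i. m i > 0"
    and u: "set_integrable lebesgue (closed_cube L) u" and W: "dir_var_le i L u W"
  shows "(\<Sum>k\<in>{k\<in>grid m. Suc (k i) < m i}.
      \<bar>(LINT x:cell L m (k(i := Suc (k i)))|lebesgue. u x) - (LINT x:cell L m k|lebesgue. u x)\<bar>)
    \<le> L / m i * W"
proof -
  have uo: "set_integrable lebesgue (open_cube L) u"
    by (rule set_integrable_subset[OF u]) (auto simp: open_cube_def closed_cube_def less_imp_le)
  obtain \<beta> \<beta>' \<Theta> :: "nat \<Rightarrow> real \<Rightarrow> real" and a :: "nat \<Rightarrow> real"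
    where \<beta>: "\<And>p y. (\<beta> p has_real_derivative \<beta>' p y) (at y)" "\<And>p. continuous_on UNIV (\<beta>' p)"
    and \<Theta>: "\<And>p y. (\<Theta> p has_real_derivative \<beta> p y) (at y)"
    and \<beta>01: "\<And>p y. 0 \<le> \<beta> p y" "\<And>p y. \<beta> p y \<le> 1"
    and a: "\<And>p. a p > 0" "\<And>p. a p < 1 / 2"
    and \<beta>0: "\<And>p y. y < a p \<Longrightarrow> \<beta> p y = 0" "\<And>p y. y > 1 - a p \<Longrightarrow> \<beta> p y = 0"
    and \<Theta>01: "\<And>p y. 0 \<le> \<Theta> p y" "\<And>p y. \<Theta> p y \<le> 1"
    and \<Theta>0: "\<And>p y. y < a p \<Longrightarrow> \<Theta> p y = 0" "\<And>p y. y > 1 - a p \<Longrightarrow> \<Theta> p y = \<Theta> p 1"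
    and lim: "\<And>y. 0 < y \<Longrightarrow> y < 1 \<Longrightarrow> (\<lambda>p. \<beta> p y) \<longlonglongrightarrow> 1"
    by (rule bump_exists) blast
  define K where "K = {k\<in>grid m. Suc (k i) < m i}"
  have finK [simp]: "finite K" and K_grid: "K \<subseteq> grid m" by (auto simp: K_def)
  define e where "e k = k(i := Suc (k i))" for k :: "'n \<Rightarrow> nat"
  define I where "I k = (LINT x:cell L m k|lebesgue. u x)" for k
  \<comment> \<open>The \<open>i\<close>-th derivative of the hat at \<open>k\<close> tends to a
    multiple of the indicator of \<open>k\<close> minus that of \<open>e k\<close>; these signs turn
    the sum over \<open>k\<close> into a sum of absolute values.\<close>
  define \<sigma> where "\<sigma> k = sgn (I k - I (e k))" for k
  have \<sigma>: "\<bar>\<sigma> k\<bar> \<le> 1" for k by (simp add: \<sigma>_def abs_sgn_eq)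
  define y where "y j x = real (m j) / L * x $ j" for j and x :: "real^'n"
  define g where "g p j z = (if j = i then \<Theta> p z - \<Theta> p (z - 1) else \<beta> p z)" for p j z
  define \<psi> where "\<psi> p x = (\<Sum>k\<in>K. \<sigma> k * (\<Prod>j\<in>UNIV. g p j (y j x - real (k j))))" for p x
  define B where "B p k x = (\<Prod>j\<in>UNIV. \<beta> p (y j x - real (k j)))" for p k x
  define D where "D p x = real (m i) / L * (\<Sum>k\<in>K. \<sigma> k * (B p k x - B p (e k) x))" for p x
  have g_deriv: "\<exists>g'. (\<forall>z. (g p j has_real_derivative g' z) (at z)) \<and> continuous_on UNIV g'" for p j
  proof (cases "j = i")
    case True
    have "((\<lambda>z. \<Theta> p z - \<Theta> p (z - 1)) has_real_derivative \<beta> p z - \<beta> p (z - 1)) (at z)" for z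
    proof -
      have "((\<lambda>z. z - 1) has_real_derivative 1) (at z)"
        by (auto intro!: derivative_eq_intros)
      from DERIV_chain2[OF \<Theta> this] have "((\<lambda>z. \<Theta> p (z - 1)) has_real_derivative \<beta> p (z - 1)) (at z)" by simp
      then show ?thesis by (intro DERIV_diff \<Theta>)
    qed
    moreover have cb: "continuous_on UNIV (\<beta> p)"
      using \<beta>(1) by (intro DERIV_continuous_on) auto
    have "continuous_on UNIV (\<lambda>z. \<beta> p z - \<beta> p (z - 1))"
      by (intro continuous_intros cb continuous_on_compose2[OF cb]) auto
    ultimately show ?thesis using True by (intro exI[of _ "\<lambda>z. \<beta> p z - \<beta> p (z - 1)"]) (simp add: g_def[abs_def])
  next
    case False
    then have "g p j = \<beta> p" by (simp add: g_def fun_eq_iff)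
    then show ?thesis using \<beta> by auto
  qed
  have C1: "Ck 1 (\<psi> p)" for p
    unfolding \<psi>_def
  proof (intro Ck_1_sum Ck_1_mult Ck_1_const Ck_1_prod)
    fix k j
    obtain g' where "\<And>z. (g p j has_real_derivative g' z) (at z)" "continuous_on UNIV g'"
      using g_deriv[of p j] by blast
    then show "Ck 1 (\<lambda>x. g p j (y j x - real (k j)))"
      unfolding y_def by (rule Ck_1_coordinate)
  qed
  have \<Theta>_mono: "\<Theta> p x \<le> \<Theta> p z" if "x \<le> z" for p x z
    using DERIV_nonneg_imp_nondecreasing[OF that, of "\<Theta> p"] \<Theta> \<beta>01(1) by blast
  have g0: "0 \<le> g p j z" for p j z
    using \<Theta>_mono[of "z - 1" z p] \<beta>01(1) by (simp add: g_def)
  have g_sum: "(\<Sum>l<M. g p j (z - real l)) \<le> 1" for M p j z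
  proof (cases "j = i")
    case True
    have "(\<Sum>l<M. g p j (z - real l)) = (\<Sum>l<M. \<Theta> p (z - real l) - \<Theta> p (z - real (Suc l)))"
      using True by (simp add: g_def algebra_simps)
    also have "\<dots> = \<Theta> p (z - real 0) - \<Theta> p (z - real M)"
      by (rule sum_lessThan_telescope')
    also have "\<dots> \<le> 1" using \<Theta>01(2)[of p z] \<Theta>01(1)[of p "z - real M"] by simp
    finally show ?thesis .
  next
    case False
    \<comment> \<open>The shifted plateaus have disjoint supports, so only the \<open>l\<close> with
      \<open>l \<le> z < l + 1\<close> can contribute.\<close>
    have "(\<Sum>l<M. g p j (z - real l)) \<le> (\<Sum>l<M. if l = nat \<lfloor>z\<rfloor> then 1 else 0)"
    proof (rule sum_mono)
      fix l assume "l \<in> {..<M}"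
      show "g p j (z - real l) \<le> (if l = nat \<lfloor>z\<rfloor> then 1 else 0)"
      proof (cases "0 \<le> z - real l \<and> z - real l < 1")
        case True
        then have "\<lfloor>z\<rfloor> = int l" by (intro floor_unique) auto
        then show ?thesis using False \<beta>01(2) by (simp add: g_def)
      next
        case f: False
        then have "\<beta> p (z - real l) = 0"
          using \<beta>0(1)[of "z - real l" p] \<beta>0(2)[of p "z - real l"] a(1)[of p] by argo
        then show ?thesis using False by (simp add: g_def)
      qed
    qed
    also have "\<dots> \<le> 1" by (simp add: sum.delta)
    finally show ?thesis .
  qed
  have bound: "\<bar>\<psi> p x\<bar> \<le> 1" for p x
  proof -
    have "\<bar>\<psi> p x\<bar> \<le> (\<Sum>k\<in>K. \<bar>\<sigma> k * (\<Prod>j\<in>UNIV. g p j (y j x - real (k j)))\<bar>)"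
      unfolding \<psi>_def by (rule sum_abs)
    also have "\<dots> \<le> (\<Sum>k\<in>K. \<Prod>j\<in>UNIV. g p j (y j x - real (k j)))"
    proof (rule sum_mono)
      fix k
      have "0 \<le> (\<Prod>j\<in>UNIV. g p j (y j x - real (k j)))" by (intro prod_nonneg) (simp add: g0)
      then show "\<bar>\<sigma> k * (\<Prod>j\<in>UNIV. g p j (y j x - real (k j)))\<bar> \<le> (\<Prod>j\<in>UNIV. g p j (y j x - real (k j)))"
        using \<sigma>[of k] by (simp add: abs_mult mult_left_le_one_le)
    qed
    also have "\<dots> \<le> (\<Sum>k\<in>grid m. \<Prod>j\<in>UNIV. g p j (y j x - real (k j)))"
      by (rule sum_mono2) (auto simp: K_grid intro!: prod_nonneg g0)
    \<comment> \<open>Each coordinate contributes a factor of at most 1: by telescoping in direction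
      \<open>i\<close>, by disjoint supports in the others. So the bound does not grow with the
      number of cells.\<close>
    also have "\<dots> = (\<Prod>j\<in>UNIV. \<Sum>l<m j. g p j (y j x - real l))"
      by (rule sum_grid_prod)
    also have "\<dots> \<le> 1"
      by (intro prod_le_1 conjI sum_nonneg g0 g_sum)
    finally show ?thesis .
  qed
  have supp: "\<exists>a b. {x. \<psi> p x \<noteq> 0} \<subseteq> cbox a b \<and> cbox a b \<subseteq> open_cube L" for p
  proof (intro exI conjI)
    let ?a = "(\<chi> j. a p * L / m j) :: real^'n" and ?b = "(\<chi> j. L - a p * L / m j) :: real^'n"
    show "{x. \<psi> p x \<noteq> 0} \<subseteq> cbox ?a ?b"
    proof
      fix x assume "x \<in> {x. \<psi> p x \<noteq> 0}"
      then have "(\<Sum>k\<in>K. \<sigma> k * (\<Prod>j\<in>UNIV. g p j (y j x - real (k j)))) \<noteq> 0" by (simp add: \<psi>_def)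
      then obtain k where k: "k \<in> K" "\<sigma> k * (\<Prod>j\<in>UNIV. g p j (y j x - real (k j))) \<noteq> 0"
        by (meson sum.not_neutral_contains_not_neutral)
      have "a p \<le> y j x \<and> y j x \<le> real (m j) - a p" for j
      proof -
        have nz: "g p j (y j x - real (k j)) \<noteq> 0" using k(2) by auto
        show ?thesis
        proof (cases "j = i")
          case True
          have "a p \<le> y j x - real (k j)"
          proof (rule ccontr)
            assume "\<not> ?thesis"
            then show False using nz True \<Theta>0(1)[of "y j x - real (k j)" p] \<Theta>0(1)[of "y j x - real (k j) - 1" p]
              by (simp add: g_def)
          qed
          moreover have "y j x - real (k j) - 1 \<le> 1 - a p"
          proof (rule ccontr)
            assume "\<not> ?thesis"
            then show False using nz True \<Theta>0(2)[of p "y j x - real (k j)"] \<Theta>0(2)[of p "y j x - real (k j) - 1"]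
              by (simp add: g_def)
          qed
          \<comment> \<open>The hat occupies two cells in direction \<open>i\<close>, and
            \<open>k \<in> K\<close> keeps the second one inside the cube.\<close>
          moreover have "real (k j) + 2 \<le> real (m j)" using k(1) True by (simp add: K_def)
          ultimately show ?thesis by linarith
        next
          case False
          have "\<beta> p (y j x - real (k j)) \<noteq> 0" using nz False by (simp add: g_def)
          then have "a p \<le> y j x - real (k j)" "y j x - real (k j) \<le> 1 - a p"
            using \<beta>0(1)[of "y j x - real (k j)" p] \<beta>0(2)[of p "y j x - real (k j)"] by force+
          moreover have "real (k j) + 1 \<le> real (m j)"
          proof -
            have "Suc (k j) \<le> m j" using k(1) K_grid by (auto simp: grid_def Suc_le_eq)
            then show ?thesis by linarith
          qed
          ultimately show ?thesis by linarith
        qed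
      qed
      then show "x \<in> cbox ?a ?b"
        using L m by (simp add: mem_box_cart y_def field_simps)
    qed
    have "0 < a p * L / m j" for j using a(1) L m by simp
    then show "cbox ?a ?b \<subseteq> open_cube L"
    proof (intro subsetI)
      fix x assume "x \<in> cbox ?a ?b"
      then have "a p * L / m j \<le> x $ j" "x $ j \<le> L - a p * L / m j" for j
        by (simp_all add: mem_box_cart)
      moreover note \<open>\<And>j. 0 < a p * L / m j\<close>
      ultimately have "0 < x $ j \<and> x $ j < L" for j by (smt (verit))
      then show "x \<in> open_cube L" by (simp add: open_cube_def)
    qed
  qed
  have Cck: "\<psi> p \<in> Cck 1 (open_cube L)" for p
  proof -
    obtain c d where cd: "{x. \<psi> p x \<noteq> 0} \<subseteq> cbox c d" "cbox c d \<subseteq> open_cube L"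
      using supp[of p] by blast
    have "closure {x. \<psi> p x \<noteq> 0} \<subseteq> cbox c d"
      by (rule closure_minimal[OF cd(1)]) (rule closed_cbox)
    moreover from this have "compact (closure {x. \<psi> p x \<noteq> 0})"
      by (meson bounded_cbox bounded_subset compact_eq_bounded_closed closed_closure)
    ultimately show ?thesis using C1[of p] cd(2) unfolding Cck_def by blast
  qed
  have pd: "partial_deriv i (\<psi> p) x = D p x" for p x
  proof (rule partial_deriv_line_unique)
    show "\<psi> p differentiable at x" by (rule Ck_1_differentiable[OF C1])
    define R where "R k = (\<Prod>j\<in>UNIV - {i}. \<beta> p (y j x - real (k j)))" for k
    have "\<psi> p (x + t *\<^sub>R axis i 1) =
      (\<Sum>k\<in>K. \<sigma> k * ((\<Theta> p (real (m i) / L * t + y i x - real (k i)) - \<Theta> p (real (m i) / L * t + y i x - real (k i) - 1)) * R k))" for t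
      unfolding \<psi>_def
    proof (rule sum.cong[OF refl])
      fix k
      have "(\<Prod>j\<in>UNIV. g p j (y j (x + t *\<^sub>R axis i 1) - real (k j)))
        = g p i (y i (x + t *\<^sub>R axis i 1) - real (k i)) * (\<Prod>j\<in>UNIV - {i}. g p j (y j (x + t *\<^sub>R axis i 1) - real (k j)))"
        by (rule prod.remove) auto
      also have "(\<Prod>j\<in>UNIV - {i}. g p j (y j (x + t *\<^sub>R axis i 1) - real (k j))) = R k"
        unfolding R_def by (rule prod.cong) (auto simp: g_def y_def axis_def)
      also have "y i (x + t *\<^sub>R axis i 1) = real (m i) / L * t + y i x"
        by (simp add: y_def axis_def ring_distribs add.commute)
      finally show "\<sigma> k * (\<Prod>j\<in>UNIV. g p j (y j (x + t *\<^sub>R axis i 1) - real (k j))) =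
        \<sigma> k * ((\<Theta> p (real (m i) / L * t + y i x - real (k i)) - \<Theta> p (real (m i) / L * t + y i x - real (k i) - 1)) * R k)"
        by (simp add: g_def)
    qed
    then have eq: "(\<lambda>t. \<psi> p (x + t *\<^sub>R axis i 1)) =
      (\<lambda>t. \<Sum>k\<in>K. \<sigma> k * ((\<Theta> p (real (m i) / L * t + y i x - real (k i)) - \<Theta> p (real (m i) / L * t + y i x - real (k i) - 1)) * R k))"
      by (rule ext)
    have Deq: "D p x = (\<Sum>k\<in>K. \<sigma> k * ((\<beta> p (y i x - real (k i)) * (real (m i) / L) - \<beta> p (y i x - real (k i) - 1) * (real (m i) / L)) * R k))"
      unfolding D_def sum_distrib_left
    proof (rule sum.cong[OF refl])
      fix k
      have "B p k x = \<beta> p (y i x - real (k i)) * R k"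
        unfolding B_def R_def by (rule prod.remove) auto
      moreover have "B p (e k) x = \<beta> p (y i x - real (e k i)) * (\<Prod>j\<in>UNIV - {i}. \<beta> p (y j x - real (e k j)))"
        unfolding B_def by (rule prod.remove) auto
      moreover have "(\<Prod>j\<in>UNIV - {i}. \<beta> p (y j x - real (e k j))) = R k"
        unfolding R_def by (rule prod.cong) (auto simp: e_def)
      moreover have "y i x - real (e k i) = y i x - real (k i) - 1" by (simp add: e_def)
      ultimately show "real (m i) / L * (\<sigma> k * (B p k x - B p (e k) x)) = \<sigma> k * ((\<beta> p (y i x - real (k i)) * (real (m i) / L) - \<beta> p (y i x - real (k i) - 1) * (real (m i) / L)) * R k)"
        by (simp add: algebra_simps)
    qed
    have lin: "((\<lambda>t. c * t + z - k - l) has_real_derivative c) (at t)" "((\<lambda>t. c * t + z - k) has_real_derivative c) (at t)" for c t z k l :: real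
      by (auto intro!: derivative_eq_intros)
    have T1: "((\<lambda>t. \<Theta> p (c * t + z - k)) has_real_derivative \<beta> p (z - k) * c) (at 0)"
      "((\<lambda>t. \<Theta> p (c * t + z - k - 1)) has_real_derivative \<beta> p (z - k - 1) * c) (at 0)" for c z k :: real
      using DERIV_chain2[OF \<Theta> lin(2)[where c=c and z=z and k=k and t=0], of p] DERIV_chain2[OF \<Theta> lin(1)[where c=c and z=z and k=k and l=1 and t=0], of p] by simp_all
    show "((\<lambda>t. \<psi> p (x + t *\<^sub>R axis i 1)) has_real_derivative D p x) (at 0)"
      unfolding eq Deq
      by (intro DERIV_sum DERIV_cmult DERIV_cmult_right DERIV_diff T1)
  qed
  have B01: "0 \<le> B p k x" "B p k x \<le> 1" for p k x
    unfolding B_def using \<beta>01 by (auto intro!: prod_nonneg prod_le_1)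
  have Blim: "(\<lambda>p. B p k x) \<longlonglongrightarrow> indicator (ocell L m k) x" for k x
  proof (cases "x \<in> ocell L m k")
    case True
    have "(\<lambda>p. B p k x) \<longlonglongrightarrow> (\<Prod>j\<in>(UNIV :: 'n set). 1)"
      unfolding B_def by (intro tendsto_prod lim) (use True in \<open>auto simp: ocell_def y_def\<close>)
    then show ?thesis using True by simp
  next
    case False
    then obtain j where j: "y j x - real (k j) \<le> 0 \<or> y j x - real (k j) \<ge> 1"
      by (auto simp: ocell_def y_def not_less)
    have "\<beta> p (y j x - real (k j)) = 0" for p
      using j \<beta>0(1)[of "y j x - real (k j)" p] \<beta>0(2)[of p "y j x - real (k j)"] a(1)[of p] by argo
    then have "B p k x = 0" for p
      unfolding B_def by (intro prod_zero) auto
    then show ?thesis using False by simp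
  qed
  define Dl where "Dl x = real (m i) / L * (\<Sum>k\<in>K. \<sigma> k * (indicator (ocell L m k) x - indicator (ocell L m (e k)) x))" for x :: "real^'n"
  have Dlim: "(\<lambda>p. D p x) \<longlonglongrightarrow> Dl x" for x
    unfolding D_def Dl_def by (intro tendsto_intros Blim)
  have Dbound: "\<bar>D p x\<bar> \<le> real (m i) / L * real (card K)" for p x
  proof -
    have "\<bar>\<Sum>k\<in>K. \<sigma> k * (B p k x - B p (e k) x)\<bar> \<le> (\<Sum>k\<in>K. 1)"
    proof (rule order_trans[OF sum_abs], rule sum_mono)
      fix k
      have "\<bar>B p k x - B p (e k) x\<bar> \<le> 1" using B01[of p k x] B01[of p "e k" x] by linarith
      then show "\<bar>\<sigma> k * (B p k x - B p (e k) x)\<bar> \<le> 1"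
        using \<sigma>[of k] by (simp add: abs_mult mult_le_one)
    qed
    then show ?thesis
      unfolding D_def using L by (simp add: abs_mult divide_right_mono mult_left_mono)
  qed
  have ocell_sub: "ocell L m k \<subseteq> open_cube L" if "k \<in> grid m" for k
  proof
    fix x assume x: "x \<in> ocell L m k"
    have "0 < x $ j \<and> x $ j < L" for j
    proof -
      have mL: "real (m j) / L > 0" using L m by simp
      have "0 < real (m j) / L * x $ j - real (k j)" "real (m j) / L * x $ j - real (k j) < 1"
        using x by (auto simp: ocell_def)
      moreover have "real (k j) + 1 \<le> real (m j)"
      proof -
        have "Suc (k j) \<le> m j" using that by (auto simp: grid_def Suc_le_eq)
        then show ?thesis by linarith
      qed
      ultimately have "0 < real (m j) / L * x $ j" "real (m j) / L * x $ j < real (m j)" by linarith+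
      then show ?thesis using L m mL by (auto simp: zero_less_mult_iff field_simps)
    qed
    then show "x \<in> open_cube L" by (simp add: open_cube_def)
  qed
  have e_grid: "e k \<in> grid m" if "k \<in> K" for k
    using that by (auto simp: K_def e_def grid_def)
  have io: "set_integrable lebesgue (ocell L m k) u" if "k \<in> grid m" for k
    by (rule set_integrable_subset[OF uo ocell_sets[OF L m] ocell_sub[OF that]])
  have Io: "(LINT x:ocell L m k|lebesgue. u x) = I k" if "k \<in> grid m" for k
    unfolding I_def
  proof (rule set_integral_cong_set)
    show b: "set_borel_measurable lebesgue (ocell L m k) u"
      using io[OF that] by (simp add: set_integrable_def set_borel_measurable_def borel_measurable_integrable)
    have "set_integrable lebesgue (cell L m k) u"
      by (rule set_integrable_subset[OF u _ cell_subset_cube[OF L m that]]) simp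
    then show "set_borel_measurable lebesgue (cell L m k) u"
      by (simp add: set_integrable_def set_borel_measurable_def borel_measurable_integrable)
    show "AE x in lebesgue. (x \<in> cell L m k) = (x \<in> ocell L m k)"
      by (rule AE_ocell[OF L m])
  qed
  have "(\<lambda>p. LINT x|lebesgue. indicator (open_cube L) x * (u x * D p x))
    \<longlonglongrightarrow> (LINT x|lebesgue. indicator (open_cube L) x * (u x * Dl x))"
  proof (rule integral_dominated_convergence[where w = "\<lambda>x. \<bar>indicator (open_cube L) x * u x\<bar> * (real (m i) / L * real (card K))"])
    have um: "(\<lambda>x. indicator (open_cube L) x * u x) \<in> borel_measurable lebesgue"
      using uo by (simp add: set_integrable_def borel_measurable_integrable)
    have Dm: "D p \<in> borel_measurable lebesgue" for p
    proof -
      have "continuous_on UNIV (D p)"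
        using Ck_1_partial_deriv[OF C1[of p], of i] pd[of p] by (simp add: fun_eq_iff cong: continuous_on_cong)
      then have "D p \<in> borel_measurable borel" by (rule borel_measurable_continuous_onI)
      then show ?thesis by (intro measurable_completion) simp
    qed
    show "(\<lambda>x. indicator (open_cube L) x * (u x * D p x)) \<in> borel_measurable lebesgue" for p
      using borel_measurable_times[OF um Dm[of p]] by (simp add: mult.assoc)
    have "Dl \<in> borel_measurable lebesgue"
      by (rule borel_measurable_LIMSEQ_real[OF Dlim Dm])
    then show "(\<lambda>x. indicator (open_cube L) x * (u x * Dl x)) \<in> borel_measurable lebesgue"
      using borel_measurable_times[OF um, of Dl] by (simp add: mult.assoc)
    show "integrable lebesgue (\<lambda>x. \<bar>indicator (open_cube L) x * u x\<bar> * (real (m i) / L * real (card K)))"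
      using uo by (intro integrable_mult_left integrable_abs) (simp add: set_integrable_def)
    show "AE x in lebesgue. (\<lambda>p. indicator (open_cube L) x * (u x * D p x)) \<longlonglongrightarrow> indicator (open_cube L) x * (u x * Dl x)"
      by (intro AE_I2 tendsto_intros Dlim)
    show "AE x in lebesgue. norm (indicator (open_cube L) x * (u x * D p x)) \<le> \<bar>indicator (open_cube L) x * u x\<bar> * (real (m i) / L * real (card K))" for p
    proof (rule AE_I2)
      fix x
      have "norm (indicator (open_cube L) x * (u x * D p x)) = \<bar>indicator (open_cube L) x * u x\<bar> * \<bar>D p x\<bar>"
        by (simp only: real_norm_def abs_mult mult.assoc)
      also have "\<dots> \<le> \<bar>indicator (open_cube L) x * u x\<bar> * (real (m i) / L * real (card K))"
        by (rule mult_left_mono[OF Dbound]) simp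
      finally show "norm (indicator (open_cube L) x * (u x * D p x)) \<le> \<bar>indicator (open_cube L) x * u x\<bar> * (real (m i) / L * real (card K))" .
    qed
  qed
  moreover have "(LINT x|lebesgue. indicator (open_cube L) x * (u x * D p x)) \<le> W" for p
    using W[unfolded dir_var_le_def, rule_format, OF Cck bound, of p]
    by (simp add: pd set_lebesgue_integral_def)
  ultimately have le: "(LINT x|lebesgue. indicator (open_cube L) x * (u x * Dl x)) \<le> W"
    by (meson LIMSEQ_le_const2)
  have "(LINT x|lebesgue. indicator (open_cube L) x * (u x * Dl x))
    = (LINT x|lebesgue. real (m i) / L * (\<Sum>k\<in>K. \<sigma> k * (indicator (ocell L m k) x * u x - indicator (ocell L m (e k)) x * u x)))"
  proof (rule Bochner_Integration.integral_cong[OF refl])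
    fix x
    have ind: "indicator (open_cube L) x * indicator (ocell L m k) x = (indicator (ocell L m k) x :: real)" if "k \<in> grid m" for k
      using ocell_sub[OF that] by (auto simp: indicator_def)
    have "indicator (open_cube L) x * (\<Sum>k\<in>K. \<sigma> k * (indicator (ocell L m k) x - indicator (ocell L m (e k)) x))
      = (\<Sum>k\<in>K. \<sigma> k * (indicator (ocell L m k) x - indicator (ocell L m (e k)) x))"
      unfolding sum_distrib_left
    proof (rule sum.cong[OF refl])
      fix k assume k: "k \<in> K"
      have "indicator (open_cube L) x * (\<sigma> k * (indicator (ocell L m k) x - indicator (ocell L m (e k)) x))
        = \<sigma> k * (indicator (open_cube L) x * indicator (ocell L m k) x - indicator (open_cube L) x * indicator (ocell L m (e k)) x)"
        by (simp only: right_diff_distrib mult.left_commute)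
      then show "indicator (open_cube L) x * (\<sigma> k * (indicator (ocell L m k) x - indicator (ocell L m (e k)) x)) = \<sigma> k * (indicator (ocell L m k) x - indicator (ocell L m (e k)) x)"
        using ind[OF subsetD[OF K_grid k]] ind[OF e_grid[OF k]] by (simp only:)
    qed
    then have "indicator (open_cube L) x * (u x * Dl x) = real (m i) / L * (u x * (\<Sum>k\<in>K. \<sigma> k * (indicator (ocell L m k) x - indicator (ocell L m (e k)) x)))"
      by (simp add: Dl_def mult_ac)
    then show "indicator (open_cube L) x * (u x * Dl x) = real (m i) / L * (\<Sum>k\<in>K. \<sigma> k * (indicator (ocell L m k) x * u x - indicator (ocell L m (e k)) x * u x))"
      by (simp add: sum_distrib_left algebra_simps)
  qed
  also have "\<dots> = real (m i) / L * (\<Sum>k\<in>K. \<sigma> k * (I k - I (e k)))"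
  proof -
    have io': "integrable lebesgue (\<lambda>x. indicator (ocell L m k) x * u x)" "(LINT x|lebesgue. indicator (ocell L m k) x * u x) = I k"
      if "k \<in> grid m" for k
      using io[OF that] Io[OF that] by (simp_all add: set_integrable_def set_lebesgue_integral_def)
    have "(LINT x|lebesgue. (\<Sum>k\<in>K. \<sigma> k * (indicator (ocell L m k) x * u x - indicator (ocell L m (e k)) x * u x)))
      = (\<Sum>k\<in>K. LINT x|lebesgue. \<sigma> k * (indicator (ocell L m k) x * u x - indicator (ocell L m (e k)) x * u x))"
      using K_grid e_grid by (intro Bochner_Integration.integral_sum) (auto intro!: integrable_mult_right Bochner_Integration.integrable_diff io')
    also have "\<dots> = (\<Sum>k\<in>K. \<sigma> k * (I k - I (e k)))"
    proof (rule sum.cong[OF refl])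
      fix k assume k: "k \<in> K"
      then have "k \<in> grid m" using K_grid by auto
      with io' e_grid[OF k] show "(LINT x|lebesgue. \<sigma> k * (indicator (ocell L m k) x * u x - indicator (ocell L m (e k)) x * u x)) = \<sigma> k * (I k - I (e k))"
        by simp
    qed
    finally show ?thesis by simp
  qed
  also have "(\<Sum>k\<in>K. \<sigma> k * (I k - I (e k))) = (\<Sum>k\<in>K. \<bar>I (e k) - I k\<bar>)"
    unfolding \<sigma>_def by (rule sum.cong[OF refl]) (metis abs_minus_commute abs_sgn mult.commute)
  finally have "real (m i) / L * (\<Sum>k\<in>K. \<bar>I (e k) - I k\<bar>) \<le> W" using le by simp
  then show ?thesis
    using L m by (simp add: K_def[symmetric] e_def[symmetric] I_def[symmetric] field_simps)
qed

section \<open>From the total variation to the variations in single directions\<close>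

lemma Ck_1_scaleR_left: 
  assumes "Ck 1 f" shows "Ck 1 (\<lambda>x. f x *\<^sub>R c)"
proof (rule Ck_1I)
  show "((\<lambda>x. f x *\<^sub>R c) has_derivative (\<lambda>v. frechet_derivative f (at x) v *\<^sub>R c)) (at x)" for x
    by (intro has_derivative_scaleR_left Ck_1_has_derivative assms)
  show "continuous_on UNIV (\<lambda>x. frechet_derivative f (at x) v *\<^sub>R c)" for v
    by (intro continuous_intros Ck_1_continuous_deriv assms)
qed

lemma partial_deriv_off_support:
  assumes "x \<notin> closure {x. \<psi> x \<noteq> 0}"
  shows "partial_deriv i \<psi> x = 0"
proof -
  have "((\<lambda>_. 0) has_derivative (\<lambda>_. 0)) (at x)" by simp
  then have "(\<psi> has_derivative (\<lambda>_. 0)) (at x)"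
  proof (rule has_derivative_transform_within_open[where s = "- closure {x. \<psi> x \<noteq> 0}"])
    fix y assume "y \<in> - closure {x. \<psi> x \<noteq> 0}"
    then show "0 = \<psi> y" using closure_subset[of "{x. \<psi> x \<noteq> 0}"] by auto
  qed (use assms in auto)
  then show ?thesis
    unfolding partial_deriv_def by (metis frechet_derivative_at)
qed

lemma Cck_1_partial_deriv_bounded:
  assumes "\<psi> \<in> Cck 1 \<Omega>"
  obtains C where "\<And>x. \<bar>partial_deriv i \<psi> x\<bar> \<le> C"
proof -
  let ?K = "closure {x. \<psi> x \<noteq> 0}"
  have C1: "Ck 1 \<psi>" and K: "compact ?K" using assms by (auto simp: Cck_def simp del: Ck.simps One_nat_def)
  have "compact (partial_deriv i \<psi> ` ?K)"
    using Ck_1_partial_deriv[OF C1, of i] K by (intro compact_continuous_image) (auto intro: continuous_on_subset)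
  then obtain B where B: "\<And>x. x \<in> ?K \<Longrightarrow> \<bar>partial_deriv i \<psi> x\<bar> \<le> B"
    unfolding image_iff by (metis bounded_real compact_imp_bounded image_eqI)
  have "\<bar>partial_deriv i \<psi> x\<bar> \<le> max B 0" for x
    using B[of x] partial_deriv_off_support[of x \<psi> i] by (cases "x \<in> ?K") auto
  then show ?thesis using that by blast
qed

lemma Cck_1_set_integrable:
  fixes u :: "real^'n \<Rightarrow> real"
  assumes u: "set_integrable lebesgue S u" and \<psi>: "\<psi> \<in> Cck 1 \<Omega>"
  shows "set_integrable lebesgue S (\<lambda>x. u x * partial_deriv i \<psi> x)"
proof -
  obtain C where C: "\<And>x. \<bar>partial_deriv i \<psi> x\<bar> \<le> C" using Cck_1_partial_deriv_bounded[OF \<psi>] by blast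
  have "partial_deriv i \<psi> \<in> borel_measurable borel"
    using \<psi> by (intro borel_measurable_continuous_onI Ck_1_partial_deriv) (simp add: Cck_def)
  then have m: "partial_deriv i \<psi> \<in> borel_measurable lebesgue"
    by (intro measurable_completion) simp
  have um: "(\<lambda>x. indicator S x * u x) \<in> borel_measurable lebesgue"
    using u by (simp add: set_integrable_def borel_measurable_integrable)
  have "integrable lebesgue (\<lambda>x. (indicator S x * u x) * partial_deriv i \<psi> x)"
  proof (rule Bochner_Integration.integrable_bound)
    show "integrable lebesgue (\<lambda>x. C * (indicator S x * u x))"
      using u by (simp add: set_integrable_def)
    show "(\<lambda>x. (indicator S x * u x) * partial_deriv i \<psi> x) \<in> borel_measurable lebesgue"
      by (intro borel_measurable_times um m)
    show "AE x in lebesgue. norm ((indicator S x * u x) * partial_deriv i \<psi> x) \<le> norm (C * (indicator S x * u x))"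
    proof (rule AE_I2)
      fix x
      have "\<bar>indicator S x * u x\<bar> * \<bar>partial_deriv i \<psi> x\<bar> \<le> \<bar>indicator S x * u x\<bar> * \<bar>C\<bar>"
        using C[of x] by (intro mult_left_mono) auto
      then show "norm ((indicator S x * u x) * partial_deriv i \<psi> x) \<le> norm (C * (indicator S x * u x))"
        by (simp only: real_norm_def abs_mult mult_ac)
    qed
  qed
  then show ?thesis by (simp add: set_integrable_def mult_ac)
qed

text \<open>The field with components \<open>\<psi> i / sqrt n\<close> has Euclidean norm at most 1,
  so it is admissible for the total variation. The functions \<open>\<psi> i\<close> are independent
  of each other, which later allows a separate supremum in each direction.\<close>

lemma sum_directional_le:
  fixes u :: "real^'n \<Rightarrow> real" and \<psi> :: "'n::finite \<Rightarrow> real^'n \<Rightarrow> real"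
  assumes u: "set_integrable lebesgue (open_cube L) u"
    and V: "total_variation (open_cube L) u \<le> ereal V"
    and \<psi>: "\<And>i. \<psi> i \<in> Cck 1 (open_cube L)" "\<And>i x. \<bar>\<psi> i x\<bar> \<le> 1"
  shows "(\<Sum>i\<in>UNIV. LINT x:open_cube L|lebesgue. u x * partial_deriv i (\<psi> i) x) \<le> sqrt CARD('n) * V"
proof -
  let ?n = "real CARD('n)"
  define \<phi> where "\<phi> x = (\<Sum>i\<in>UNIV. \<psi> i x *\<^sub>R ((1 / sqrt ?n) *\<^sub>R axis i (1::real)))" for x :: "real^'n"
  have n: "?n > 0" by simp
  have \<phi>_nth: "\<phi> x $ i = \<psi> i x / sqrt ?n" for x i
    unfolding \<phi>_def by (simp add: axis_def if_distrib[of "\<lambda>z. _ * z"] if_distrib[of "\<lambda>z. z / _"] sum.delta cong: if_cong)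
  have C1: "Ck 1 (\<psi> i)" for i using \<psi>(1)[of i] by (auto simp: Cck_def simp del: Ck.simps One_nat_def)
  have C1\<phi>: "Ck 1 \<phi>"
    unfolding \<phi>_def by (intro Ck_1_sum Ck_1_scaleR_left C1)
  have cl: "closure {x. \<phi> x \<noteq> 0} \<subseteq> (\<Union>i. closure {x. \<psi> i x \<noteq> 0})"
  proof (rule closure_minimal)
    show "{x. \<phi> x \<noteq> 0} \<subseteq> (\<Union>i. closure {x. \<psi> i x \<noteq> 0})"
    proof
      fix x assume "x \<in> {x. \<phi> x \<noteq> 0}"
      then obtain i where "\<phi> x $ i \<noteq> 0" by (auto simp: vec_eq_iff)
      then have "x \<in> {x. \<psi> i x \<noteq> 0}" by (simp add: \<phi>_nth)
      then show "x \<in> (\<Union>i. closure {x. \<psi> i x \<noteq> 0})" using closure_subset by fast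
    qed
  qed (intro closed_UN; simp)
  have "compact (\<Union>i. closure {x. \<psi> i x \<noteq> 0})"
    using \<psi>(1) by (intro compact_UN) (auto simp: Cck_def)
  then have "compact (closure {x. \<phi> x \<noteq> 0})"
    using cl by (meson bounded_subset closed_closure compact_eq_bounded_closed)
  moreover have "(\<Union>i. closure {x. \<psi> i x \<noteq> 0}) \<subseteq> open_cube L"
    using \<psi>(1) by (auto simp: Cck_def)
  ultimately have \<phi>: "\<phi> \<in> Cck 1 (open_cube L)"
    using C1\<phi> cl unfolding Cck_def by blast
  have norm\<phi>: "norm (\<phi> x) \<le> 1" for x
  proof -
    have "(\<Sum>i\<in>UNIV. (norm (\<phi> x $ i))\<^sup>2) \<le> (\<Sum>i\<in>(UNIV::'n set). 1 / ?n)"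
    proof (rule sum_mono)
      fix i
      have "(\<psi> i x)\<^sup>2 \<le> 1" using \<psi>(2)[of i x] by (simp add: abs_square_le_1)
      then show "(norm (\<phi> x $ i))\<^sup>2 \<le> 1 / ?n"
        by (simp add: \<phi>_nth power_divide divide_right_mono)
    qed
    also have "\<dots> = 1" by simp
    finally show ?thesis by (simp add: norm_vec_def L2_set_def)
  qed
  have "Linf_norm (lebesgue_on (open_cube L)) \<phi> \<le> 1"
    unfolding Linf_norm_def
  proof (rule esssup_I)
    have "\<phi> \<in> borel_measurable borel"
      by (rule borel_measurable_continuous_onI[OF Ck_1_continuous[OF C1\<phi>]])
    then have "\<phi> \<in> borel_measurable lebesgue" by (intro measurable_completion) simp
    then have "\<phi> \<in> borel_measurable (lebesgue_on (open_cube L))" by (rule measurable_restrict_space1)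
    then show "(\<lambda>x. ereal (norm (\<phi> x))) \<in> borel_measurable (lebesgue_on (open_cube L))" by simp
  qed (simp add: norm\<phi>)
  then have "ereal (LINT x|lebesgue_on (open_cube L). u x * divergence \<phi> x) \<le> total_variation (open_cube L) u"
    unfolding total_variation_def using \<phi> by (intro SUP_upper) simp
  then have le: "(LINT x|lebesgue_on (open_cube L). u x * divergence \<phi> x) \<le> V"
    using V by (metis ereal_less_eq(3) order_trans)
  have div: "divergence \<phi> x = (\<Sum>i\<in>UNIV. partial_deriv i (\<psi> i) x) / sqrt ?n" for x
    unfolding divergence_def sum_divide_distrib
  proof (rule sum.cong[OF refl])
    fix i
    have "((\<lambda>y. \<psi> i y / sqrt ?n) has_derivative (\<lambda>v. frechet_derivative (\<psi> i) (at x) v / sqrt ?n)) (at x)"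
      by (rule bounded_linear.has_derivative[OF bounded_linear_divide Ck_1_has_derivative[OF C1]])
    then have "frechet_derivative (\<lambda>y. \<psi> i y / sqrt ?n) (at x) = (\<lambda>v. frechet_derivative (\<psi> i) (at x) v / sqrt ?n)"
      by (metis frechet_derivative_at)
    then show "partial_deriv i (\<lambda>y. \<phi> y $ i) x = partial_deriv i (\<psi> i) x / sqrt ?n"
      by (simp add: partial_deriv_def \<phi>_nth)
  qed
  have "(LINT x|lebesgue_on (open_cube L). u x * divergence \<phi> x)
    = (LINT x|lebesgue. (\<Sum>i\<in>UNIV. indicator (open_cube L) x * (u x * partial_deriv i (\<psi> i) x)) / sqrt ?n)"
    by (subst integral_restrict_space) (simp_all add: div sum_distrib_left)
  also have "\<dots> = (\<Sum>i\<in>UNIV. LINT x:open_cube L|lebesgue. u x * partial_deriv i (\<psi> i) x) / sqrt ?n"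
  proof -
    have "integrable lebesgue (\<lambda>x. indicator (open_cube L) x * (u x * partial_deriv i (\<psi> i) x))" for i
      using Cck_1_set_integrable[OF u \<psi>(1)[of i], of i] by (simp add: set_integrable_def)
    then show ?thesis
      by (simp only: set_lebesgue_integral_def integral_divide_zero Bochner_Integration.integral_sum real_scaleR_def)
  qed
  finally have "(\<Sum>i\<in>UNIV. LINT x:open_cube L|lebesgue. u x * partial_deriv i (\<psi> i) x) / sqrt ?n \<le> V"
    using le by simp
  then show ?thesis using n by (simp add: pos_divide_le_eq mult.commute)
qed

lemma Cck_zero: "(\<lambda>_. 0 :: real) \<in> Cck 1 \<Omega>"
  using Ck_1_const[of "0::real"] by (simp add: Cck_def)

text \<open>\<open>W i\<close> is the supremum over the tests in direction \<open>i\<close>.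
  Near-maximizers for all directions are combined into one field, so the sum of the suprema obeys
  the same bound as the single sums. A field with one nonzero component shows that each supremum is
  finite.\<close>

lemma dir_var_exists:
  fixes u :: "real^'n \<Rightarrow> real"
  assumes u: "set_integrable lebesgue (open_cube L) u"
    and V: "total_variation (open_cube L) u \<le> ereal V"
  obtains W :: "'n::finite \<Rightarrow> real"
  where "\<And>i. dir_var_le i L u (W i)" "(\<Sum>i\<in>UNIV. W i) \<le> sqrt CARD('n) * V"
proof -
  define T where "T = {\<psi> \<in> Cck 1 (open_cube L :: (real^'n) set). \<forall>x. \<bar>\<psi> x :: real\<bar> \<le> 1}"
  define J where "J i \<psi> = (LINT x:open_cube L|lebesgue. u x * partial_deriv i \<psi> x)" for i \<psi>
  define W where "W i = (SUP \<psi>\<in>T. J i \<psi>)" for i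
  have T0: "(\<lambda>_. 0) \<in> T" by (simp add: T_def Cck_zero del: One_nat_def)
  have pd0: "partial_deriv i (\<lambda>_. 0) x = 0" for i and x :: "real^'n" by (simp add: partial_deriv_def)
  have J0: "J i (\<lambda>_. 0) = 0" for i by (simp add: J_def pd0)
  have sumJ: "(\<Sum>i\<in>UNIV. J i (\<psi> i)) \<le> sqrt CARD('n) * V" if "\<And>i. \<psi> i \<in> T" for \<psi>
    unfolding J_def using that by (intro sum_directional_le[OF u V]) (auto simp: T_def)
  have J_le: "J i \<psi> \<le> sqrt CARD('n) * V" if "\<psi> \<in> T" for i \<psi>
  proof -
    have "(\<Sum>j\<in>UNIV. J j (if j = i then \<psi> else (\<lambda>_. 0))) \<le> sqrt CARD('n) * V"
      by (rule sumJ) (use that T0 in auto)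
    moreover have "(\<Sum>j\<in>UNIV. J j (if j = i then \<psi> else (\<lambda>_. 0))) = (\<Sum>j\<in>UNIV. if j = i then J i \<psi> else 0)"
      by (rule sum.cong) (auto simp: J0)
    ultimately show ?thesis by (simp add: sum.delta)
  qed
  have bdd: "bdd_above (J i ` T)" for i using J_le by (auto simp: bdd_above_def)
  show ?thesis
  proof (rule that[of W])
    show "dir_var_le i L u (W i)" for i
      unfolding dir_var_le_def
    proof (intro ballI impI)
      fix \<psi> :: "real^'n \<Rightarrow> real" assume "\<psi> \<in> Cck 1 (open_cube L)" "\<forall>x. \<bar>\<psi> x\<bar> \<le> 1"
      then have "\<psi> \<in> T" by (simp add: T_def)
      then have "J i \<psi> \<le> W i" unfolding W_def by (intro cSUP_upper bdd)
      then show "(LINT x:open_cube L|lebesgue. u x * partial_deriv i \<psi> x) \<le> W i" by (simp add: J_def)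
    qed
    show "(\<Sum>i\<in>UNIV. W i) \<le> sqrt CARD('n) * V"
    proof (rule field_le_epsilon)
      fix e :: real assume e: "e > 0"
      have "\<exists>\<psi>\<in>T. J i \<psi> > W i - e / CARD('n)" for i
      proof -
        have "W i - e / CARD('n) < W i" using e by simp
        then show ?thesis unfolding W_def using T0 bdd by (subst (asm) less_cSUP_iff) auto
      qed
      then obtain \<psi> where \<psi>: "\<And>i. \<psi> i \<in> T" "\<And>i. J i (\<psi> i) > W i - e / CARD('n)" by metis
      have "(\<Sum>i\<in>UNIV. W i) - e = (\<Sum>i\<in>UNIV. W i - e / CARD('n))"
        by (simp add: sum_subtractf)
      also have "\<dots> \<le> (\<Sum>i\<in>UNIV. J i (\<psi> i))" by (intro sum_mono less_imp_le \<psi>)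
      also have "\<dots> \<le> sqrt CARD('n) * V" by (rule sumJ[OF \<psi>(1)])
      finally show "(\<Sum>i\<in>UNIV. W i) \<le> sqrt CARD('n) * V + e" by simp
    qed
  qed
qed

section \<open>Approximation by cell averages\<close>

definition cell_avg :: "real \<Rightarrow> ('n::finite \<Rightarrow> nat) \<Rightarrow> (real^'n \<Rightarrow> real) \<Rightarrow> ('n \<Rightarrow> nat) \<Rightarrow> real" where
  "cell_avg L m u k = (LINT x:cell L m k|lebesgue. u x) / (\<Prod>i\<in>UNIV. L / real (m i))"

text \<open>The \<open>L1\<close> error of the piecewise constant projection, that is, of the
  conditional expectation on the grid.\<close>

definition osc :: "real \<Rightarrow> ('n::finite \<Rightarrow> nat) \<Rightarrow> (real^'n \<Rightarrow> real) \<Rightarrow> real" where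
  "osc L m u = (\<Sum>k\<in>grid m. LINT x:cell L m k|lebesgue. \<bar>u x - cell_avg L m u k\<bar>)"

context
  fixes L :: real and u :: "real^'n::finite \<Rightarrow> real"
  assumes L: "L > 0" and u: "set_integrable lebesgue (closed_cube L) u"
begin

section \<open>Averages and deviations on a single cell\<close>

lemma cell_const_integrable [simp]:
  fixes c :: real and m :: "'n \<Rightarrow> nat"
  assumes "\<forall>i. m i > 0"
  shows "set_integrable lebesgue (cell L m k) (\<lambda>_. c)"
  using cell_lmeasurable[OF L assms, of k]
  by (simp add: set_integrable_def integrable_mult_left integrable_indicator_iff fmeasurable_def)

lemma cell_const_integral:
  fixes c :: real and m :: "'n \<Rightarrow> nat"
  assumes "\<forall>i. m i > 0"
  shows "(LINT x:cell L m k|lebesgue. c) = c * (\<Prod>i\<in>UNIV. L / real (m i))"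
  using measure_cell[OF L assms, of k] cell_lmeasurable[OF L assms, of k]
  by (simp add: set_lebesgue_integral_def fmeasurable_def)

lemma cell_integrable:
  fixes m :: "'n \<Rightarrow> nat"
  assumes "\<forall>i. m i > 0" "k \<in> grid m"
  shows "set_integrable lebesgue (cell L m k) u"
  by (rule set_integrable_subset[OF u _ cell_subset_cube[OF L assms]]) simp

lemma vol_pos:
  fixes m :: "'n \<Rightarrow> nat"
  assumes "\<forall>i. m i > 0" 
  shows "(\<Prod>i\<in>UNIV. L / real (m i)) > 0"
  using assms L by (intro prod_pos) simp

lemma cell_abs_diff_integrable:
  fixes m :: "'n \<Rightarrow> nat"
  assumes "\<forall>i. m i > 0" "k \<in> grid m"
  shows "set_integrable lebesgue (cell L m k) (\<lambda>x. \<bar>u x - c\<bar>)"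
  by (intro set_integrable_abs set_integral_diff cell_integrable cell_const_integrable assms)

lemma cell_abs_diff_mono:
  fixes m :: "'n \<Rightarrow> nat"
  assumes m: "\<forall>i. m i > 0" "k \<in> grid m"
  shows "(LINT x:cell L m k|lebesgue. \<bar>u x - c\<bar>) \<le>
     (LINT x:cell L m k|lebesgue. \<bar>u x - d\<bar>) + \<bar>c - d\<bar> * (\<Prod>i\<in>UNIV. L / real (m i))"
proof -
  have "(LINT x:cell L m k|lebesgue. \<bar>u x - c\<bar>) \<le> (LINT x:cell L m k|lebesgue. \<bar>u x - d\<bar> + \<bar>c - d\<bar>)"
    by (rule set_integral_mono) (auto intro!: set_integral_add cell_abs_diff_integrable cell_const_integrable m)
  also have "\<dots> = (LINT x:cell L m k|lebesgue. \<bar>u x - d\<bar>) + (LINT x:cell L m k|lebesgue. \<bar>c - d\<bar>)"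
    by (intro set_integral_add cell_abs_diff_integrable cell_const_integrable m)
  finally show ?thesis by (simp add: cell_const_integral[OF m(1)])
qed

lemma cell_avg_diff_le:
  fixes m :: "'n \<Rightarrow> nat"
  assumes m: "\<forall>i. m i > 0" "k \<in> grid m"
  shows "\<bar>cell_avg L m u k - c\<bar> * (\<Prod>i\<in>UNIV. L / real (m i)) \<le> (LINT x:cell L m k|lebesgue. \<bar>u x - c\<bar>)"
proof -
  define v where "v = (\<Prod>i\<in>UNIV. L / real (m i))"
  have v: "v > 0" unfolding v_def by (rule vol_pos[OF m(1)])
  have "(cell_avg L m u k - c) * v = (LINT x:cell L m k|lebesgue. u x) - c * v"
    using v by (simp add: cell_avg_def left_diff_distrib v_def[symmetric])
  also have "\<dots> = (LINT x:cell L m k|lebesgue. u x - c)"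
    using set_integral_diff(2)[OF cell_integrable[OF m] cell_const_integrable[OF m(1), of k c]]
    by (simp add: cell_const_integral[OF m(1)] v_def)
  finally have "\<bar>cell_avg L m u k - c\<bar> * v = \<bar>LINT x:cell L m k|lebesgue. u x - c\<bar>"
    using v by (metis abs_mult abs_of_pos)
  also have "\<dots> \<le> (LINT x:cell L m k|lebesgue. \<bar>u x - c\<bar>)"
    using set_integral_norm_bound[of lebesgue "cell L m k" "\<lambda>x. u x - c"]
      set_integral_diff(1)[OF cell_integrable[OF m] cell_const_integrable[OF m(1), of k c]] by simp
  finally show ?thesis by (simp only: v_def)
qed

text \<open>Up to a factor 2 the average is the best constant, so any convenient \<open>c\<close>
  can be used to estimate the deviation from it.\<close>

lemma cell_osc_le:
  fixes m :: "'n \<Rightarrow> nat"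
  assumes m: "\<forall>i. m i > 0" "k \<in> grid m"
  shows "(LINT x:cell L m k|lebesgue. \<bar>u x - cell_avg L m u k\<bar>) \<le> 2 * (LINT x:cell L m k|lebesgue. \<bar>u x - c\<bar>)"
  using cell_abs_diff_mono[OF m, of "cell_avg L m u k" c] cell_avg_diff_le[OF m, of c] by simp

section \<open>Halving the cells in one direction\<close>

context
  fixes m :: "'n \<Rightarrow> nat" and i :: 'n
  assumes m: "\<forall>i. m i > 0"
begin

lemma cell_halves:
  "cell L m k = cell L (m(i := 2 * m i)) (k(i := 2 * k i)) \<union> cell L (m(i := 2 * m i)) (k(i := Suc (2 * k i)))"
  (is "_ = cell L ?m ?k0 \<union> cell L ?m ?k1")
proof (rule set_eqI)
  fix x :: "real^'n"
  define t where "t = real (m i) * x $ i / L"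
  have two: "\<lfloor>t\<rfloor> = int (k i) \<longleftrightarrow> \<lfloor>2 * t\<rfloor> = int (2 * k i) \<or> \<lfloor>2 * t\<rfloor> = int (Suc (2 * k i))"
    by linarith
  have other: "(\<forall>j. j \<noteq> i \<longrightarrow> \<lfloor>real (?m j) * x $ j / L\<rfloor> = int (?k0 j)) \<longleftrightarrow> (\<forall>j. j \<noteq> i \<longrightarrow> \<lfloor>real (m j) * x $ j / L\<rfloor> = int (k j))"
    "(\<forall>j. j \<noteq> i \<longrightarrow> \<lfloor>real (?m j) * x $ j / L\<rfloor> = int (?k1 j)) \<longleftrightarrow> (\<forall>j. j \<noteq> i \<longrightarrow> \<lfloor>real (m j) * x $ j / L\<rfloor> = int (k j))"
    by auto
  have split: "(\<forall>j. P j) \<longleftrightarrow> P i \<and> (\<forall>j. j \<noteq> i \<longrightarrow> P j)" for P :: "'n \<Rightarrow> bool" by auto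
  have 2: "real (?m i) * x $ i / L = 2 * t" by (simp add: t_def)
  show "x \<in> cell L m k \<longleftrightarrow> x \<in> cell L ?m ?k0 \<union> cell L ?m ?k1"
    unfolding Un_iff cell_def mem_Collect_eq split[of "\<lambda>j. \<lfloor>_ j\<rfloor> = _ j"]
      split[of "\<lambda>j. \<lfloor>real (m j) * x $ j / L\<rfloor> = int (k j)"]
      split[of "\<lambda>j. \<lfloor>real (?m j) * x $ j / L\<rfloor> = int (?k0 j)"]
      split[of "\<lambda>j. \<lfloor>real (?m j) * x $ j / L\<rfloor> = int (?k1 j)"] other 2
    using two by (auto simp: t_def)
qed

lemma grid_halves:
  "grid (m(i := 2 * m i)) = (\<lambda>k. k(i := 2 * k i)) ` grid m \<union> (\<lambda>k. k(i := Suc (2 * k i))) ` grid m" (is "?l = ?r")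
proof (intro equalityI subsetI)
  fix k assume k: "k \<in> ?l"
  define k' where "k' = k(i := k i div 2)"
  have kj: "k j < (m(i := 2 * m i)) j" for j using k unfolding grid_def by blast
  have "k' j < m j" for j
    using kj[of j] kj[of i] by (cases "j = i") (auto simp: k'_def)
  then have k': "k' \<in> grid m" by (simp add: grid_def)
  have "k i = 2 * (k i div 2) \<or> k i = Suc (2 * (k i div 2))" by linarith
  then have "k = k'(i := 2 * k' i) \<or> k = k'(i := Suc (2 * k' i))"
    by (auto simp: k'_def)
  then show "k \<in> ?r" using k' by blast
next
  fix k assume "k \<in> ?r"
  moreover have "Suc (2 * k i) < 2 * m i" if "k \<in> grid m" for k
  proof -
    have "k i < m i" using that by (simp add: grid_def)
    then show ?thesis by simp
  qed
  ultimately show "k \<in> ?l" by (auto simp: grid_def)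
qed

lemma inj_halves: "inj_on (\<lambda>k. k(i := 2 * k i)) A" "inj_on (\<lambda>k. k(i := Suc (2 * k i))) A"
proof -
  have "k j = k' j" if "k(i := 2 * k i) = k'(i := 2 * k' i)" for k k' :: "'n \<Rightarrow> nat" and j
    using fun_cong[OF that, of j] by (cases "j = i") auto
  then show "inj_on (\<lambda>k. k(i := 2 * k i)) A" by (auto simp: inj_on_def fun_eq_iff)
  have "k j = k' j" if "k(i := Suc (2 * k i)) = k'(i := Suc (2 * k' i))" for k k' :: "'n \<Rightarrow> nat" and j
    using fun_cong[OF that, of j] by (cases "j = i") auto
  then show "inj_on (\<lambda>k. k(i := Suc (2 * k i))) A" by (auto simp: inj_on_def fun_eq_iff)
qed

lemma sum_grid_halves:
  fixes f :: "('n \<Rightarrow> nat) \<Rightarrow> real"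
  shows "(\<Sum>k\<in>grid (m(i := 2 * m i)). f k) = (\<Sum>k\<in>grid m. f (k(i := 2 * k i)) + f (k(i := Suc (2 * k i))))"
proof -
  have "k(i := 2 * k i) \<noteq> k'(i := Suc (2 * k' i))" for k k' :: "'n \<Rightarrow> nat"
  proof
    assume "k(i := 2 * k i) = k'(i := Suc (2 * k' i))"
    from fun_cong[OF this, of i] show False by simp presburger
  qed
  then have disj: "(\<lambda>k. k(i := 2 * k i)) ` grid m \<inter> (\<lambda>k. k(i := Suc (2 * k i))) ` grid m = {}"
    by blast
  show ?thesis
    unfolding grid_halves using disj
    by (simp add: sum.union_disjoint sum.reindex[OF inj_halves(1)] sum.reindex[OF inj_halves(2)] sum.distrib)
qed

text \<open>The average over a cell is the mean of the averages over its halves, so passing to a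
  half shifts the constant by half of their difference. Multiplied by the volume this costs
  \<open>\<bar>I (?k1 k) - I (?k0 k)\<bar> / 2\<close> on each half. The two halves are neighbours
  in the finer grid, where \<open>shift_difference_le\<close> applies.\<close>

lemma osc_halve_direction:
  assumes W: "dir_var_le i L u W"
  shows "osc L m u \<le> osc L (m(i := 2 * m i)) u + L / (2 * real (m i)) * W"
proof -
  let ?m = "m(i := 2 * m i)"
  let ?k0 = "\<lambda>k :: 'n \<Rightarrow> nat. k(i := 2 * k i)" and ?k1 = "\<lambda>k :: 'n \<Rightarrow> nat. k(i := Suc (2 * k i))"
  have m': "\<forall>i. ?m i > 0" using m by simp
  define v where "v = (\<Prod>i\<in>UNIV. L / real (?m i))"
  have v: "v > 0" unfolding v_def by (rule vol_pos[OF m'])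
  have vm: "(\<Prod>i\<in>UNIV. L / real (m i)) = 2 * v"
  proof -
    have "(\<Prod>j\<in>UNIV. L / real (m j)) = L / real (m i) * (\<Prod>j\<in>UNIV - {i}. L / real (m j))"
      by (rule prod.remove) auto
    moreover have "v = L / real (?m i) * (\<Prod>j\<in>UNIV - {i}. L / real (?m j))"
      unfolding v_def by (rule prod.remove) auto
    moreover have "(\<Prod>j\<in>UNIV - {i}. L / real (?m j)) = (\<Prod>j\<in>UNIV - {i}. L / real (m j))"
      by (rule prod.cong) auto
    ultimately show ?thesis by simp
  qed
  define I where "I k = (LINT x:cell L ?m k|lebesgue. u x)" for k
  have kg: "?k0 k \<in> grid ?m" "?k1 k \<in> grid ?m" if "k \<in> grid m" for k
    using that unfolding grid_halves by auto
  have disj: "cell L ?m (?k0 k) \<inter> cell L ?m (?k1 k) = {}" for k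
  proof -
    have "?k0 k \<noteq> ?k1 k" by (metis fun_upd_same n_not_Suc_n)
    then show ?thesis using cell_unique by blast
  qed
  have avg': "cell_avg L ?m u k = I k / v" for k
    by (simp add: cell_avg_def v_def I_def)
  have avg: "cell_avg L m u k = (I (?k0 k) + I (?k1 k)) / (2 * v)" if "k \<in> grid m" for k
    unfolding cell_avg_def vm I_def
    by (subst cell_halves, subst set_integral_Un)
       (use disj cell_integrable[OF m' kg(1)[OF that]] cell_integrable[OF m' kg(2)[OF that]] in auto)
  define A where "A k = (LINT x:cell L ?m k|lebesgue. \<bar>u x - cell_avg L ?m u k\<bar>)" for k
  have "(LINT x:cell L m k|lebesgue. \<bar>u x - cell_avg L m u k\<bar>) \<le>
    (A (?k0 k) +
     A (?k1 k)) + \<bar>I (?k1 k) - I (?k0 k)\<bar>"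
    if k: "k \<in> grid m" for k
  proof -
    let ?c = "cell_avg L m u k"
    have "(LINT x:cell L m k|lebesgue. \<bar>u x - ?c\<bar>) =
      (LINT x:cell L ?m (?k0 k)|lebesgue. \<bar>u x - ?c\<bar>) + (LINT x:cell L ?m (?k1 k)|lebesgue. \<bar>u x - ?c\<bar>)"
      by (subst cell_halves, rule set_integral_Un)
         (use disj cell_abs_diff_integrable[OF m' kg(1)[OF k]] cell_abs_diff_integrable[OF m' kg(2)[OF k]] in auto)
    also have "\<dots> \<le> (A (?k0 k) + \<bar>?c - cell_avg L ?m u (?k0 k)\<bar> * v) +
      (A (?k1 k) + \<bar>?c - cell_avg L ?m u (?k1 k)\<bar> * v)"
      unfolding v_def A_def
      using cell_abs_diff_mono[OF m' kg(1)[OF k], of ?c "cell_avg L ?m u (?k0 k)"]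
        cell_abs_diff_mono[OF m' kg(2)[OF k], of ?c "cell_avg L ?m u (?k1 k)"]
      by (rule add_mono)
    finally have 1: "(LINT x:cell L m k|lebesgue. \<bar>u x - ?c\<bar>) \<le> (A (?k0 k) + \<bar>?c - cell_avg L ?m u (?k0 k)\<bar> * v) + (A (?k1 k) + \<bar>?c - cell_avg L ?m u (?k1 k)\<bar> * v)" .
    have 2: "\<bar>?c - cell_avg L ?m u (?k0 k)\<bar> * v = \<bar>I (?k1 k) - I (?k0 k)\<bar> / 2"
    proof -
      have "?c - cell_avg L ?m u (?k0 k) = (I (?k1 k) - I (?k0 k)) / (2 * v)"
        unfolding avg[OF k] avg' using v by (simp add: field_simps)
      then show ?thesis using v by (simp add: abs_divide abs_mult)
    qed
    have 3: "\<bar>?c - cell_avg L ?m u (?k1 k)\<bar> * v = \<bar>I (?k1 k) - I (?k0 k)\<bar> / 2"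
    proof -
      have "?c - cell_avg L ?m u (?k1 k) = - ((I (?k1 k) - I (?k0 k)) / (2 * v))"
        unfolding avg[OF k] avg' using v by (simp add: field_simps)
      then show ?thesis using v by (simp add: abs_divide abs_mult)
    qed
    have "(a + d / 2) + (b + d / 2) = (a + b) + d" for a b d :: real by simp
    then show ?thesis using 1 unfolding 2 3 by (simp only:)
  qed
  then have "osc L m u \<le> (\<Sum>k\<in>grid m. (A (?k0 k) +
     A (?k1 k)) + \<bar>I (?k1 k) - I (?k0 k)\<bar>)"
    unfolding osc_def by (rule sum_mono)
  also have "\<dots> = (\<Sum>k\<in>grid ?m. A k) + (\<Sum>k\<in>grid m. \<bar>I (?k1 k) - I (?k0 k)\<bar>)"
    unfolding sum_grid_halves by (rule sum.distrib)
  also have "(\<Sum>k\<in>grid ?m. A k) = osc L ?m u"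
    unfolding osc_def A_def ..
  finally have "osc L m u \<le> osc L ?m u + (\<Sum>k\<in>grid m. \<bar>I (?k1 k) - I (?k0 k)\<bar>)" .
  moreover have "(\<Sum>k\<in>grid m. \<bar>I (?k1 k) - I (?k0 k)\<bar>) \<le> L / (2 * real (m i)) * W"
  proof -
    have "(\<Sum>k\<in>grid m. \<bar>I (?k1 k) - I (?k0 k)\<bar>) = (\<Sum>k\<in>?k0 ` grid m. \<bar>I (k(i := Suc (k i))) - I k\<bar>)"
      by (simp add: sum.reindex[OF inj_halves(1)])
    \<comment> \<open>Only the neighbours whose first index is even are halves of a common cell; the
      others add nonnegative terms.\<close>
    also have "\<dots> \<le> (\<Sum>k\<in>{k\<in>grid ?m. Suc (k i) < ?m i}. \<bar>I (k(i := Suc (k i))) - I k\<bar>)"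
    proof (rule sum_mono2)
      show "?k0 ` grid m \<subseteq> {k\<in>grid ?m. Suc (k i) < ?m i}"
      proof (rule image_subsetI)
        fix k assume k: "k \<in> grid m"
        then have "k i < m i" by (simp add: grid_def)
        then show "?k0 k \<in> {k\<in>grid ?m. Suc (k i) < ?m i}" using kg(1)[OF k] by simp
      qed
    qed auto
    also have "\<dots> \<le> L / ?m i * W"
      unfolding I_def by (rule shift_difference_le[OF L m' u W])
    finally show ?thesis by simp
  qed
  ultimately show ?thesis by linarith
qed

end

text \<open>The directions are halved one after the other. Direction \<open>a\<close> still has
  \<open>N\<close> cells when its turn comes, so its cost \<open>L / (2 * N) * W a\<close> does not
  depend on the directions halved before.\<close>

lemma osc_halve:
  fixes W :: "'n \<Rightarrow> real"
  assumes N: "N > 0" and W: "\<And>i. dir_var_le i L u (W i)"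
  shows "osc L (\<lambda>_. N) u \<le> osc L (\<lambda>_. 2 * N) u + L / (2 * real N) * (\<Sum>i\<in>UNIV. W i)"
proof -
  have "finite A \<Longrightarrow> osc L (\<lambda>_. N) u \<le> osc L (\<lambda>j. if j \<in> A then 2 * N else N) u + L / (2 * real N) * (\<Sum>i\<in>A. W i)" for A :: "'n set"
  proof (induction A rule: finite_induct)
    case (insert a A)
    let ?m = "\<lambda>j. if j \<in> A then 2 * N else N"
    have "osc L ?m u \<le> osc L (?m(a := 2 * ?m a)) u + L / (2 * real (?m a)) * W a"
      by (rule osc_halve_direction[OF _ W]) (use N in auto)
    moreover have "?m(a := 2 * ?m a) = (\<lambda>j. if j \<in> insert a A then 2 * N else N)"
      using insert by (auto simp: fun_eq_iff)
    ultimately show ?case using insert by (simp add: distrib_left)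
  qed simp
  from this[of UNIV] show ?thesis by simp
qed

text \<open>Each halving costs half as much as the previous one; \<open>1 - 1 / 2 ^ p\<close> is the
  partial sum of the geometric series.\<close>

lemma osc_iterate:
  fixes W :: "'n \<Rightarrow> real"
  assumes N: "N > 0" and W: "\<And>i. dir_var_le i L u (W i)"
  shows "osc L (\<lambda>_. N) u \<le> osc L (\<lambda>_. 2 ^ p * N) u + (1 - 1 / 2 ^ p) * (L / real N * (\<Sum>i\<in>UNIV. W i))"
proof (induction p)
  case (Suc p)
  have "osc L (\<lambda>_. 2 ^ p * N) u \<le> osc L (\<lambda>_. 2 * (2 ^ p * N)) u + L / (2 * real (2 ^ p * N)) * (\<Sum>i\<in>UNIV. W i)"
    by (rule osc_halve[OF _ W]) (use N in simp)
  moreover have "L / (2 * real (2 ^ p * N)) * (\<Sum>i\<in>UNIV. W i) + (1 - 1 / 2 ^ p) * (L / real N * (\<Sum>i\<in>UNIV. W i))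
    = (1 - 1 / 2 ^ Suc p) * (L / real N * (\<Sum>i\<in>UNIV. W i))"
    using N by (simp add: field_simps)
  ultimately show ?case using Suc by (simp add: mult.assoc)
qed simp

end

text \<open>A measurable function is an almost everywhere limit of continuous ones; truncating these
  at the bound of \<open>u\<close> supplies the majorant for dominated convergence.\<close>

lemma continuous_L1_approximation:
  fixes u :: "'a::euclidean_space \<Rightarrow> real"
  assumes S: "S \<in> lmeasurable" and u: "set_integrable lebesgue S u"
    and M: "AE x in lebesgue. x \<in> S \<longrightarrow> \<bar>u x\<bar> \<le> M" and e: "e > 0"
  obtains g where "continuous_on UNIV g" "(LINT x:S|lebesgue. \<bar>u x - g x\<bar>) \<le> e"
    "set_integrable lebesgue S (\<lambda>x. \<bar>u x - g x\<bar>)"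
proof -
  define f where "f x = indicator S x * u x" for x
  have fm: "f \<in> borel_measurable lebesgue"
    using u by (simp add: f_def[abs_def] set_integrable_def borel_measurable_integrable)
  then have "f measurable_on UNIV"
    by (intro lebesgue_measurable_imp_measurable_on) auto
  then obtain N g where N: "negligible N" and g: "\<And>n. continuous_on UNIV (g n)"
    and lim: "\<And>x. x \<notin> N \<Longrightarrow> (\<lambda>n. g n x) \<longlonglongrightarrow> f x"
    unfolding measurable_on_def by auto
  \<comment> \<open>\<open>M\<close> carries no sign here, whereas the truncation level has to be
    nonnegative because \<open>f\<close> is 0 off \<open>S\<close>.\<close>
  define B where "B = max M 0"
  define h where "h n x = max (- B) (min B (g n x))" for n :: nat and x
  have hc: "continuous_on UNIV (h n)" for n
    unfolding h_def by (intro continuous_intros g)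
  have hm: "h n \<in> borel_measurable lebesgue" for n
    using borel_measurable_continuous_onI[OF hc[of n]] by (intro measurable_completion) simp
  have hB: "\<bar>h n x\<bar> \<le> B" for n x by (auto simp: h_def B_def)
  have hlim: "(\<lambda>n. h n x) \<longlonglongrightarrow> f x" if "x \<notin> N" "\<bar>f x\<bar> \<le> B" for x
  proof -
    have "(\<lambda>n. h n x) \<longlonglongrightarrow> max (- B) (min B (f x))"
      unfolding h_def by (intro tendsto_intros lim that)
    moreover have "max (- B) (min B (f x)) = f x" using that(2) by auto
    ultimately show ?thesis by simp
  qed
  have AEN: "AE x in lebesgue. x \<notin> N"
    using N by (simp add: AE_not_in negligible_iff_null_sets)
  have fB: "AE x in lebesgue. \<bar>f x\<bar> \<le> B"
    using M by eventually_elim (auto simp: f_def B_def indicator_def)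
  have Si: "integrable lebesgue (\<lambda>x. indicator S x * (2 * B))"
    using S by (intro integrable_mult_left integrable_real_indicator) (auto simp: fmeasurable_def)
  have dm: "(\<lambda>x. indicator S x * \<bar>f x - h n x\<bar>) \<in> borel_measurable lebesgue" for n
    using fm hm S by (intro borel_measurable_times borel_measurable_abs borel_measurable_diff) (auto simp: fmeasurable_def)
  have bnd: "AE x in lebesgue. norm (indicator S x * \<bar>f x - h n x\<bar>) \<le> indicator S x * (2 * B)" for n
    using fB
  proof eventually_elim
    case (elim x)
    then have "\<bar>f x - h n x\<bar> \<le> 2 * B" using hB[of n x] by linarith
    then show ?case by (simp add: indicator_def)
  qed
  have "(\<lambda>n. LINT x|lebesgue. indicator S x * \<bar>f x - h n x\<bar>) \<longlonglongrightarrow> (LINT x|lebesgue. (\<lambda>_::'a. 0::real) x)"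
  proof (rule integral_dominated_convergence[where w = "\<lambda>x. indicator S x * (2 * B)"])
    show "AE x in lebesgue. (\<lambda>n. indicator S x * \<bar>f x - h n x\<bar>) \<longlonglongrightarrow> 0"
      using AEN fB
    proof eventually_elim
      case (elim x)
      have "(\<lambda>n. indicator S x * \<bar>f x - h n x\<bar>) \<longlonglongrightarrow> indicator S x * \<bar>f x - f x\<bar>"
        by (intro tendsto_intros hlim elim)
      then show ?case by simp
    qed
  qed (use dm Si bnd in auto)
  then have "(\<lambda>n. LINT x|lebesgue. indicator S x * \<bar>f x - h n x\<bar>) \<longlonglongrightarrow> 0" by simp
  from order_tendstoD(2)[OF this e] obtain n where n: "(LINT x|lebesgue. indicator S x * \<bar>f x - h n x\<bar>) < e"
    by (auto simp: eventually_sequentially)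
  have eq: "indicator S x * \<bar>f x - h n x\<bar> = indicator S x *\<^sub>R \<bar>u x - h n x\<bar>" for x
    by (simp add: f_def indicator_def)
  show ?thesis
  proof (rule that[of "h n"])
    show "(LINT x:S|lebesgue. \<bar>u x - h n x\<bar>) \<le> e"
      using n by (simp only: eq set_lebesgue_integral_def less_imp_le)
    show "set_integrable lebesgue S (\<lambda>x. \<bar>u x - h n x\<bar>)"
      unfolding set_integrable_def eq[symmetric]
      by (rule Bochner_Integration.integrable_bound[OF Si dm]) (use bnd[of n] in \<open>auto elim!: eventually_mono\<close>)
  qed (rule hc)
qed

section \<open>The averaging error vanishes as the grid is refined\<close>

lemma cell_corner:
  fixes k :: "'n::finite \<Rightarrow> nat"
  assumes "L > 0" "N > 0"
  shows "(\<chi> i. L * real (k i) / real N) \<in> cell L (\<lambda>_. N) k"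
  using assms by (simp add: cell_def)

lemma cell_dist:
  fixes x y :: "real^'n::finite"
  assumes "L > 0" "N > 0" "x \<in> cell L (\<lambda>_. N) k" "y \<in> cell L (\<lambda>_. N) k"
  shows "dist x y \<le> real CARD('n) * (L / real N)"
proof -
  have "dist x y \<le> (\<Sum>i\<in>UNIV. \<bar>(x - y) $ i\<bar>)"
    unfolding dist_norm by (rule norm_le_l1_cart)
  also have "\<dots> \<le> (\<Sum>i\<in>(UNIV :: 'n set). L / real N)"
  proof (rule sum_mono)
    fix i
    have "L * (real (k i) + 1) / real N = L * real (k i) / real N + L / real N"
      by (simp add: ring_distribs add_divide_distrib)
    then show "\<bar>(x - y) $ i\<bar> \<le> L / real N"
      using cell_bounds[OF assms(1) assms(2) assms(3), of i] cell_bounds[OF assms(1) assms(2) assms(4), of i]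
      by (simp add: abs_le_iff)
  qed
  finally show ?thesis by simp
qed

text \<open>Closes the iteration of halvings. No rate is asked for, so density of the continuous
  functions and uniform continuity suffice.\<close>

lemma osc_eventually_small:
  fixes u :: "real^'n::finite \<Rightarrow> real"
  assumes L: "L > 0" and u: "set_integrable lebesgue (closed_cube L) u"
    and M: "AE x in lebesgue. x \<in> closed_cube L \<longrightarrow> \<bar>u x\<bar> \<le> M" and e: "e > 0"
  obtains P where "\<And>N. N \<ge> P \<Longrightarrow> N > 0 \<Longrightarrow> osc L (\<lambda>_. N) u \<le> e"
proof -
  obtain g where g: "continuous_on UNIV g" "(LINT x:closed_cube L|lebesgue. \<bar>u x - g x\<bar>) \<le> e / 4"
    and gi: "set_integrable lebesgue (closed_cube L) (\<lambda>x. \<bar>u x - g x\<bar>)"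
    using continuous_L1_approximation[OF _ u M, of "e / 4"] e by auto
  have "uniformly_continuous_on (closed_cube L) g"
    by (rule compact_uniformly_continuous) (auto simp: closed_cube_cbox intro: continuous_on_subset[OF g(1)])
  \<comment> \<open>The total volume is \<open>L ^ n\<close>, so an error \<open>w\<close> on every
    cell adds up to \<open>e / 4\<close>, as much as the approximation by \<open>g\<close> costs;
    \<open>cell_osc_le\<close> doubles the sum of the two.\<close>
  moreover define w where "w = e / (4 * L ^ CARD('n))"
  ultimately obtain d where d: "d > 0" "\<And>x y. x \<in> closed_cube L \<Longrightarrow> y \<in> closed_cube L \<Longrightarrow> dist y x < d \<Longrightarrow> dist (g y) (g x) < w"
    unfolding uniformly_continuous_on_def using e L by (metis divide_pos_pos mult_pos_pos zero_less_numeral zero_less_power)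
  obtain P :: nat where P: "P > real CARD('n) * L / d" using reals_Archimedean2 by blast
  show ?thesis
  proof (rule that[of P])
    fix N assume N: "N \<ge> P" "N > 0"
    let ?m = "\<lambda>_ :: 'n. N"
    have m: "\<forall>i. ?m i > 0" using N by simp
    have "real CARD('n) * L / d < real N" using P N by linarith
    then have small: "real CARD('n) * (L / real N) < d" using d N by (simp add: field_simps)
    have vol: "(\<Prod>i\<in>(UNIV :: 'n set). L / real (?m i)) = (L / real N) ^ CARD('n)" by simp
    have "(LINT x:cell L ?m k|lebesgue. \<bar>u x - cell_avg L ?m u k\<bar>) \<le>
      2 * ((LINT x:cell L ?m k|lebesgue. \<bar>u x - g x\<bar>) + w * (L / real N) ^ CARD('n))" if k: "k \<in> grid ?m" for k
    proof -
      define c where "c = g (\<chi> i. L * real (k i) / real N)"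
      have sub: "cell L ?m k \<subseteq> closed_cube L" by (rule cell_subset_cube[OF L m k])
      have gk: "set_integrable lebesgue (cell L ?m k) (\<lambda>x. \<bar>u x - g x\<bar>)"
        by (rule set_integrable_subset[OF gi _ sub]) simp
      have wk: "set_integrable lebesgue (cell L ?m k) (\<lambda>_. w)" by (rule cell_const_integrable[OF L u m])
      have "(LINT x:cell L ?m k|lebesgue. \<bar>u x - c\<bar>) \<le> (LINT x:cell L ?m k|lebesgue. \<bar>u x - g x\<bar> + w)"
      proof (rule set_integral_mono)
        show "set_integrable lebesgue (cell L ?m k) (\<lambda>x. \<bar>u x - c\<bar>)"
          by (rule cell_abs_diff_integrable[OF L u m k])
        show "set_integrable lebesgue (cell L ?m k) (\<lambda>x. \<bar>u x - g x\<bar> + w)"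
          using gk wk by simp
        fix x assume x: "x \<in> cell L ?m k"
        have corner: "(\<chi> i. L * real (k i) / real N) \<in> cell L ?m k" by (rule cell_corner[OF L N(2)])
        have "dist (g x) c < w"
          unfolding c_def using x corner sub small cell_dist[OF L N(2) x corner] by (intro d(2)) auto
        then show "\<bar>u x - c\<bar> \<le> \<bar>u x - g x\<bar> + w" by (simp add: dist_real_def)
      qed
      also have "\<dots> = (LINT x:cell L ?m k|lebesgue. \<bar>u x - g x\<bar>) + w * (L / real N) ^ CARD('n)"
        using set_integral_add(2)[OF gk wk] cell_const_integral[OF L u m, of k w] by simp
      finally show ?thesis by (rule order_trans[OF cell_osc_le[OF L u m k, of c] mult_left_mono]) simp
    qed
    then have "osc L ?m u \<le> (\<Sum>k\<in>grid ?m. 2 * ((LINT x:cell L ?m k|lebesgue. \<bar>u x - g x\<bar>) + w * (L / real N) ^ CARD('n)))"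
      unfolding osc_def by (rule sum_mono)
    also have "\<dots> = 2 * ((\<Sum>k\<in>grid ?m. LINT x:cell L ?m k|lebesgue. \<bar>u x - g x\<bar>) + real (card (grid ?m)) * (w * (L / real N) ^ CARD('n)))"
      by (simp add: sum_distrib_left[symmetric] sum.distrib)
    also have "(\<Sum>k\<in>grid ?m. LINT x:cell L ?m k|lebesgue. \<bar>u x - g x\<bar>) = (LINT x:closed_cube L|lebesgue. \<bar>u x - g x\<bar>)"
      by (rule integral_cube_cells[OF L m gi, symmetric])
    also have "real (card (grid ?m)) * (w * (L / real N) ^ CARD('n)) = e / 4"
      using N L by (simp add: card_grid power_divide w_def)
    finally have "osc L ?m u \<le> 2 * ((LINT x:closed_cube L|lebesgue. \<bar>u x - g x\<bar>) + e / 4)" .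
    also have "\<dots> \<le> 2 * (e / 4 + e / 4)" by (intro mult_left_mono add_right_mono g) simp
    finally show "osc L ?m u \<le> e" by simp
  qed
qed

lemma osc_le:
  fixes u :: "real^'n::finite \<Rightarrow> real"
  assumes L: "L > 0" and u: "set_integrable lebesgue (closed_cube L) u"
    and M: "AE x in lebesgue. x \<in> closed_cube L \<longrightarrow> \<bar>u x\<bar> \<le> M"
    and N: "N > 0" and W: "\<And>i. dir_var_le i L u (W i)"
    and V: "(\<Sum>i\<in>UNIV. W i) \<le> V" "V \<ge> 0"
  shows "osc L (\<lambda>_. N) u \<le> L / real N * V"
proof (rule field_le_epsilon)
  fix e :: real assume "e > 0"
  then obtain P where P: "\<And>N. N \<ge> P \<Longrightarrow> N > 0 \<Longrightarrow> osc L (\<lambda>_. N) u \<le> e"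
    using osc_eventually_small[OF L u M] by blast
  \<comment> \<open>\<open>P\<close> halvings in every direction already bring the grid to the
    threshold \<open>P\<close>.\<close>
  have "P \<le> 2 ^ P * N" using less_exp[of P] N by (metis less_imp_le mult.right_neutral mult_le_mono Suc_leI One_nat_def)
  then have "osc L (\<lambda>_. 2 ^ P * N) u \<le> e" using N by (intro P) auto
  moreover have "osc L (\<lambda>_. N) u \<le> osc L (\<lambda>_. 2 ^ P * N) u + (1 - 1 / 2 ^ P) * (L / real N * (\<Sum>i\<in>UNIV. W i))"
    by (rule osc_iterate[OF L u N W])
  moreover have "(1 - 1 / 2 ^ P) * (L / real N * (\<Sum>i\<in>UNIV. W i)) \<le> 1 * (L / real N * V)"
  proof -
    have "(1 - 1 / 2 ^ P) * (L / real N * (\<Sum>i\<in>UNIV. W i)) \<le> (1 - 1 / 2 ^ P) * (L / real N * V)"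
      using L N V by (intro mult_left_mono) auto
    also have "\<dots> \<le> 1 * (L / real N * V)"
      using L N V by (intro mult_right_mono) auto
    finally show ?thesis .
  qed
  ultimately show "osc L (\<lambda>_. N) u \<le> L / real N * V + e" by linarith
qed

section \<open>Coding the cell averages\<close>

lemma cell_avg_bound:
  fixes u :: "real^'n::finite \<Rightarrow> real" and m :: "'n \<Rightarrow> nat"
  assumes L: "L > 0" and u: "set_integrable lebesgue (closed_cube L) u"
    and M: "AE x in lebesgue. x \<in> closed_cube L \<longrightarrow> \<bar>u x\<bar> \<le> M"
    and m: "\<forall>i. m i > 0" "k \<in> grid m"
  shows "\<bar>cell_avg L m u k\<bar> \<le> M"
proof -
  let ?v = "\<Prod>i\<in>UNIV. L / real (m i)"
  have "\<bar>cell_avg L m u k - 0\<bar> * ?v \<le> (LINT x:cell L m k|lebesgue. \<bar>u x - 0\<bar>)"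
    by (rule cell_avg_diff_le[OF L u m])
  also have "\<dots> \<le> (LINT x:cell L m k|lebesgue. M)"
  proof (rule set_integral_mono_AE)
    show "set_integrable lebesgue (cell L m k) (\<lambda>x. \<bar>u x - 0\<bar>)" by (rule cell_abs_diff_integrable[OF L u m])
    show "set_integrable lebesgue (cell L m k) (\<lambda>_. M)" by (rule cell_const_integrable[OF L u m(1)])
    show "AE x\<in>cell L m k in lebesgue. \<bar>u x - 0\<bar> \<le> M"
      using M by eventually_elim (use cell_subset_cube[OF L m] in auto)
  qed
  also have "\<dots> = M * ?v" by (rule cell_const_integral[OF L u m(1)])
  finally show ?thesis using vol_pos[OF L u m(1)] by simp
qed

lemma L1_distance_le_osc:
  fixes u v :: "real^'n::finite \<Rightarrow> real" and m :: "'n \<Rightarrow> nat"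
  assumes L: "L > 0" and u: "set_integrable lebesgue (closed_cube L) u"
    and v: "set_integrable lebesgue (closed_cube L) v" and m: "\<forall>i. m i > 0"
    and h: "\<And>k. k \<in> grid m \<Longrightarrow> \<bar>cell_avg L m u k - cell_avg L m v k\<bar> \<le> h"
  shows "(LINT x:closed_cube L|lebesgue. \<bar>u x - v x\<bar>) \<le> osc L m u + osc L m v + h * L ^ CARD('n)"
proof -
  let ?v = "\<Prod>i\<in>UNIV. L / real (m i)"
  have uv: "set_integrable lebesgue (closed_cube L) (\<lambda>x. \<bar>u x - v x\<bar>)"
    by (intro set_integrable_abs set_integral_diff u v)
  have "(LINT x:cell L m k|lebesgue. \<bar>u x - v x\<bar>) \<le>
    (LINT x:cell L m k|lebesgue. \<bar>u x - cell_avg L m u k\<bar>) + (LINT x:cell L m k|lebesgue. \<bar>v x - cell_avg L m v k\<bar>) + h * ?v"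
    if k: "k \<in> grid m" for k
  proof -
    let ?a = "cell_avg L m u k" and ?b = "cell_avg L m v k"
    note 1 = cell_abs_diff_integrable[OF L u m k, of ?a]
    note 2 = cell_abs_diff_integrable[OF L v m k, of ?b]
    note 3 = cell_const_integrable[OF L u m, of k h]
    note 12 = set_integral_add[OF 1 2]
    have "(LINT x:cell L m k|lebesgue. \<bar>u x - v x\<bar>) \<le> (LINT x:cell L m k|lebesgue. (\<bar>u x - ?a\<bar> + \<bar>v x - ?b\<bar>) + h)"
    proof (rule set_integral_mono)
      show "set_integrable lebesgue (cell L m k) (\<lambda>x. \<bar>u x - v x\<bar>)"
        by (rule set_integrable_subset[OF uv _ cell_subset_cube[OF L m k]]) simp
      show "set_integrable lebesgue (cell L m k) (\<lambda>x. (\<bar>u x - ?a\<bar> + \<bar>v x - ?b\<bar>) + h)"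
        by (rule set_integral_add(1)[OF 12(1) 3])
      show "\<bar>u x - v x\<bar> \<le> (\<bar>u x - ?a\<bar> + \<bar>v x - ?b\<bar>) + h" for x
        using h[OF k] by linarith
    qed
    then show ?thesis
      by (simp only: set_integral_add(2)[OF 12(1) 3] 12(2) cell_const_integral[OF L u m])
  qed
  then have "(LINT x:closed_cube L|lebesgue. \<bar>u x - v x\<bar>) \<le>
    (\<Sum>k\<in>grid m. (LINT x:cell L m k|lebesgue. \<bar>u x - cell_avg L m u k\<bar>) + (LINT x:cell L m k|lebesgue. \<bar>v x - cell_avg L m v k\<bar>) + h * ?v)"
    unfolding integral_cube_cells[OF L m uv] by (rule sum_mono)
  also have "\<dots> = osc L m u + osc L m v + real (card (grid m)) * (h * ?v)"
    by (simp only: sum.distrib osc_def sum_constant)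
  also have "real (card (grid m)) * (h * ?v) = h * L ^ CARD('n)"
  proof -
    have "real (card (grid m)) * ?v = (\<Prod>i\<in>UNIV. real (m i) * (L / real (m i)))"
      by (simp only: card_grid of_nat_prod prod.distrib)
    also have "\<dots> = (\<Prod>i\<in>(UNIV::'n set). L)" using m by (intro prod.cong) auto
    finally show ?thesis by simp
  qed
  finally show ?thesis .
qed

text \<open>The edges from \<open>k\<close> to \<open>parent k\<close> form a spanning tree of the grid, rooted at the origin. At the
  root \<open>parent_dir\<close> is arbitrary.\<close>

definition parent_dir :: "('n \<Rightarrow> nat) \<Rightarrow> 'n" where
  "parent_dir k = (SOME i. k i \<noteq> 0)"

definition parent :: "('n \<Rightarrow> nat) \<Rightarrow> ('n \<Rightarrow> nat)" where
  "parent k = k(parent_dir k := k (parent_dir k) - 1)"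

lemma parent_dir: "k \<noteq> (\<lambda>_. 0) \<Longrightarrow> k (parent_dir k) \<noteq> 0"
  unfolding parent_dir_def by (rule someI_ex) auto

lemma parent_succ: "k \<noteq> (\<lambda>_. 0) \<Longrightarrow> (parent k)(parent_dir k := Suc (parent k (parent_dir k))) = k"
  using parent_dir[of k] by (auto simp: parent_def)

lemma parent_grid: "k \<in> grid m \<Longrightarrow> parent k \<in> grid m"
  by (auto simp: parent_def grid_def) (metis diff_le_self le_less_trans)

lemma parent_sum_less:
  fixes k :: "'n::finite \<Rightarrow> nat"
  assumes "k \<noteq> (\<lambda>_. 0)"
  shows "sum (parent k) UNIV < sum k UNIV"
proof -
  have "sum k UNIV = k (parent_dir k) + sum k (UNIV - {parent_dir k})"
    by (rule sum.remove) auto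
  moreover have "sum (parent k) UNIV = parent k (parent_dir k) + sum (parent k) (UNIV - {parent_dir k})"
    by (rule sum.remove) auto
  moreover have "sum (parent k) (UNIV - {parent_dir k}) = sum k (UNIV - {parent_dir k})"
    by (rule sum.cong) (auto simp: parent_def)
  ultimately show ?thesis using parent_dir[OF assms] by (simp add: parent_def)
qed

text \<open>A cell other than the root is recovered from its parent and the direction, so the tree
  edges form a subfamily of all edges of the grid.\<close>

lemma sum_parent_le:
  fixes F :: "('n::finite \<Rightarrow> nat) \<Rightarrow> real"
  shows "(\<Sum>k\<in>grid m - {\<lambda>_. 0}. \<bar>F k - F (parent k)\<bar>)
    \<le> (\<Sum>i\<in>UNIV. \<Sum>k\<in>{k\<in>grid m. Suc (k i) < m i}. \<bar>F (k(i := Suc (k i))) - F k\<bar>)"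
proof -
  let ?A = "grid m - {\<lambda>_. 0}"
  let ?S = "SIGMA i:UNIV. {k\<in>grid m. Suc (k i) < m i}"
  define G where "G = (\<lambda>(i, k). \<bar>F (k(i := Suc (k i))) - F k\<bar>)"
  have inj: "inj_on (\<lambda>k. (parent_dir k, parent k)) ?A"
  proof (rule inj_onI)
    fix k k' assume *: "k \<in> ?A" "k' \<in> ?A" "(parent_dir k, parent k) = (parent_dir k', parent k')"
    have "k = (parent k)(parent_dir k := Suc (parent k (parent_dir k)))"
      using parent_succ[of k] *(1) by simp
    also have "\<dots> = (parent k')(parent_dir k' := Suc (parent k' (parent_dir k')))" using * by simp
    also have "\<dots> = k'" using parent_succ[of k'] *(2) by simp
    finally show "k = k'" .
  qed
  have "(\<Sum>k\<in>?A. \<bar>F k - F (parent k)\<bar>) = (\<Sum>k\<in>?A. G (parent_dir k, parent k))"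
    by (rule sum.cong) (auto simp: G_def parent_succ)
  also have "\<dots> = (\<Sum>p\<in>(\<lambda>k. (parent_dir k, parent k)) ` ?A. G p)"
    by (simp add: sum.reindex[OF inj])
  also have "\<dots> \<le> (\<Sum>p\<in>?S. G p)"
  proof (rule sum_mono2)
    show "(\<lambda>k. (parent_dir k, parent k)) ` ?A \<subseteq> ?S"
    proof (rule image_subsetI)
      fix k assume k: "k \<in> ?A"
      then have "Suc (parent k (parent_dir k)) = k (parent_dir k)"
        using parent_dir[of k] by (simp add: parent_def)
      then show "(parent_dir k, parent k) \<in> ?S"
        using k parent_grid[of k m] by (auto simp: grid_def)
    qed
  qed (auto simp: G_def)
  also have "\<dots> = (\<Sum>i\<in>UNIV. \<Sum>k\<in>{k\<in>grid m. Suc (k i) < m i}. G (i, k))"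
    by (subst sum.Sigma) auto
  finally show ?thesis by (simp add: G_def)
qed

lemma sum_avg_parent_le:
  fixes u :: "real^'n::finite \<Rightarrow> real"
  assumes L: "L > 0" and u: "set_integrable lebesgue (closed_cube L) u" and N: "N > 0"
    and W: "\<And>i. dir_var_le i L u (W i)" and V: "(\<Sum>i\<in>UNIV. W i) \<le> V"
  shows "(\<Sum>k\<in>grid (\<lambda>_. N) - {\<lambda>_. 0}. \<bar>cell_avg L (\<lambda>_. N) u k - cell_avg L (\<lambda>_. N) u (parent k)\<bar>)
    \<le> L / real N * V / (L / real N) ^ CARD('n)"
proof -
  let ?m = "\<lambda>_ :: 'n. N"
  let ?v = "(L / real N) ^ CARD('n)"
  have m: "\<forall>i. ?m i > 0" using N by simp
  have v: "?v > 0" using L N by simp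
  have "(\<Sum>k\<in>grid ?m - {\<lambda>_. 0}. \<bar>cell_avg L ?m u k - cell_avg L ?m u (parent k)\<bar>)
    \<le> (\<Sum>i\<in>UNIV. \<Sum>k\<in>{k\<in>grid ?m. Suc (k i) < ?m i}. \<bar>cell_avg L ?m u (k(i := Suc (k i))) - cell_avg L ?m u k\<bar>)"
    by (rule sum_parent_le[where F = "cell_avg L ?m u" and m = ?m])
  also have "\<dots> \<le> (\<Sum>i\<in>UNIV. L / real N * W i / ?v)"
  proof (rule sum_mono)
    fix i
    have "(\<Sum>k\<in>{k\<in>grid ?m. Suc (k i) < ?m i}. \<bar>cell_avg L ?m u (k(i := Suc (k i))) - cell_avg L ?m u k\<bar>)
      = (\<Sum>k\<in>{k\<in>grid ?m. Suc (k i) < ?m i}.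
      \<bar>(LINT x:cell L ?m (k(i := Suc (k i)))|lebesgue. u x) - (LINT x:cell L ?m k|lebesgue. u x)\<bar>) / ?v"
      unfolding sum_divide_distrib
      using v by (intro sum.cong) (simp_all add: cell_avg_def abs_divide flip: diff_divide_distrib)
    also have "\<dots> \<le> L / real N * W i / ?v"
      using shift_difference_le[OF L m u W[of i]] v by (intro divide_right_mono) auto
    finally show "(\<Sum>k\<in>{k\<in>grid ?m. Suc (k i) < ?m i}. \<bar>cell_avg L ?m u (k(i := Suc (k i))) - cell_avg L ?m u k\<bar>) \<le> L / real N * W i / ?v" .
  qed
  also have "\<dots> = L / real N * (\<Sum>i\<in>UNIV. W i) / ?v"
    by (simp only: sum_divide_distrib sum_distrib_left)
  also have "\<dots> \<le> L / real N * V / ?v"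
    using V L v by (intro divide_right_mono mult_left_mono) auto
  finally show ?thesis .
qed

text \<open>The full series over the integers has sum 3; this is the base 3 in the number of
  codes.\<close>

lemma sum_half_powers: "(\<Sum>j\<in>{- int K..int K}. (1/2 :: real) ^ nat \<bar>j\<bar>) = 3 - 2 / 2 ^ K"
proof (induction K)
  case (Suc K)
  have "{- int (Suc K)..int (Suc K)} = insert (- int (Suc K)) (insert (int (Suc K)) {- int K..int K})"
    by auto
  then have "(\<Sum>j\<in>{- int (Suc K)..int (Suc K)}. (1/2 :: real) ^ nat \<bar>j\<bar>)
    = (1/2) ^ Suc K + ((1/2) ^ Suc K + (\<Sum>j\<in>{- int K..int K}. (1/2 :: real) ^ nat \<bar>j\<bar>))"
    by (simp add: nat_add_distrib)
  then show ?case unfolding Suc by (simp add: power_one_over field_simps)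
qed simp

lemma card_bounded_variation_sequences:
  assumes S: "finite S"
  shows "real (card {f \<in> S \<rightarrow>\<^sub>E {- int K..int K}. (\<Sum>k\<in>S. \<bar>f k\<bar>) \<le> int K}) \<le> 2 ^ K * 3 ^ card S"
    and "finite {f \<in> S \<rightarrow>\<^sub>E {- int K..int K}. (\<Sum>k\<in>S. \<bar>f k\<bar>) \<le> int K}"
proof -
  let ?P = "S \<rightarrow>\<^sub>E {- int K..int K}"
  let ?A = "{f \<in> ?P. (\<Sum>k\<in>S. \<bar>f k\<bar>) \<le> int K}"
  have fP: "finite ?P" using S by (intro finite_PiE) auto
  then show fA: "finite ?A" by simp
  \<comment> \<open>Weight \<open>f\<close> by \<open>2 ^ (K - \<Sum>\<bar>f k\<bar>) \<ge> 1\<close>; the sum of the weights factorizes.\<close>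
  have "real (card ?A) = (\<Sum>f\<in>?A. 1)" by simp
  also have "\<dots> \<le> (\<Sum>f\<in>?A. 2 ^ K * (\<Prod>k\<in>S. (1/2) ^ nat \<bar>f k\<bar>))"
  proof (rule sum_mono)
    fix f assume f: "f \<in> ?A"
    have "(\<Sum>k\<in>S. nat \<bar>f k\<bar>) \<le> K"
      using f by (simp add: nat_le_iff flip: of_nat_le_iff[where 'a=int])
    then have "(1/2 :: real) ^ K \<le> (1/2) ^ (\<Sum>k\<in>S. nat \<bar>f k\<bar>)"
      by (intro power_decreasing) auto
    then have "2 ^ K * (1/2 :: real) ^ K \<le> 2 ^ K * (\<Prod>k\<in>S. (1/2) ^ nat \<bar>f k\<bar>)"
      by (simp add: power_sum)
    then show "1 \<le> 2 ^ K * (\<Prod>k\<in>S. (1/2 :: real) ^ nat \<bar>f k\<bar>)"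
      by (simp add: power_one_over)
  qed
  also have "\<dots> \<le> (\<Sum>f\<in>?P. 2 ^ K * (\<Prod>k\<in>S. (1/2) ^ nat \<bar>f k\<bar>))"
    by (rule sum_mono2[OF fP]) (auto intro!: mult_nonneg_nonneg prod_nonneg)
  also have "\<dots> = 2 ^ K * (\<Prod>k\<in>S. \<Sum>j\<in>{- int K..int K}. (1/2) ^ nat \<bar>j\<bar>)"
    using S by (subst prod_sum_PiE) (simp_all add: sum_distrib_left)
  also have "\<dots> \<le> 2 ^ K * (\<Prod>k\<in>S. 3)"
  proof -
    have "2 / 2 ^ K \<le> 2 / (1::real)" by (intro divide_left_mono) auto
    then show ?thesis unfolding sum_half_powers by (intro mult_left_mono prod_mono) auto
  qed
  finally show "real (card ?A) \<le> 2 ^ K * 3 ^ card S" by simp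
qed

text \<open>All that the coding argument uses of a member of the class. Its \<open>V\<close> bounds
  the sum of the directional variations, hence it is instantiated with \<open>sqrt n\<close> times
  the bound for the total variation.\<close>

definition bv_data :: "real \<Rightarrow> real \<Rightarrow> real \<Rightarrow> (real^'n::finite \<Rightarrow> real) \<Rightarrow> bool" where
  "bv_data L M V u \<longleftrightarrow> set_integrable lebesgue (closed_cube L) u \<and>
     (AE x in lebesgue. x \<in> closed_cube L \<longrightarrow> \<bar>u x\<bar> \<le> M) \<and>
     (\<exists>W. (\<forall>i. dir_var_le i L u (W i)) \<and> (\<Sum>i\<in>UNIV. W i) \<le> V)"

lemma integrable_cube_iff:
  fixes f :: "real^'n \<Rightarrow> real"
  shows "integrable (lebesgue_on (closed_cube L)) f \<longleftrightarrow> set_integrable lebesgue (closed_cube L) f"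
  by (simp add: integrable_restrict_space set_integrable_def)

lemma integral_cube_eq:
  fixes f :: "real^'n \<Rightarrow> real"
  shows "(LINT x|lebesgue_on (closed_cube L). f x) = (LINT x:closed_cube L|lebesgue. f x)"
  by (simp add: integral_restrict_space set_lebesgue_integral_def)

lemma BV_class_data:
  fixes c :: "(real^'n::finite \<Rightarrow> real) set"
  assumes "c \<in> BV_class L M V"
  obtains u where "c = L1_class (lebesgue_on (closed_cube L)) u"
    "bv_data L M (sqrt CARD('n) * V) u"
proof -
  obtain u where u: "c = L1_class (lebesgue_on (closed_cube L)) u" "integrable (lebesgue_on (closed_cube L)) u"
    "Linf_norm (lebesgue_on (closed_cube L)) u \<le> ereal M" "total_variation (open_cube L) u \<le> ereal V"
    using assms unfolding BV_class_def by blast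
  have ui: "set_integrable lebesgue (closed_cube L) u" using u(2) by (simp add: integrable_cube_iff)
  have uo: "set_integrable lebesgue (open_cube L) u"
    by (rule set_integrable_subset[OF ui]) (auto simp: open_cube_def closed_cube_def less_imp_le)
  have "AE x in lebesgue_on (closed_cube L). ereal (norm (u x)) \<le> esssup (lebesgue_on (closed_cube L)) (\<lambda>x. ereal (norm (u x)))"
    by (rule esssup_AE)
  then have "AE x in lebesgue_on (closed_cube L). \<bar>u x\<bar> \<le> M"
  proof eventually_elim
    case (elim x)
    then have "ereal (norm (u x)) \<le> ereal M"
      using u(3) unfolding Linf_norm_def by (rule order_trans)
    then show ?case by simp
  qed
  then have M: "AE x in lebesgue. x \<in> closed_cube L \<longrightarrow> \<bar>u x\<bar> \<le> M"
    by (subst (asm) AE_restrict_space_iff) auto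
  obtain W where "\<And>i. dir_var_le i L u (W i)" "(\<Sum>i\<in>UNIV. W i) \<le> sqrt CARD('n) * V"
    using dir_var_exists[OF uo u(4)] by blast
  then have "bv_data L M (sqrt CARD('n) * V) u" using ui M by (auto simp: bv_data_def)
  then show ?thesis using that u(1) by blast
qed

text \<open>A step towards the root lowers the sum of the coordinates, so induction on that sum
  recovers all values from the root value and the increments.\<close>

lemma tree_codes_determine:
  fixes a b :: "('n::finite \<Rightarrow> nat) \<Rightarrow> int"
  assumes "a (\<lambda>_. 0) = b (\<lambda>_. 0)"
    and "\<And>k. k \<in> grid m - {\<lambda>_. 0} \<Longrightarrow> a k - a (parent k) = b k - b (parent k)"
  shows "k \<in> grid m \<Longrightarrow> a k = b k"
proof (induction "sum k UNIV" arbitrary: k rule: less_induct)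
  case less
  show ?case
  proof (cases "k = (\<lambda>_. 0)")
    case False
    then have "a (parent k) = b (parent k)"
      using less parent_sum_less parent_grid by blast
    moreover have "a k - a (parent k) = b k - b (parent k)" using assms(2) False less.prems by blast
    ultimately show ?thesis by simp
  qed (simp add: assms(1))
qed

text \<open>The covering sets are the fibres of the code. In the condition on \<open>K\<close> the
  first term is the variation of the averages along the tree in units of \<open>h\<close>; the
  second is the number of edges, since rounding adds at most one unit to each increment. The factor
  \<open>2 * M / h + 2\<close> bounds the number of rounded values at the origin.\<close>

lemma covering_exists:
  fixes L M V h \<epsilon> :: real and N K :: nat
  assumes L: "L > 0" and M: "M > 0" and V: "V > 0" and N: "N > 0" and h: "h > 0"
    and close: "2 * (L / real N * (sqrt CARD('n::finite) * V)) + h * L ^ CARD('n) \<le> 2 * \<epsilon>"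
    and K: "N = 1 \<or> L / real N * (sqrt CARD('n) * V) / (L / real N) ^ CARD('n) / h + (real (N ^ CARD('n)) - 1) \<le> real K"
  obtains C :: "(real^'n \<Rightarrow> real) set set set"
  where "finite C" "eps_covering (L1_cube L) \<epsilon> (BV_class L M V) C"
    "real (card C) \<le> (2 * M / h + 2) * (2 ^ K * 3 ^ (N ^ CARD('n) - 1))"
proof -
  let ?n = "CARD('n)"
  let ?V = "sqrt ?n * V"
  let ?m = "\<lambda>_ :: 'n. N"
  let ?o = "\<lambda>_ :: 'n. 0 :: nat"
  let ?S = "grid ?m - {?o}"
  let ?mu = "lebesgue_on (closed_cube L) :: (real^'n) measure"
  have m: "\<forall>i. ?m i > 0" using N by simp
  have o: "?o \<in> grid ?m" using N by (simp add: grid_def)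
  have card_S: "card ?S = N ^ ?n - 1" using o by (simp add: card_Diff_singleton card_grid)
  define q where "q u k = \<lfloor>cell_avg L ?m u k / h\<rfloor>" for u :: "real^'n \<Rightarrow> real" and k
  define E where "E u = (q u ?o, restrict (\<lambda>k. q u k - q u (parent k)) ?S)" for u
  define D where "D = {f \<in> ?S \<rightarrow>\<^sub>E {- int K..int K}. (\<Sum>k\<in>?S. \<bar>f k\<bar>) \<le> int K}"
  define T where "T = {\<lfloor>- M / h\<rfloor>..\<lfloor>M / h\<rfloor>} \<times> D"
  define A where "A t = {L1_class ?mu u | u. bv_data L M ?V u \<and> E u = t}" for t
  have finS: "finite ?S" by simp
  have finD: "finite D" and cardD: "real (card D) \<le> 2 ^ K * 3 ^ card ?S"
    using card_bounded_variation_sequences[OF finS, of K] by (simp_all add: D_def)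
  have finT: "finite T" using finD by (simp add: T_def)
  have ET: "E u \<in> T" if u: "bv_data L M ?V u" for u
  proof -
    from u obtain W where ui: "set_integrable lebesgue (closed_cube L) u"
      and uM: "AE x in lebesgue. x \<in> closed_cube L \<longrightarrow> \<bar>u x\<bar> \<le> M"
      and W: "\<And>i. dir_var_le i L u (W i)" "(\<Sum>i\<in>UNIV. W i) \<le> ?V"
      by (auto simp: bv_data_def)
    have "\<bar>cell_avg L ?m u ?o\<bar> \<le> M" by (rule cell_avg_bound[OF L ui uM m o])
    then have "- M \<le> cell_avg L ?m u ?o" "cell_avg L ?m u ?o \<le> M" by linarith+
    then have "- M / h \<le> cell_avg L ?m u ?o / h" "cell_avg L ?m u ?o / h \<le> M / h"
      using h by (auto intro!: divide_right_mono simp del: minus_divide_left[symmetric])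
    then have 1: "q u ?o \<in> {\<lfloor>- M / h\<rfloor>..\<lfloor>M / h\<rfloor>}" unfolding q_def by (auto intro!: floor_mono)
    have "real_of_int (\<Sum>k\<in>?S. \<bar>q u k - q u (parent k)\<bar>) \<le> real K"
    \<comment> \<open>A single cell has no tree edges, so even \<open>K = 0\<close> is allowed;
      \<open>eps_entropy_upper\<close> relies on this.\<close>
    proof (cases "N = 1")
      case True
      have "k = ?o" if "k \<in> grid ?m" for k using that True by (auto simp: grid_def fun_eq_iff)
      then have "?S = {}" by blast
      then show ?thesis by (simp only: sum.empty of_int_0 of_nat_0_le_iff)
    next
      case False
      have "real_of_int (\<Sum>k\<in>?S. \<bar>q u k - q u (parent k)\<bar>) = (\<Sum>k\<in>?S. \<bar>real_of_int (q u k) - real_of_int (q u (parent k))\<bar>)"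
        by simp
      also have "\<dots> \<le> (\<Sum>k\<in>?S. \<bar>cell_avg L ?m u k - cell_avg L ?m u (parent k)\<bar> / h + 1)"
      proof (rule sum_mono)
        fix k
        have "\<bar>real_of_int \<lfloor>x\<rfloor> - real_of_int \<lfloor>y\<rfloor>\<bar> \<le> \<bar>x - y\<bar> + 1" for x y :: real by linarith
        from this[of "cell_avg L ?m u k / h" "cell_avg L ?m u (parent k) / h"]
        show "\<bar>real_of_int (q u k) - real_of_int (q u (parent k))\<bar> \<le> \<bar>cell_avg L ?m u k - cell_avg L ?m u (parent k)\<bar> / h + 1"
          using h by (simp add: q_def abs_divide flip: diff_divide_distrib)
      qed
      also have "\<dots> = (\<Sum>k\<in>?S. \<bar>cell_avg L ?m u k - cell_avg L ?m u (parent k)\<bar>) / h + real (card ?S)"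
        by (simp add: sum.distrib sum_divide_distrib)
      also have "\<dots> \<le> L / real N * ?V / (L / real N) ^ ?n / h + (real (N ^ ?n) - 1)"
      proof (rule add_mono)
        show "(\<Sum>k\<in>?S. \<bar>cell_avg L ?m u k - cell_avg L ?m u (parent k)\<bar>) / h \<le> L / real N * ?V / (L / real N) ^ ?n / h"
          using h sum_avg_parent_le[OF L ui N W] by (intro divide_right_mono) auto
        show "real (card ?S) \<le> real (N ^ ?n) - 1"
          unfolding card_S using N by (simp add: of_nat_diff)
      qed
      also have "\<dots> \<le> real K" using K False by blast
      finally show ?thesis .
    qed
    then have 2: "(\<Sum>k\<in>?S. \<bar>q u k - q u (parent k)\<bar>) \<le> int K" by linarith
    have "\<bar>q u k - q u (parent k)\<bar> \<le> int K" if "k \<in> ?S" for k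
      using member_le_sum[OF that, of "\<lambda>k. \<bar>q u k - q u (parent k)\<bar>"] 2 finS by simp
    then have "q u k - q u (parent k) \<in> {- int K..int K}" if "k \<in> ?S" for k
      using that unfolding abs_le_iff atLeastAtMost_iff by (metis minus_le_iff)
    then have "restrict (\<lambda>k. q u k - q u (parent k)) ?S \<in> D"
      unfolding D_def using 2 by (auto simp: PiE_def Pi_def)
    with 1 show ?thesis by (simp add: E_def T_def)
  qed
  have dist: "(LINT x:closed_cube L|lebesgue. \<bar>u x - v x\<bar>) \<le> 2 * \<epsilon>"
    if u: "bv_data L M ?V u" and v: "bv_data L M ?V v" and Eq: "E u = E v" for u v
  proof -
    have osc: "osc L ?m w \<le> L / real N * ?V" if "bv_data L M ?V w" for w
      using that V osc_le[OF L _ _ N, of w M _ ?V] unfolding bv_data_def by auto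
    have fun_eq: "restrict (\<lambda>k. q u k - q u (parent k)) ?S k = restrict (\<lambda>k. q v k - q v (parent k)) ?S k" for k
      using Eq by (simp add: E_def)
    have qq: "q u k = q v k" if "k \<in> grid ?m" for k
    proof (rule tree_codes_determine[of _ _ ?m])
      show "q u ?o = q v ?o" using Eq by (simp add: E_def)
      show "q u k - q u (parent k) = q v k - q v (parent k)" if "k \<in> ?S" for k
        using fun_eq[of k] that by (simp only: restrict_apply' if_True)
    qed (rule that)
    have "\<bar>cell_avg L ?m u k - cell_avg L ?m v k\<bar> \<le> h" if "k \<in> grid ?m" for k
    proof -
      have "\<lfloor>cell_avg L ?m u k / h\<rfloor> = \<lfloor>cell_avg L ?m v k / h\<rfloor>" using qq[OF that] by (simp add: q_def)
      then have "\<bar>cell_avg L ?m u k / h - cell_avg L ?m v k / h\<bar> \<le> 1" by linarith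
      then show ?thesis using h by (simp add: abs_divide flip: diff_divide_distrib)
    qed
    then have "(LINT x:closed_cube L|lebesgue. \<bar>u x - v x\<bar>) \<le> osc L ?m u + osc L ?m v + h * L ^ ?n"
      using u v by (intro L1_distance_le_osc[OF L _ _ m]) (auto simp: bv_data_def)
    also have "\<dots> \<le> 2 * \<epsilon>" by (rule order_trans[OF add_right_mono[OF add_mono[OF osc[OF u] osc[OF v]]]]) (use close in \<open>simp add: mult_ac\<close>)
    finally show ?thesis .
  qed
  show ?thesis
  proof (rule that[of "A ` T"])
    show "finite (A ` T)" using finT by simp
    show "eps_covering (L1_cube L) \<epsilon> (BV_class L M V) (A ` T)"
      unfolding eps_covering_def
    proof (intro conjI ballI)
      show "A ` T \<subseteq> Pow (mspace (L1_cube L))"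
        by (auto simp: A_def bv_data_def integrable_cube_iff intro!: L1_class_in_space)
      show "BV_class L M V \<subseteq> \<Union> (A ` T)"
      proof
        fix c :: "(real^'n \<Rightarrow> real) set" assume "c \<in> BV_class L M V"
        then obtain u where "c = L1_class ?mu u" "bv_data L M ?V u" by (rule BV_class_data)
        then show "c \<in> \<Union> (A ` T)" using ET[of u] by (auto simp: A_def)
      qed
      fix B x y assume B: "B \<in> A ` T" and x: "x \<in> B" and y: "y \<in> B"
      then obtain u v where "x = L1_class ?mu u" "y = L1_class ?mu v"
        and uv: "bv_data L M ?V u" "bv_data L M ?V v" "E u = E v"
        by (auto simp: A_def)
      moreover have "integrable ?mu u" "integrable ?mu v"
        using uv by (simp_all add: bv_data_def integrable_cube_iff)
      ultimately have "mdist (L1_cube L) x y = (LINT x:closed_cube L|lebesgue. \<bar>u x - v x\<bar>)"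
        by (simp add: L1_dist_class integral_cube_eq)
      then show "mdist (L1_cube L) x y \<le> 2 * \<epsilon>" using dist[OF uv] by simp
    qed
    have "real (card (A ` T)) \<le> real (card T)" using finT by (simp add: card_image_le)
    also have "\<dots> = real (card {\<lfloor>- M / h\<rfloor>..\<lfloor>M / h\<rfloor>}) * real (card D)"
      by (simp add: T_def card_cartesian_product)
    also have "\<dots> \<le> (2 * M / h + 2) * (2 ^ K * 3 ^ card ?S)"
    proof (rule mult_mono)
      have "real (card {\<lfloor>- M / h\<rfloor>..\<lfloor>M / h\<rfloor>}) = real_of_int (\<lfloor>M / h\<rfloor> - \<lfloor>- M / h\<rfloor> + 1)"
      proof -
        have "- M / h \<le> M / h" using M h by (intro divide_right_mono) auto
        then have "\<lfloor>- M / h\<rfloor> \<le> \<lfloor>M / h\<rfloor>" by (rule floor_mono)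
        then show ?thesis by simp
      qed
      also have "\<dots> \<le> M / h - (- M / h) + 2" by linarith
      also have "\<dots> = 2 * M / h + 2" by simp
      finally show "real (card {\<lfloor>- M / h\<rfloor>..\<lfloor>M / h\<rfloor>}) \<le> 2 * M / h + 2" .
    qed (use cardD M h in auto)
    finally show "real (card (A ` T)) \<le> (2 * M / h + 2) * (2 ^ K * 3 ^ (N ^ ?n - 1))"
      unfolding card_S .
  qed
qed

section \<open>Choice of the parameters and comparison with the constant\<close>

lemma eps_entropy_le:
  assumes "finite C" "eps_covering X \<epsilon> E C" "real (card C) \<le> B" "1 \<le> B"
  shows "eps_entropy X \<epsilon> E \<le> ereal (log 2 B)"
proof -
  have "covering_number X \<epsilon> E \<le> enat (card C)"
    unfolding covering_number_def using assms by (intro INF_lower) auto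
  then obtain k where k: "covering_number X \<epsilon> E = enat k" "k \<le> card C"
    by (cases "covering_number X \<epsilon> E") auto
  have "log 2 (real k) \<le> log 2 B"
  proof (cases "k = 0")
    \<comment> \<open>The empty set has covering number 0, and \<open>log 2 0 = 0\<close> by
      convention; \<open>1 \<le> B\<close> takes care of this.\<close>
    case True
    then show ?thesis using assms(4) by (simp add: log_def)
  next
    case False
    then show ?thesis using k(2) assms(3) by (intro log_mono) auto
  qed
  then show ?thesis by (simp add: eps_entropy_def k(1))
qed

text \<open>\<open>2 powr Y\<close> lies above its tangent at 8, and from 8 on that tangent lies
  above \<open>3 * Y + 2\<close>: the values at 8 are 256 and 26, the slopes 256 ln 2 and 3.
  \<open>Y\<close> will be \<open>M * L ^ n / \<epsilon>\<close>.\<close>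

lemma log2_linear_le:
  fixes Y :: real
  assumes "Y \<ge> 8" shows "log 2 (3 * Y + 2) \<le> Y"
proof -
  have "3 * Y + 2 \<le> 256 * (1 + (Y - 8) * ln 2)"
  proof -
    have "(Y - 8) * (2 / 3) \<le> (Y - 8) * ln 2"
      using assms ln2_ge_two_thirds by (intro mult_left_mono) auto
    then have "256 * (1 + (Y - 8) * (2 / 3)) \<le> 256 * (1 + (Y - 8) * ln 2)" by simp
    moreover have "3 * Y + 2 \<le> 256 * (1 + (Y - 8) * (2 / 3))"
    proof -
      have "256 * (1 + (Y - 8) * (2 / 3)) = 512 / 3 * Y - 3328 / 3" by (simp add: field_simps)
      then show ?thesis using assms by linarith
    qed
    ultimately show ?thesis by (rule order_trans[rotated])
  qed
  also have "\<dots> \<le> 256 * exp ((Y - 8) * ln 2)"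
    by (intro mult_left_mono exp_ge_add_one_self) auto
  also have "\<dots> = 2 powr 8 * 2 powr (Y - 8)"
    using powr_realpow[of 2 8] by (simp add: powr_def[of 2 "Y - 8"])
  also have "\<dots> = 2 powr Y" by (simp only: powr_add[symmetric]) simp
  finally have "log 2 (3 * Y + 2) \<le> log 2 (2 powr Y)"
    using assms by (intro log_mono) auto
  then show ?thesis by simp
qed

text \<open>By Bernoulli's inequality \<open>(4/3) ^ n\<close> grows at least linearly, hence faster
  than sqrt n. This trades the \<open>(3 * X) ^ n\<close> from the number of cells for the
  \<open>(4 * X) ^ n / sqrt n\<close> of \<open>Gamma_const\<close>.\<close>

lemma three_fourths_power_le:
  assumes "n \<ge> 1"
  shows "4 * 3 ^ n * sqrt (real n) \<le> 8 * 4 ^ n"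
proof -
  have "sqrt (real n) \<le> (1 + real n) / 2"
    using arith_geo_mean_sqrt[of 1 "real n"] by simp
  also have "\<dots> \<le> 2 * (1 + real n * (1/3))" by simp
  also have "\<dots> \<le> 2 * (1 + 1/3) ^ n"
    using Bernoulli_inequality[of "1/3" n] by (intro mult_left_mono) auto
  finally have "3 ^ n * sqrt (real n) \<le> 3 ^ n * (2 * (4/3) ^ n)"
    by (intro mult_left_mono) auto
  also have "\<dots> = 2 * 4 ^ n" by (simp add: power_divide)
  finally have "4 * (3 ^ n * sqrt (real n)) \<le> 4 * (2 * 4 ^ n)" by (intro mult_left_mono) auto
  then show ?thesis by (simp only: mult.assoc)
qed

text \<open>The cost \<open>Y\<close> of the root value has only the order
  \<open>1 / \<epsilon>\<close>; since \<open>Y / 8\<close> is at least 1, it is at most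
  \<open>8 * (Y / 8) ^ n\<close>, which has the order of the bound.\<close>

lemma Gamma_const_ge:
  fixes L M V \<epsilon> :: real
  assumes L: "L > 0" and M: "M > 0" and V: "V > 0" and e: "\<epsilon> > 0" "\<epsilon> < M * L ^ n / 8"
    and n: "n \<ge> 1"
  shows "M * L ^ n / \<epsilon> + 8 / sqrt (real n) * (4 * sqrt (real n) * L * V) ^ n / \<epsilon> ^ n
    \<le> Gamma_const n L M V * (1 / \<epsilon> ^ n)"
proof -
  define Y where "Y = M * L ^ n / \<epsilon>"
  have Y8: "Y / 8 \<ge> 1" using e by (simp add: Y_def field_simps)
  have "Y / 8 \<le> (Y / 8) ^ n" using power_increasing[of 1 n "Y / 8"] Y8 n by simp
  then have "Y \<le> 8 * (Y / 8) ^ n" by simp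
  also have "\<dots> = 8 * (M * L ^ n / 8) ^ n / \<epsilon> ^ n"
    by (simp add: Y_def power_divide)
  also have "\<dots> \<le> (2 ^ (n + 7) * V / M + 8) * (M * L ^ n / 8) ^ n / \<epsilon> ^ n"
    using L M V e by (intro divide_right_mono mult_right_mono) auto
  finally show ?thesis
    by (simp add: Gamma_const_def Y_def ring_distribs add_divide_distrib)
qed

lemma eps_entropy_upper:
  fixes L M V \<epsilon> :: real
  assumes L: "L > 0" and M: "M > 0" and V: "V > 0"
    and e: "0 < \<epsilon>" "\<epsilon> < M * L ^ CARD('n::finite) / 8"
  shows "eps_entropy (L1_cube L) \<epsilon> (BV_class L M V :: (real^'n \<Rightarrow> real) set set)
           \<le> ereal (Gamma_const CARD('n) L M V * (1 / \<epsilon> ^ CARD('n)))"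
proof -
  let ?n = "CARD('n)"
  have n: "?n \<ge> 1" by (simp add: Suc_leI)
  define s where "s = sqrt (real ?n)"
  have s: "s \<ge> 1" using n by (simp add: s_def)
  define X where "X = s * V * L / \<epsilon>"
  define Y where "Y = M * L ^ ?n / \<epsilon>"
  \<comment> \<open>Two thirds of the diameter \<open>2 * \<epsilon>\<close> go to the averaging error and one third to the rounding.\<close>
  define h where "h = 2 * \<epsilon> / (3 * L ^ ?n)"
  \<comment> \<open>The smallest positive \<open>N\<close> with \<open>X / N \<le> 2 / 3\<close>, so
    that the averaging errors of two functions sum to at most
    \<open>4 / 3 * \<epsilon>\<close>.\<close>
  define N where "N = max 1 (nat \<lceil>3 / 2 * X\<rceil>)"
  \<comment> \<open>One \<open>N ^ n\<close> pays for the variation of the averages and one for the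
    rounding. For \<open>N = 1\<close> no bits may be charged: \<open>X\<close> can be arbitrarily
    small there, and with it the first summand of the bound.\<close>
  define K where "K = (if N = 1 then 0 else 2 * N ^ ?n)"
  have X: "X > 0" using s V L e by (simp add: X_def)
  have Y: "Y \<ge> 8" using e by (simp add: Y_def field_simps)
  have h: "h > 0" using e L by (simp add: h_def)
  have N: "N > 0" by (simp add: N_def)
  have NX: "3 / 2 * X \<le> real N"
  proof -
    have "3 / 2 * X \<le> real (nat \<lceil>3 / 2 * X\<rceil>)" using X by linarith
    then show ?thesis by (simp add: N_def)
  qed
  have XN: "X / real N \<le> 2 / 3" using NX N by (simp add: field_simps)
  have LV: "L / real N * (s * V) = \<epsilon> * (X / real N)" using e by (simp add: X_def field_simps)
  have close: "2 * (L / real N * (sqrt ?n * V)) + h * L ^ ?n \<le> 2 * \<epsilon>"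
  proof -
    have "2 * (L / real N * (s * V)) \<le> 2 * (\<epsilon> * (2 / 3))"
      unfolding LV using e XN by (intro mult_left_mono) auto
    moreover have "h * L ^ ?n = 2 * \<epsilon> / 3" using L by (simp add: h_def)
    ultimately show ?thesis unfolding s_def[symmetric] by linarith
  qed
  have K: "N = 1 \<or> L / real N * (sqrt ?n * V) / (L / real N) ^ ?n / h + (real (N ^ ?n) - 1) \<le> real K"
  proof (cases "N = 1")
    case False
    have "L / real N * (s * V) / (L / real N) ^ ?n / h = 3 / 2 * (X / real N) * real N ^ ?n"
      unfolding LV using e L N by (simp add: h_def power_divide field_simps)
    also have "\<dots> \<le> 1 * real N ^ ?n"
    proof (rule mult_right_mono)
      show "3 / 2 * (X / real N) \<le> 1" using XN by linarith
    qed simp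
    finally show ?thesis using False by (simp add: K_def s_def)
  qed simp
  obtain C :: "(real^'n \<Rightarrow> real) set set set"
    where C: "finite C" "eps_covering (L1_cube L) \<epsilon> (BV_class L M V) C"
    "real (card C) \<le> (2 * M / h + 2) * (2 ^ K * 3 ^ (N ^ ?n - 1))"
    using covering_exists[OF L M V N h close K] by blast
  let ?B = "(2 * M / h + 2) * (2 ^ K * 3 ^ (N ^ ?n - 1))"
  have Mh: "2 * M / h + 2 = 3 * Y + 2" using L e by (simp add: h_def Y_def)
  have pos: "3 * Y + 2 > 0" using Y by simp
  have B1: "1 \<le> ?B"
  proof -
    have "1 * 1 \<le> (3 * Y + 2) * (2 ^ K * 3 ^ (N ^ ?n - 1))"
    proof (rule mult_mono)
      have "1 * 1 \<le> (2::real) ^ K * 3 ^ (N ^ ?n - 1)"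
        by (rule mult_mono) (auto intro: one_le_power)
      then show "1 \<le> (2::real) ^ K * 3 ^ (N ^ ?n - 1)" by simp
    qed (use Y in auto)
    then show ?thesis unfolding Mh by simp
  qed
  have "log 2 ?B \<le> Y + 8 / s * (4 * s * L * V) ^ ?n / \<epsilon> ^ ?n"
  proof (cases "N = 1")
    case True
    then have "log 2 ?B = log 2 (3 * Y + 2)" unfolding Mh by (simp add: K_def)
    also have "\<dots> \<le> Y" by (rule log2_linear_le[OF Y])
    also have "\<dots> \<le> Y + 8 / s * (4 * s * L * V) ^ ?n / \<epsilon> ^ ?n"
      using s L V e by simp
    finally show ?thesis .
  next
    case False
    \<comment> \<open>For \<open>N \<ge> 2\<close> the 1 lost by rounding up is at most
      \<open>N / 2\<close>.\<close>
    have "real N \<le> 3 * X"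
    proof -
      have "N \<ge> 2" using False N by linarith
      then have "N = nat \<lceil>3 / 2 * X\<rceil>" by (simp add: N_def max_def split: if_splits)
      then have "real N < 3 / 2 * X + 1" using X by linarith
      with \<open>N \<ge> 2\<close> show ?thesis by linarith
    qed
    then have NX': "real N ^ ?n \<le> (3 * X) ^ ?n" by (intro power_mono) auto
    have "log 2 ?B = log 2 (3 * Y + 2) + (real K + real (N ^ ?n - 1) * log 2 3)"
      unfolding Mh using pos by (simp add: log_mult log_nat_power)
    also have "\<dots> \<le> Y + (real K + real (N ^ ?n) * 2)"
    proof (intro add_mono mult_mono log2_linear_le[OF Y])
      have "log 2 3 \<le> log 2 (4::real)" by (intro log_mono) auto
      moreover have "log 2 (4::real) = 2" using log_pow_cancel[of "2::real" 2] by simp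
      ultimately show "log 2 3 \<le> (2::real)" by (simp only:)
    qed auto
    \<comment> \<open>\<open>K\<close> accounts for two bits per cell, and the factor 3 per edge for
      at most two more.\<close>
    also have "\<dots> = Y + 4 * real N ^ ?n" using False by (simp add: K_def)
    also have "\<dots> \<le> Y + 4 * (3 * X) ^ ?n" using NX' by simp
    also have "4 * (3 * X) ^ ?n \<le> 8 / s * (4 * s * L * V) ^ ?n / \<epsilon> ^ ?n"
    proof -
      have "4 * 3 ^ ?n * s / s \<le> 8 * 4 ^ ?n / s"
        using three_fourths_power_le[OF n] s by (intro divide_right_mono) (auto simp: s_def)
      then have "4 * 3 ^ ?n * X ^ ?n \<le> 8 / s * 4 ^ ?n * X ^ ?n"
        using s X by (intro mult_right_mono) auto
      then show ?thesis
        by (simp add: X_def power_mult_distrib power_divide mult_ac)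
    qed
    finally show ?thesis by simp
  qed
  also have "\<dots> \<le> Gamma_const ?n L M V * (1 / \<epsilon> ^ ?n)"
    unfolding Y_def s_def by (rule Gamma_const_ge[OF L M V e n])
  finally have le: "log 2 ?B \<le> Gamma_const ?n L M V * (1 / \<epsilon> ^ ?n)" .
  have "eps_entropy (L1_cube L) \<epsilon> (BV_class L M V :: (real^'n \<Rightarrow> real) set set) \<le> ereal (log 2 ?B)"
    by (rule eps_entropy_le[OF C B1])
  also have "\<dots> \<le> ereal (Gamma_const ?n L M V * (1 / \<epsilon> ^ ?n))" using le by simp
  finally show ?thesis .
qed

section \<open>Step functions of bounded variation\<close>

text \<open>Fubini with the coordinate along \<open>b\<close> innermost. Comparing two integrands
  line by line lets the fundamental theorem of calculus act inside an integral over the whole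
  space.\<close>

lemma lborel_integral_eq_lines:
  fixes f g :: "'a::euclidean_space \<Rightarrow> real"
  assumes f: "integrable lborel f" and g: "integrable lborel g" and b: "b \<in> Basis"
    and eq: "\<And>x. (\<integral>t. f (x + t *\<^sub>R b) \<partial>lborel) = (\<integral>t. g (x + t *\<^sub>R b) \<partial>lborel)"
  shows "integral\<^sup>L lborel f = integral\<^sup>L lborel g"
proof -
  interpret product_sigma_finite "\<lambda>_ :: 'a. lborel :: real measure" ..
  let ?\<phi> = "\<lambda>y :: 'a \<Rightarrow> real. \<Sum>c\<in>Basis. y c *\<^sub>R c"
  let ?P = "\<Pi>\<^sub>M c\<in>Basis. (lborel :: real measure)"
  have ins: "insert b (Basis - {b}) = (Basis :: 'a set)" using b by auto
  have meas: "?\<phi> \<in> measurable ?P borel" by measurable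
  have Fub: "integral\<^sup>L lborel h = (\<integral>y. (\<integral>t. h (?\<phi> (y(b := t))) \<partial>lborel) \<partial>Pi\<^sub>M (Basis - {b}) (\<lambda>_. lborel))"
    if h: "integrable lborel h" for h :: "'a \<Rightarrow> real"
  proof -
    have hd: "integrable (distr ?P borel ?\<phi>) h" using h by (subst (asm) lborel_eq)
    have hm: "h \<in> borel_measurable borel" using h by (simp add: borel_measurable_integrable)
    have hP: "integrable ?P (\<lambda>y. h (?\<phi> y))"
      using hd hm by (subst (asm) integrable_distr_eq[OF meas]) auto
    have "integral\<^sup>L lborel h = integral\<^sup>L (distr ?P borel ?\<phi>) h" by (subst lborel_eq) simp
    also have "\<dots> = (\<integral>y. h (?\<phi> y) \<partial>?P)" by (rule integral_distr[OF meas hm])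
    also have "\<dots> = (\<integral>y. h (?\<phi> y) \<partial>Pi\<^sub>M (insert b (Basis - {b})) (\<lambda>_. lborel))" by (simp only: ins)
    also have "\<dots> = (\<integral>y. (\<integral>t. h (?\<phi> (y(b := t))) \<partial>lborel) \<partial>Pi\<^sub>M (Basis - {b}) (\<lambda>_. lborel))"
      using hP by (intro product_integral_insert) (simp_all only: ins, auto)
    finally show ?thesis .
  qed
  have \<phi>: "?\<phi> (y(b := t)) = (\<Sum>c\<in>Basis - {b}. y c *\<^sub>R c) + t *\<^sub>R b" for y t
  proof -
    have "?\<phi> (y(b := t)) = (y(b := t)) b *\<^sub>R b + (\<Sum>c\<in>Basis - {b}. (y(b := t)) c *\<^sub>R c)"
      by (rule sum.remove[OF finite_Basis b])
    also have "(\<Sum>c\<in>Basis - {b}. (y(b := t)) c *\<^sub>R c) = (\<Sum>c\<in>Basis - {b}. y c *\<^sub>R c)"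
      by (rule sum.cong) auto
    finally show ?thesis by (simp add: add.commute)
  qed
  show ?thesis unfolding Fub[OF f] Fub[OF g] \<phi> eq ..
qed

definition set_coord :: "'n \<Rightarrow> real \<Rightarrow> real^'n \<Rightarrow> real^'n" where
  "set_coord i t x = (\<chi> j. if j = i then t else x $ j)"

lemma set_coord_measurable [measurable]:
  fixes i :: "'n::finite"
  assumes [measurable]: "g \<in> borel_measurable borel"
  shows "(\<lambda>x :: real^'n. set_coord i (g x) x) \<in> borel_measurable borel"
proof (rule borel_measurable_euclidean_space[THEN iffD2], rule ballI)
  fix b :: "real^'n" assume "b \<in> Basis"
  then obtain j where b: "b = axis j 1" by (auto simp: Basis_vec_def)
  show "(\<lambda>x. set_coord i (g x) x \<bullet> b) \<in> borel_measurable borel"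
    unfolding b inner_axis set_coord_def by (cases "j = i") simp_all
qed

text \<open>Averaging the two boundary terms over the cell itself replaces integrals over faces, so that
  only Lebesgue measure on the whole space is needed.\<close>

lemma cell_integral_partial_deriv:
  fixes \<psi> :: "real^'n::finite \<Rightarrow> real" and m k :: "'n \<Rightarrow> nat" and L :: real
  assumes L: "L > 0" and m: "\<forall>i. m i > 0" and \<psi>: "Ck 1 \<psi>"
  shows "(LINT x:cell L m k|lborel. partial_deriv i \<psi> x) =
    m i / L * (LINT x:cell L m k|lborel. \<psi> (set_coord i (L * (real (k i) + 1) / m i) x) - \<psi> (set_coord i (L * k i / m i) x))"
    and "set_integrable lborel (cell L m k) (\<lambda>x. \<psi> (set_coord i c x))"
    and "set_integrable lborel (cell L m k) (partial_deriv i \<psi>)"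
proof -
  let ?C = "cell L m k"
  define lo where "lo = L * real (k i) / real (m i)"
  define hi where "hi = L * (real (k i) + 1) / real (m i)"
  have mi: "real (m i) > 0" using m by simp
  have hl: "hi - lo = L / real (m i)" by (simp add: hi_def lo_def ring_distribs add_divide_distrib)
  have lohi: "lo < hi" using hl L mi by (metis diff_gt_0_iff_gt divide_pos_pos)
  have bounded_C: "bounded ?C"
    by (rule bounded_subset[OF bounded_cbox cell_box(2)[OF L m]])
  have cont: "continuous_on UNIV \<psi>" by (rule Ck_1_continuous[OF \<psi>])
  have intb: "set_integrable lborel ?C f" if "continuous_on UNIV f" for f :: "real^'n \<Rightarrow> real"
  proof -
    have "set_integrable lborel (closure ?C) f"
      using bounded_C by (intro borel_integrable_compact[unfolded set_integrable_def[symmetric]] continuous_on_subset[OF that]) (auto simp: compact_closure)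
    then show ?thesis by (rule set_integrable_subset) (auto simp: closure_subset)
  qed
  have sc_cont: "continuous_on UNIV (set_coord i c)" for c :: real
    unfolding set_coord_def
  proof (rule continuous_on_vec_lambda)
    show "continuous_on UNIV (\<lambda>x. if j = i then c else x $ j)" for j :: 'n
      by (cases "j = i") (auto intro!: continuous_intros)
  qed
  show int_sc: "set_integrable lborel ?C (\<lambda>x. \<psi> (set_coord i c x))" for c
    by (intro intb continuous_on_compose2[OF cont sc_cont]) auto
  show int_pd: "set_integrable lborel ?C (partial_deriv i \<psi>)"
    by (intro intb Ck_1_partial_deriv \<psi>)
  let ?g = "\<lambda>x. real (m i) / L * (indicator ?C x * (\<psi> (set_coord i hi x) - \<psi> (set_coord i lo x)))"
  have "integral\<^sup>L lborel (\<lambda>x. indicator ?C x * partial_deriv i \<psi> x) = integral\<^sup>L lborel ?g"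
  proof (rule lborel_integral_eq_lines[where b = "axis i 1"])
    show "integrable lborel (\<lambda>x. indicator ?C x * partial_deriv i \<psi> x)"
      using int_pd by (simp add: set_integrable_def)
    have "integrable lborel (\<lambda>x. indicator ?C x * (\<psi> (set_coord i hi x) - \<psi> (set_coord i lo x)))"
      using set_integral_diff(1)[OF int_sc int_sc] by (simp add: set_integrable_def)
    then show "integrable lborel ?g" by (rule integrable_mult_right)
    show "axis i 1 \<in> (Basis :: (real^'n) set)" by (auto simp: Basis_vec_def)
    fix x :: "real^'n"
    define inC where "inC \<longleftrightarrow> (\<forall>j. j \<noteq> i \<longrightarrow> \<lfloor>real (m j) * x $ j / L\<rfloor> = int (k j))"
    have mem: "x + t *\<^sub>R axis i 1 \<in> ?C \<longleftrightarrow> inC \<and> lo \<le> x $ i + t \<and> x $ i + t < hi" for t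
    proof -
      have "(x + t *\<^sub>R axis i 1) $ j = (if j = i then x $ i + t else x $ j)" for j
        by (simp add: axis_def)
      then have "x + t *\<^sub>R axis i 1 \<in> ?C \<longleftrightarrow> inC \<and> \<lfloor>real (m i) * (x $ i + t) / L\<rfloor> = int (k i)"
        unfolding cell_def inC_def mem_Collect_eq by metis
      also have "\<lfloor>real (m i) * (x $ i + t) / L\<rfloor> = int (k i) \<longleftrightarrow> real (k i) \<le> real (m i) * (x $ i + t) / L \<and> real (m i) * (x $ i + t) / L < real (k i) + 1"
        by (simp add: floor_eq_iff)
      also have "\<dots> \<longleftrightarrow> lo \<le> x $ i + t \<and> x $ i + t < hi"
        using L mi by (simp add: lo_def hi_def pos_le_divide_eq pos_divide_le_eq pos_divide_less_eq pos_less_divide_eq mult.commute)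
      finally show ?thesis .
    qed
    show "(\<integral>t. indicator ?C (x + t *\<^sub>R axis i 1) * partial_deriv i \<psi> (x + t *\<^sub>R axis i 1) \<partial>lborel) = (\<integral>t. ?g (x + t *\<^sub>R axis i 1) \<partial>lborel)"
    proof (cases inC)
      case False
      then show ?thesis by (simp add: mem indicator_def)
    next
      case True
      define a b where "a = lo - x $ i" and "b = hi - x $ i"
      have ab: "a < b" using lohi by (simp add: a_def b_def)
      have ind: "indicator ?C (x + t *\<^sub>R axis i 1) = (indicator {a..<b} t :: real)" for t
        using True by (auto simp: mem indicator_def a_def b_def)
      define D where "D = \<psi> (x + b *\<^sub>R axis i 1) - \<psi> (x + a *\<^sub>R axis i 1)"
      have sc: "set_coord i c (x + t *\<^sub>R axis i 1) = x + (c - x $ i) *\<^sub>R axis i 1" for c t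
        by (auto simp: set_coord_def vec_eq_iff axis_def)
      have "(\<integral>t. indicator ?C (x + t *\<^sub>R axis i 1) * partial_deriv i \<psi> (x + t *\<^sub>R axis i 1) \<partial>lborel)
        = (\<integral>t. indicator {a..b} t *\<^sub>R partial_deriv i \<psi> (x + t *\<^sub>R axis i 1) \<partial>lborel)"
      proof (rule integral_cong_AE)
        have pc: "continuous_on UNIV (\<lambda>t. partial_deriv i \<psi> (x + t *\<^sub>R axis i 1))"
          by (intro continuous_on_compose2[OF Ck_1_partial_deriv[OF \<psi>]] continuous_intros) auto
        note [measurable] = borel_measurable_continuous_onI[OF pc]
        show "(\<lambda>t. indicator ?C (x + t *\<^sub>R axis i 1) * partial_deriv i \<psi> (x + t *\<^sub>R axis i 1)) \<in> borel_measurable lborel"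
          unfolding ind by measurable
        show "(\<lambda>t. indicator {a..b} t *\<^sub>R partial_deriv i \<psi> (x + t *\<^sub>R axis i 1)) \<in> borel_measurable lborel"
          by measurable
        have "AE t in lborel. t \<noteq> b" by (rule AE_lborel_singleton)
        then show "AE t in lborel. indicator ?C (x + t *\<^sub>R axis i 1) * partial_deriv i \<psi> (x + t *\<^sub>R axis i 1) = indicator {a..b} t *\<^sub>R partial_deriv i \<psi> (x + t *\<^sub>R axis i 1)"
          unfolding ind by eventually_elim (auto simp: indicator_def)
      qed
      also have "\<dots> = \<psi> (x + b *\<^sub>R axis i 1) - \<psi> (x + a *\<^sub>R axis i 1)"
      proof (rule integral_FTC_Icc[OF less_imp_le[OF ab]])
        fix t assume "a \<le> t" "t \<le> b"
        have "((\<lambda>r. \<psi> ((x + t *\<^sub>R axis i 1) + r *\<^sub>R axis i 1)) has_real_derivative partial_deriv i \<psi> (x + t *\<^sub>R axis i 1)) (at 0)"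
          by (rule partial_deriv_line[OF Ck_1_differentiable[OF \<psi>]])
        then have "((\<lambda>r. \<psi> (x + (t + r) *\<^sub>R axis i 1)) has_real_derivative partial_deriv i \<psi> (x + t *\<^sub>R axis i 1)) (at 0)"
          by (simp add: scaleR_add_left add.assoc)
        then have "((\<lambda>r. \<psi> (x + r *\<^sub>R axis i 1)) has_real_derivative partial_deriv i \<psi> (x + t *\<^sub>R axis i 1)) (at t)"
          using DERIV_shift[of "\<lambda>r. \<psi> (x + r *\<^sub>R axis i 1)" "partial_deriv i \<psi> (x + t *\<^sub>R axis i 1)" 0 t]
          by (simp add: add.commute)
        then show "((\<lambda>r. \<psi> (x + r *\<^sub>R axis i 1)) has_vector_derivative partial_deriv i \<psi> (x + t *\<^sub>R axis i 1)) (at t within {a..b})"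
          by (simp add: has_real_derivative_iff_has_vector_derivative has_vector_derivative_at_within)
      next
        show "continuous_on {a..b} (\<lambda>t. partial_deriv i \<psi> (x + t *\<^sub>R axis i 1))"
          by (intro continuous_on_compose2[OF Ck_1_partial_deriv[OF \<psi>]] continuous_intros) auto
      qed
      \<comment> \<open>The line meets the cell in length \<open>L / m i\<close>, and the difference
        of the boundary values is constant along it; so \<open>D\<close> equals its own average over
        that piece.\<close>
      also have "\<dots> = real (m i) / L * ((b - a) * D)"
        using hl L mi by (simp add: D_def a_def b_def)
      also have "(b - a) * D = (\<integral>t. indicator {a..<b} t * D \<partial>lborel)"
        using ab by simp
      also have "real (m i) / L * (\<integral>t. indicator {a..<b} t * D \<partial>lborel) = (\<integral>t. ?g (x + t *\<^sub>R axis i 1) \<partial>lborel)"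
        unfolding sc ind by (simp add: D_def a_def b_def)
      finally show ?thesis .
    qed
  qed
  then show "(LINT x:?C|lborel. partial_deriv i \<psi> x) =
    m i / L * (LINT x:?C|lborel. \<psi> (set_coord i (L * (real (k i) + 1) / m i) x) - \<psi> (set_coord i (L * k i / m i) x))"
    by (simp add: set_lebesgue_integral_def lo_def hi_def add.commute)
qed

lemma Cck_1_zero_outside:
  assumes "\<psi> \<in> Cck 1 \<Omega>" "x \<notin> \<Omega>"
  shows "\<psi> x = 0" "partial_deriv i \<psi> x = 0"
proof -
  have sub: "closure {x. \<psi> x \<noteq> 0} \<subseteq> \<Omega>" using assms(1) by (simp add: Cck_def)
  then show "\<psi> x = 0" using closure_subset[of "{x. \<psi> x \<noteq> 0}"] assms(2) by blast
  show "partial_deriv i \<psi> x = 0" by (rule partial_deriv_off_support) (use sub assms(2) in blast)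
qed

lemma Cck_1_Ck: "\<psi> \<in> Cck 1 \<Omega> \<Longrightarrow> Ck 1 \<psi>"
  by (simp add: Cck_def del: Ck.simps One_nat_def)

lemma Cck_1_component:
  fixes \<phi> :: "real^'n \<Rightarrow> real^'n::finite"
  assumes "\<phi> \<in> Cck 1 \<Omega>"
  shows "(\<lambda>x. \<phi> x $ i) \<in> Cck 1 \<Omega>"
proof -
  have C1: "Ck 1 \<phi>" using assms by (rule Cck_1_Ck)
  have "Ck 1 (\<lambda>x. \<phi> x $ i)"
  proof (rule Ck_1I)
    show "((\<lambda>x. \<phi> x $ i) has_derivative (\<lambda>v. frechet_derivative \<phi> (at x) v $ i)) (at x)" for x
      by (rule bounded_linear.has_derivative[OF bounded_linear_vec_nth Ck_1_has_derivative[OF C1]])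
    show "continuous_on UNIV (\<lambda>x. frechet_derivative \<phi> (at x) v $ i)" for v
      by (intro continuous_intros Ck_1_continuous_deriv C1)
  qed
  moreover have sub: "closure {x. \<phi> x $ i \<noteq> 0} \<subseteq> closure {x. \<phi> x \<noteq> 0}"
    by (intro closure_mono) auto
  moreover have "compact (closure {x. \<phi> x $ i \<noteq> 0})"
  proof -
    have "compact (closure {x. \<phi> x \<noteq> 0})" using assms by (simp add: Cck_def)
    then show ?thesis using sub by (meson bounded_subset closed_closure compact_eq_bounded_closed)
  qed
  ultimately show ?thesis using assms unfolding Cck_def by blast
qed

section \<open>Unions of cells and measures moved onto their faces\<close>

definition cells :: "real \<Rightarrow> ('n::finite \<Rightarrow> nat) \<Rightarrow> ('n \<Rightarrow> nat) set \<Rightarrow> (real^'n) set" where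
  "cells L m S = (\<Union>k\<in>S. cell L m k)"

lemma cells_sets [measurable]: "S \<subseteq> grid m \<Longrightarrow> cells L m S \<in> sets borel"
  unfolding cells_def by (intro sets.finite_UN cell_borel) (metis finite_grid finite_subset)

lemma integral_cells:
  fixes f :: "real^'n::finite \<Rightarrow> real"
  assumes "S \<subseteq> grid m" "\<And>k. k \<in> S \<Longrightarrow> set_integrable lborel (cell L m k) f"
  shows "(LINT x:cells L m S|lborel. f x) = (\<Sum>k\<in>S. LINT x:cell L m k|lborel. f x)"
  unfolding cells_def
  by (rule set_integral_finite_Union) (use assms in \<open>auto intro: finite_subset disjoint_cells\<close>)

text \<open>Points that \<open>T\<close> moves out of \<open>\<Omega>\<close> are discarded; test functions vanish there.\<close>

definition moved_measure :: "real \<Rightarrow> (real^'n) set \<Rightarrow> (real^'n \<Rightarrow> real^'n) \<Rightarrow> (real^'n) set \<Rightarrow> (real^'n) measure" where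
  "moved_measure c D T \<Omega> =
     distr (density (restrict_space lborel (D \<inter> T -` \<Omega>)) (\<lambda>_. ennreal c)) (restrict_space borel \<Omega>) T"

lemma moved_measure:
  fixes D \<Omega> :: "(real^'n::finite) set"
  assumes c: "c \<ge> 0" and D: "D \<in> sets borel" "emeasure lborel D < \<infinity>" and \<Omega>: "\<Omega> \<in> sets borel"
    and T: "T \<in> borel_measurable borel"
  shows "finite_measure (moved_measure c D T \<Omega>)"
    and "sets (moved_measure c D T \<Omega>) = sets (restrict_space borel \<Omega>)"
    and "\<And>\<psi>. \<psi> \<in> borel_measurable borel \<Longrightarrow> (\<And>x. x \<notin> \<Omega> \<Longrightarrow> \<psi> x = 0) \<Longrightarrow>
      (LINT x|moved_measure c D T \<Omega>. \<psi> x) = c * (LINT x:D|lborel. \<psi> (T x))"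
proof -
  let ?E = "D \<inter> T -` \<Omega>"
  let ?R = "restrict_space lborel ?E"
  have E: "?E \<in> sets borel"
    using measurable_sets[OF T \<Omega>] D by auto
  have TR: "T \<in> measurable ?R (restrict_space borel \<Omega>)"
    using T by (intro measurable_restrict_space2 measurable_restrict_space1) (auto simp: space_restrict_space)
  then have TM: "T \<in> measurable (density ?R (\<lambda>_. ennreal c)) (restrict_space borel \<Omega>)" by simp
  have "emeasure (density ?R (\<lambda>_. ennreal c)) (space ?R) = ennreal c * emeasure lborel ?E"
    using E by (subst emeasure_density_const) (auto simp: space_restrict_space emeasure_restrict_space sets_restrict_space_iff)
  also have "\<dots> < \<infinity>"
  proof -
    have "emeasure lborel ?E \<le> emeasure lborel D" using D by (intro emeasure_mono) auto
    then show ?thesis using D by (auto simp: ennreal_mult_less_top intro: le_less_trans)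
  qed
  finally have "finite_measure (density ?R (\<lambda>_. ennreal c))"
    by (intro finite_measureI) auto
  then show "finite_measure (moved_measure c D T \<Omega>)"
    unfolding moved_measure_def using TM by (intro finite_measure.finite_measure_distr)
  show "sets (moved_measure c D T \<Omega>) = sets (restrict_space borel \<Omega>)"
    by (simp add: moved_measure_def)
  fix \<psi> :: "real^'n \<Rightarrow> real" assume \<psi>: "\<psi> \<in> borel_measurable borel" "\<And>x. x \<notin> \<Omega> \<Longrightarrow> \<psi> x = 0"
  have "(LINT x|moved_measure c D T \<Omega>. \<psi> x) = (LINT x|density ?R (\<lambda>_. ennreal c). \<psi> (T x))"
    unfolding moved_measure_def using TM by (intro integral_distr measurable_restrict_space1 \<psi>)
  also have "\<dots> = (LINT x|?R. c *\<^sub>R \<psi> (T x))"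
  proof (rule integral_density)
    show "(\<lambda>x. \<psi> (T x)) \<in> borel_measurable ?R"
      using measurable_compose[OF T \<psi>(1)] by (intro measurable_restrict_space1) simp
  qed (use c in auto)
  also have "\<dots> = c * (LINT x:?E|lborel. \<psi> (T x))"
    using E by (simp add: set_lebesgue_integral_def integral_restrict_space)
  also have "(LINT x:?E|lborel. \<psi> (T x)) = (LINT x:D|lborel. \<psi> (T x))"
    unfolding set_lebesgue_integral_def
    by (rule Bochner_Integration.integral_cong) (auto simp: indicator_def \<psi>(2))
  finally show "(LINT x|moved_measure c D T \<Omega>. \<psi> x) = c * (LINT x:D|lborel. \<psi> (T x))" .
qed

section \<open>The step functions and their variation\<close>

context
  fixes L h :: real and N :: nat and S :: "('n::finite \<Rightarrow> nat) set"
  assumes L: "L > 0" and h: "h > 0" and N: "N > 0" and S: "S \<subseteq> grid (\<lambda>_. N)"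
begin

abbreviation "mN \<equiv> (\<lambda>_ :: 'n. N)"

definition step :: "real^'n \<Rightarrow> real" where
  "step x = h * indicator (cells L mN S) x"

lemma mN_pos: "\<forall>i. mN i > 0" using N by simp

lemma step_measurable [measurable]: "step \<in> borel_measurable borel"
  using cells_sets[OF S, of L] unfolding step_def by measurable

lemma step_integral:
  fixes \<psi> :: "real^'n \<Rightarrow> real"
  assumes "\<psi> \<in> Cck 1 (open_cube L)"
  shows "(LINT x:open_cube L|lebesgue. step x * partial_deriv i \<psi> x) =
    h * (\<Sum>k\<in>S. LINT x:cell L mN k|lborel. partial_deriv i \<psi> x)"
proof -
  have pm: "partial_deriv i \<psi> \<in> borel_measurable borel"
    by (intro borel_measurable_continuous_onI Ck_1_partial_deriv Cck_1_Ck[OF assms])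
  have Sm: "cells L mN S \<in> sets borel" by (rule cells_sets[OF S])
  have "(LINT x:open_cube L|lebesgue. step x * partial_deriv i \<psi> x)
    = (LINT x|lebesgue. h * (indicator (cells L mN S) x * partial_deriv i \<psi> x))"
    unfolding set_lebesgue_integral_def
    by (rule Bochner_Integration.integral_cong) (auto simp: step_def indicator_def Cck_1_zero_outside[OF assms])
  also have "\<dots> = (LINT x|lborel. h * (indicator (cells L mN S) x * partial_deriv i \<psi> x))"
    using pm Sm by (intro integral_completion) simp
  also have "\<dots> = h * (LINT x:cells L mN S|lborel. partial_deriv i \<psi> x)"
    by (simp add: set_lebesgue_integral_def)
  also have "(LINT x:cells L mN S|lborel. partial_deriv i \<psi> x) = (\<Sum>k\<in>S. LINT x:cell L mN k|lborel. partial_deriv i \<psi> x)"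
    by (intro integral_cells S cell_integral_partial_deriv(3)[OF L mN_pos Cck_1_Ck[OF assms]])
  finally show ?thesis .
qed

text \<open>The half-open cube is itself the only cell of the coarsest grid, so the formula for a
  single cell applies to it; its faces miss the open cube, and \<open>\<psi>\<close> vanishes
  there.\<close>

lemma sum_cells_partial_deriv_zero:
  fixes \<psi> :: "real^'n \<Rightarrow> real"
  assumes "\<psi> \<in> Cck 1 (open_cube L)"
  shows "(\<Sum>k\<in>grid mN. LINT x:cell L mN k|lborel. partial_deriv i \<psi> x) = 0"
proof -
  let ?one = "\<lambda>_ :: 'n. 1 :: nat"
  note C1 = Cck_1_Ck[OF assms]
  have one: "\<forall>i. ?one i > 0" by simp
  have g1: "grid ?one = {\<lambda>_. 0}" by (auto simp: grid_def fun_eq_iff)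
  have U: "cells L mN (grid mN) = cell L ?one (\<lambda>_. 0)"
    using Union_cells[OF L mN_pos] Union_cells[OF L one] unfolding g1 by (simp add: cells_def)
  have "(\<Sum>k\<in>grid mN. LINT x:cell L mN k|lborel. partial_deriv i \<psi> x) = (LINT x:cells L mN (grid mN)|lborel. partial_deriv i \<psi> x)"
    by (intro integral_cells[symmetric] order_refl cell_integral_partial_deriv(3)[OF L mN_pos C1])
  also have "\<dots> = real (?one i) / L * (LINT x:cell L ?one (\<lambda>_. 0)|lborel. \<psi> (set_coord i (L * (real 0 + 1) / real (?one i)) x) - \<psi> (set_coord i (L * real 0 / real (?one i)) x))"
    unfolding U by (rule cell_integral_partial_deriv(1)[OF L one C1])
  also have "\<dots> = 0"
  proof -
    have "set_coord i (L * (real 0 + 1) / real (?one i)) x \<notin> open_cube L" "set_coord i (L * real 0 / real (?one i)) x \<notin> open_cube L" for x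
      by (auto simp: set_coord_def open_cube_def intro!: exI[of _ i])
    then show ?thesis by (simp add: Cck_1_zero_outside(1)[OF assms])
  qed
  finally show ?thesis .
qed

lemma cell_partial_deriv_bound:
  fixes \<psi> :: "real^'n \<Rightarrow> real"
  assumes "\<psi> \<in> Cck 1 (open_cube L)" "\<And>x. \<bar>\<psi> x\<bar> \<le> 1"
  shows "\<bar>LINT x:cell L mN k|lborel. partial_deriv i \<psi> x\<bar> \<le> real N / L * (2 * (L / real N) ^ CARD('n))"
proof -
  note C1 = Cck_1_Ck[OF assms(1)]
  let ?f = "\<lambda>x. \<psi> (set_coord i (L * (real (k i) + 1) / real N) x) - \<psi> (set_coord i (L * real (k i) / real N) x)"
  have fin: "set_integrable lborel (cell L mN k) ?f"
    by (intro set_integral_diff(1) cell_integral_partial_deriv(2)[OF L mN_pos C1])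
  have em: "emeasure lborel (cell L mN k) = ennreal ((L / real N) ^ CARD('n))"
    using emeasure_cell[OF L mN_pos, of k] by simp
  have c2: "set_integrable lborel (cell L mN k) (\<lambda>_. 2 :: real)"
    unfolding set_integrable_def using em by (intro integrable_scaleR_left integrable_real_indicator) auto
  have "\<bar>LINT x:cell L mN k|lborel. ?f x\<bar> \<le> (LINT x:cell L mN k|lborel. \<bar>?f x\<bar>)"
    using set_integral_norm_bound[OF fin] by simp
  also have "\<dots> \<le> (LINT x:cell L mN k|lborel. 2)"
  proof (rule set_integral_mono[OF set_integrable_abs[OF fin] c2])
    fix x
    show "\<bar>?f x\<bar> \<le> 2"
      using assms(2)[of "set_coord i (L * (real (k i) + 1) / real N) x"] assms(2)[of "set_coord i (L * real (k i) / real N) x"] by linarith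
  qed
  also have "\<dots> = 2 * (L / real N) ^ CARD('n)"
    using em L by (simp add: set_lebesgue_integral_def measure_def)
  finally have "\<bar>LINT x:cell L mN k|lborel. ?f x\<bar> \<le> 2 * (L / real N) ^ CARD('n)" .
  then show ?thesis
    unfolding cell_integral_partial_deriv(1)[OF L mN_pos C1]
    using L by (simp add: abs_mult divide_right_mono mult_left_mono)
qed

lemma step_partial_deriv_bound:
  fixes \<psi> :: "real^'n \<Rightarrow> real"
  assumes "\<psi> \<in> Cck 1 (open_cube L)" "\<And>x. \<bar>\<psi> x\<bar> \<le> 1"
  shows "(LINT x:open_cube L|lebesgue. step x * partial_deriv i \<psi> x) \<le> h * (real N / L * L ^ CARD('n))"
proof -
  define I where "I k = (LINT x:cell L mN k|lborel. partial_deriv i \<psi> x)" for k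
  \<comment> \<open>The derivative does not see constants: \<open>step\<close> may be replaced by \<open>step - h / 2\<close>, of modulus \<open>h / 2\<close>.\<close>
  have "sum I (grid mN) = sum I S + sum I (grid mN - S)"
    using S by (simp add: sum.subset_diff add.commute)
  then have "sum I S = (sum I S - sum I (grid mN - S)) / 2"
    using sum_cells_partial_deriv_zero[OF assms(1), of i] by (simp add: I_def)
  also have "\<dots> \<le> ((\<Sum>k\<in>S. \<bar>I k\<bar>) + (\<Sum>k\<in>grid mN - S. \<bar>I k\<bar>)) / 2"
  proof (rule divide_right_mono)
    have "sum I S \<le> (\<Sum>k\<in>S. \<bar>I k\<bar>)" by (rule order_trans[OF abs_ge_self sum_abs])
    moreover have "- sum I (grid mN - S) \<le> (\<Sum>k\<in>grid mN - S. \<bar>I k\<bar>)"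
      by (rule order_trans[OF abs_ge_minus_self sum_abs])
    ultimately have "sum I S + - sum I (grid mN - S) \<le> (\<Sum>k\<in>S. \<bar>I k\<bar>) + (\<Sum>k\<in>grid mN - S. \<bar>I k\<bar>)"
      by (rule add_mono)
    then show "sum I S - sum I (grid mN - S) \<le> (\<Sum>k\<in>S. \<bar>I k\<bar>) + (\<Sum>k\<in>grid mN - S. \<bar>I k\<bar>)"
      by (simp only: add_uminus_conv_diff)
  qed simp
  also have "(\<Sum>k\<in>S. \<bar>I k\<bar>) + (\<Sum>k\<in>grid mN - S. \<bar>I k\<bar>) = (\<Sum>k\<in>grid mN. \<bar>I k\<bar>)"
    using S by (simp add: sum.subset_diff add.commute)
  also have "(\<Sum>k\<in>grid mN. \<bar>I k\<bar>) / 2 \<le> (\<Sum>k\<in>grid mN. real N / L * (2 * (L / real N) ^ CARD('n))) / 2"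
    unfolding I_def by (intro divide_right_mono sum_mono cell_partial_deriv_bound assms) simp
  also have "\<dots> = real N / L * L ^ CARD('n)"
    using N L by (simp add: card_grid power_divide)
  finally show ?thesis
    unfolding step_integral[OF assms(1)] I_def using h by (intro mult_left_mono) auto
qed

lemma step_set_integrable: "A \<in> lmeasurable \<Longrightarrow> set_integrable lebesgue A step"
proof -
  assume A: "A \<in> lmeasurable"
  have sm: "step \<in> borel_measurable lebesgue"
    using step_measurable by (intro measurable_completion) simp
  show ?thesis
    unfolding set_integrable_def
  proof (rule Bochner_Integration.integrable_bound)
    show "integrable lebesgue (\<lambda>x. indicator A x * h)"
      using A by (intro integrable_mult_left integrable_real_indicator) (auto simp: fmeasurable_def)
    show "(\<lambda>x. indicator A x *\<^sub>R step x) \<in> borel_measurable lebesgue"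
      using A sm by (intro borel_measurable_scaleR borel_measurable_indicator) auto
    show "AE x in lebesgue. norm (indicator A x *\<^sub>R step x) \<le> norm (indicator A x * h)"
      using h by (auto simp: step_def indicator_def)
  qed
qed

text \<open>The components of an admissible field are bounded by 1, so the total variation is at
  most the sum of \<open>n\<close> equal directional bounds.\<close>

lemma step_total_variation:
  "total_variation (open_cube L) step \<le> ereal (real CARD('n) * (h * (real N / L * L ^ CARD('n))))"
  unfolding total_variation_def
proof (rule SUP_least)
  fix \<phi> :: "real^'n \<Rightarrow> real^'n"
  assume "\<phi> \<in> {\<phi> \<in> Cck 1 (open_cube L). Linf_norm (lebesgue_on (open_cube L)) \<phi> \<le> 1}"
  then have \<phi>: "\<phi> \<in> Cck 1 (open_cube L)" and Linf: "Linf_norm (lebesgue_on (open_cube L)) \<phi> \<le> 1" by auto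
  have cont: "continuous_on UNIV \<phi>" by (rule Ck_1_continuous[OF Cck_1_Ck[OF \<phi>]])
  have "AE x in lebesgue_on (open_cube L). ereal (norm (\<phi> x)) \<le> esssup (lebesgue_on (open_cube L)) (\<lambda>x. ereal (norm (\<phi> x)))"
    by (rule esssup_AE)
  then have "AE x in lebesgue_on (open_cube L). norm (\<phi> x) \<le> 1"
  proof eventually_elim
    case (elim x)
    then have "ereal (norm (\<phi> x)) \<le> ereal 1"
      using Linf unfolding Linf_norm_def one_ereal_def by (rule order_trans)
    then show ?case by simp
  qed
  then have AE1: "AE x in lebesgue. x \<in> open_cube L \<longrightarrow> norm (\<phi> x) \<le> 1"
    by (subst (asm) AE_restrict_space_iff) auto
  \<comment> \<open>Admissibility bounds \<open>\<phi>\<close> only almost everywhere. By continuity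
    the set where the norm exceeds 1 is open, and a nonempty open set is not null.\<close>
  have norm1: "norm (\<phi> x) \<le> 1" for x
  proof (rule ccontr)
    assume "\<not> ?thesis"
    then have x: "norm (\<phi> x) > 1" by simp
    let ?U = "open_cube L \<inter> {y. norm (\<phi> y) > 1}"
    have "x \<in> open_cube L"
    proof (rule ccontr)
      assume "x \<notin> open_cube L"
      then have "x \<notin> closure {x. \<phi> x \<noteq> 0}" using \<phi> by (auto simp: Cck_def)
      then have "\<phi> x = 0" using closure_subset[of "{x. \<phi> x \<noteq> 0}"] by auto
      with x show False by simp
    qed
    then have "x \<in> ?U" using x by simp
    moreover have "open ?U"
      using cont by (intro open_Int open_Collect_less continuous_intros) (auto simp: open_cube_box open_box)
    moreover have "negligible ?U"
    proof -
      have "AE x in lebesgue. x \<notin> ?U" using AE1 by eventually_elim auto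
      moreover have "?U \<in> sets borel" using \<open>open ?U\<close> by (rule borel_open)
      then have "?U \<in> sets lebesgue" by simp
      ultimately have "?U \<in> null_sets lebesgue" by (simp only: AE_iff_null_sets)
      then show ?thesis by (simp add: negligible_iff_null_sets)
    qed
    ultimately show False using open_not_negligible by blast
  qed
  note comp = Cck_1_component[OF \<phi>]
  have b: "\<bar>\<phi> x $ i\<bar> \<le> 1" for i x
    using component_le_norm_cart[of "\<phi> x" i] norm1[of x] by simp
  have "(LINT x|lebesgue_on (open_cube L). step x * divergence \<phi> x)
    = (LINT x|lebesgue. (\<Sum>i\<in>UNIV. indicator (open_cube L) x *\<^sub>R (step x * partial_deriv i (\<lambda>y. \<phi> y $ i) x)))"
    by (subst integral_restrict_space) (simp_all add: divergence_def sum_distrib_left)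
  also have "\<dots> = (\<Sum>i\<in>UNIV. LINT x:open_cube L|lebesgue. step x * partial_deriv i (\<lambda>y. \<phi> y $ i) x)"
    unfolding set_lebesgue_integral_def
    using Cck_1_set_integrable[OF step_set_integrable comp]
    by (intro Bochner_Integration.integral_sum) (simp add: set_integrable_def)
  also have "\<dots> \<le> (\<Sum>i\<in>(UNIV::'n set). h * (real N / L * L ^ CARD('n)))"
    by (intro sum_mono step_partial_deriv_bound comp b)
  finally show "ereal (LINT x|lebesgue_on (open_cube L). step x * divergence \<phi> x) \<le> ereal (real CARD('n) * (h * (real N / L * L ^ CARD('n))))"
    by simp
qed

text \<open>The \<open>i\<close>-th derivative of the indicator of a cell is the surface measure of
  its lower face minus that of its upper face. Flattening the Lebesgue measure of a cell of
  thickness \<open>L / N\<close> gives these surface measures, whence the weight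
  \<open>h * (N / L)\<close>. A face shared by two cells of the union occurs in both measures and
  cancels.\<close>

lemma step_bounded_variation: "bounded_variation_on (open_cube L) step"
proof -
  let ?D = "cells L mN S"
  \<comment> \<open>\<open>T 0 i\<close> and \<open>T 1 i\<close> project each cell onto its lower and upper face orthogonal to direction \<open>i\<close>.\<close>
  define T where "T d i x = set_coord i (L * (real_of_int \<lfloor>real N * x $ i / L\<rfloor> + d) / real N) x" for d i and x :: "real^'n"
  have Tm: "T d i \<in> borel_measurable borel" for d i
    unfolding T_def by measurable
  have D: "?D \<in> sets borel" by (rule cells_sets[OF S])
  have "emeasure lborel ?D \<le> emeasure lborel (closed_cube L :: (real^'n) set)"
    using cell_subset_cube[OF L mN_pos] S by (intro emeasure_mono) (auto simp: cells_def)
  also have "\<dots> < \<infinity>" unfolding closed_cube_cbox by (rule emeasure_lborel_cbox_finite)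
  finally have Df: "emeasure lborel ?D < \<infinity>" .
  have c: "h * (real N / L) \<ge> 0" using h L by simp
  let ?M = "\<lambda>d i. moved_measure (h * (real N / L)) ?D (T d i) (open_cube L)"
  note mm = moved_measure[OF c D Df cube_sets(2) Tm]
  have "represents_deriv (open_cube L) step (?M 0) (?M 1)"
    unfolding represents_deriv_def
  proof (intro allI conjI ballI)
    fix i and \<psi> :: "real^'n \<Rightarrow> real" assume "\<psi> \<in> Cc_infinity (open_cube L)"
    then have \<psi>: "\<psi> \<in> Cck 1 (open_cube L)" by (auto simp: Cc_infinity_def)
    note C1 = Cck_1_Ck[OF \<psi>]
    have \<psi>m: "\<psi> \<in> borel_measurable borel" by (rule borel_measurable_continuous_onI[OF Ck_1_continuous[OF C1]])
    have TD: "T d i x = set_coord i (L * (real (k i) + d) / real N) x" if "x \<in> cell L mN k" for d x k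
      using that by (simp add: T_def cell_def)
    define B where "B d k = (LINT x:cell L mN k|lborel. \<psi> (set_coord i (L * (real (k i) + d) / real N) x))" for d k
    have int: "set_integrable lborel (cell L mN k) (\<lambda>x. \<psi> (set_coord i r x))" for r k
      by (rule cell_integral_partial_deriv(2)[OF L mN_pos C1])
    have "set_integrable lborel (cell L mN k) (\<lambda>x. \<psi> (T d i x))" for d k
    proof -
      have "set_integrable lborel (cell L mN k) (\<lambda>x. \<psi> (set_coord i (L * (real (k i) + d) / real N) x)) = ?thesis"
        by (rule set_integrable_cong) (auto simp: TD)
      then show ?thesis using int by blast
    qed
    then have "(LINT x:?D|lborel. \<psi> (T d i x)) = (\<Sum>k\<in>S. LINT x:cell L mN k|lborel. \<psi> (T d i x))" for d
      by (intro integral_cells S) auto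
    also have "(\<Sum>k\<in>S. LINT x:cell L mN k|lborel. \<psi> (T d i x)) = (\<Sum>k\<in>S. B d k)" for d
      unfolding B_def by (intro sum.cong refl set_lebesgue_integral_cong) (auto simp: TD)
    finally have M: "(LINT x|?M d i. \<psi> x) = h * (real N / L) * (\<Sum>k\<in>S. B d k)" for d
      using mm(3)[of \<psi>] \<psi>m Cck_1_zero_outside(1)[OF \<psi>] by simp
    have "(LINT x|lebesgue_on (open_cube L). step x * partial_deriv i \<psi> x) = (LINT x:open_cube L|lebesgue. step x * partial_deriv i \<psi> x)"
      by (simp add: integral_restrict_space set_lebesgue_integral_def)
    also have "\<dots> = h * (\<Sum>k\<in>S. real N / L * (B 1 k - B 0 k))"
      unfolding step_integral[OF \<psi>] cell_integral_partial_deriv(1)[OF L mN_pos C1] B_def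
      using int by (simp add: set_integral_diff(2))
    also have "(\<Sum>k\<in>S. real N / L * (B 1 k - B 0 k)) = real N / L * (sum (B 1) S - sum (B 0) S)"
      by (simp only: sum_distrib_left[symmetric] sum_subtractf)
    also have "h * (real N / L * (sum (B 1) S - sum (B 0) S)) = - ((LINT x|?M 0 i. \<psi> x) - (LINT x|?M 1 i. \<psi> x))"
    proof -
      have "a * (b * (p - q)) = - (a * b * q - a * b * p)" for a b p q :: real
        by (simp add: algebra_simps)
      then show ?thesis unfolding M .
    qed
    finally show "(LINT x|lebesgue_on (open_cube L). step x * partial_deriv i \<psi> x) = - ((LINT x|?M 0 i. \<psi> x) - (LINT x|?M 1 i. \<psi> x))" .
  qed (rule mm(1) mm(2))+
  moreover have "integrable (lebesgue_on (open_cube L)) step"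
    using step_set_integrable[of "open_cube L"] by (simp add: integrable_restrict_space set_integrable_def)
  ultimately show ?thesis unfolding bounded_variation_on_def by blast
qed

end

section \<open>Counting in the Hamming cube\<close>

text \<open>A finite infimum in \<open>enat\<close> is attained, so a bound for all finite coverings
  passes to the covering number; without a finite covering the entropy is infinite.\<close>

lemma eps_entropy_ge:
  assumes B: "B > 0" and ge: "\<And>C. finite C \<Longrightarrow> eps_covering X \<epsilon> E C \<Longrightarrow> B \<le> real (card C)"
  shows "ereal (log 2 B) \<le> eps_entropy X \<epsilon> E"
proof (cases "covering_number X \<epsilon> E")
  case (enat k)
  let ?A = "(\<lambda>C. enat (card C)) ` {C. finite C \<and> eps_covering X \<epsilon> E C}"
  have Inf: "Inf ?A = enat k" using enat by (simp add: covering_number_def)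
  then have "?A \<noteq> {}" by (metis Inf_empty enat.distinct(1) top_enat_def)
  then have "Inf ?A \<in> ?A"
    unfolding Inf_enat_def by (simp only: if_False) (metis LeastI ex_in_conv)
  then have "enat k \<in> ?A" by (simp only: Inf)
  then obtain C where "finite C" "eps_covering X \<epsilon> E C" "k = card C" by auto
  then have "B \<le> real k" using ge by auto
  then show ?thesis using B enat by (simp add: eps_entropy_def)
qed (simp add: eps_entropy_def)

lemma hamming_ball_bound:
  assumes G: "finite G"
  shows "real (card {U \<in> Pow G. 4 * card U \<le> card G}) \<le> 2 ^ card G * exp (- real (card G) / 8)"
proof -
  let ?m = "card G"
  let ?A = "{U \<in> Pow G. 4 * card U \<le> ?m}"
  \<comment> \<open>Chernoff bound with weight \<open>1/3\<close> per element, the optimal one at relative size \<open>1/4\<close>.\<close>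
  define c where "c = (3::real) powr (1/4)"
  have c1: "c \<ge> 1" unfolding c_def by (rule ge_one_powr_ge_zero) auto
  have c4: "c ^ 4 = 3" unfolding c_def by (simp add: powr_power)
  have "real (card ?A) = (\<Sum>U\<in>?A. 1)" by simp
  also have "\<dots> \<le> (\<Sum>U\<in>?A. c ^ ?m * (1/3) ^ card U)"
  proof (rule sum_mono)
    fix U assume "U \<in> ?A"
    then have "c ^ (4 * card U) \<le> c ^ ?m" using c1 by (intro power_increasing) auto
    then have "3 ^ card U \<le> c ^ ?m" by (simp add: power_mult c4)
    then have "3 ^ card U * (1/3) ^ card U \<le> c ^ ?m * (1/3) ^ card U" by (intro mult_right_mono) auto
    then show "1 \<le> c ^ ?m * (1/3) ^ card U" by (simp add: power_one_over)
  qed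
  also have "\<dots> \<le> (\<Sum>U\<in>Pow G. c ^ ?m * (1/3) ^ card U)"
    using G c1 by (intro sum_mono2) auto
  also have "\<dots> = c ^ ?m * (\<Sum>U\<in>Pow G. (\<Prod>_\<in>U. 1/3) * (\<Prod>_\<in>G - U. 1))"
    by (simp add: sum_distrib_left)
  also have "(\<Sum>U\<in>Pow G. (\<Prod>_\<in>U. 1/3 :: real) * (\<Prod>_\<in>G - U. 1)) = (\<Prod>_\<in>G. 1/3 + 1)"
    using G by (rule prod_add[symmetric])
  also have "c ^ ?m * (\<Prod>_\<in>G. 1/3 + 1) = (c * (4/3)) ^ ?m" by (simp add: power_mult_distrib power_divide)
  also have "\<dots> \<le> (2 * exp (- 1 / 8)) ^ ?m"
  proof (rule power_mono)
    \<comment> \<open>The eighth power clears the exponents 1/4 in \<open>c\<close> and 1/8 in the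
      claim; what remains is \<open>9 * e \<le> (3/2) ^ 8\<close>, about 24.5 against 25.6.\<close>
    have "exp (1::real) * 9 \<le> (3/2) ^ 8" using e_less_272 by (simp add: power_divide)
    then have "9 \<le> (3/2) ^ 8 * exp (- 1 :: real)" by (simp add: exp_minus field_simps)
    moreover have "exp (- 1 / 8) ^ 8 = exp (- 1 :: real)"
      by (simp flip: exp_of_nat_mult)
    moreover have "c ^ 8 = 9"
    proof -
      have "c ^ 8 = (c ^ 4) ^ 2" by (simp flip: power_mult)
      then show ?thesis by (simp add: c4)
    qed
    ultimately have "c ^ 8 \<le> (3/2 * exp (- 1 / 8)) ^ 8" by (simp only: power_mult_distrib)
    then have "c \<le> 3/2 * exp (- 1 / 8)" by (rule power_le_imp_le_base[of c 7, unfolded Suc_numeral semiring_norm]) auto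
    then show "c * (4/3) \<le> 2 * exp (- 1 / 8)" by simp
  qed (use c1 in auto)
  also have "\<dots> = 2 ^ ?m * exp (- real ?m / 8)"
    by (simp add: power_mult_distrib flip: exp_of_nat_mult)
  finally show ?thesis .
qed

text \<open>Symmetric difference with a fixed member is an injective isometry of the Hamming cube;
  it moves the family into the ball of radius \<open>card G / 4\<close> around the empty
  set.\<close>

lemma small_diameter_family_bound:
  assumes G: "finite G" and F: "F \<subseteq> Pow G"
    and diam: "\<And>S T. S \<in> F \<Longrightarrow> T \<in> F \<Longrightarrow> 4 * card ((S - T) \<union> (T - S)) \<le> card G"
  shows "real (card F) \<le> 2 ^ card G * exp (- real (card G) / 8)"
proof (cases "F = {}")
  case False
  then obtain S where S: "S \<in> F" by blast
  have "card F \<le> card {U \<in> Pow G. 4 * card U \<le> card G}"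
  proof (rule card_inj_on_le)
    show "inj_on (\<lambda>T. (S - T) \<union> (T - S)) F" by (rule inj_onI) blast
    show "(\<lambda>T. (S - T) \<union> (T - S)) ` F \<subseteq> {U \<in> Pow G. 4 * card U \<le> card G}"
      using F S diam by blast
    show "finite {U \<in> Pow G. 4 * card U \<le> card G}" using G by simp
  qed
  then have "real (card F) \<le> real (card {U \<in> Pow G. 4 * card U \<le> card G})" by simp
  also have "\<dots> \<le> 2 ^ card G * exp (- real (card G) / 8)" by (rule hamming_ball_bound[OF G])
  finally show ?thesis .
qed simp

section \<open>The lower bound from step functions indexed by sets of cells\<close>

lemma step_distance:
  fixes S T :: "('n::finite \<Rightarrow> nat) set"
  assumes L: "L > 0" and h: "h > 0" and N: "N > 0"
    and S: "S \<subseteq> grid (\<lambda>_. N)" and T: "T \<subseteq> grid (\<lambda>_. N)"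
  shows "(LINT x:closed_cube L|lebesgue. \<bar>step L h N S x - step L h N T x\<bar>)
    = h * (L / real N) ^ CARD('n) * real (card ((S - T) \<union> (T - S)))"
proof -
  let ?m = "\<lambda>_ :: 'n. N"
  let ?U = "(S - T) \<union> (T - S)"
  have m: "\<forall>i. ?m i > 0" using N by simp
  have iS: "set_integrable lebesgue (closed_cube L) (step L h N S)" and iT: "set_integrable lebesgue (closed_cube L) (step L h N T)"
    using step_set_integrable[OF L h N S cube_lmeasurable(1)] step_set_integrable[OF L h N T cube_lmeasurable(1)] .
  have "(LINT x:closed_cube L|lebesgue. \<bar>step L h N S x - step L h N T x\<bar>)
    = (\<Sum>k\<in>grid ?m. LINT x:cell L ?m k|lebesgue. \<bar>step L h N S x - step L h N T x\<bar>)"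
    by (intro integral_cube_cells[OF L m] set_integrable_abs set_integral_diff iS iT)
  also have "\<dots> = (\<Sum>k\<in>grid ?m. (if k \<in> ?U then h * (L / real N) ^ CARD('n) else 0))"
  proof (rule sum.cong[OF refl])
    fix k
    have mem: "x \<in> cells L ?m R \<longleftrightarrow> k \<in> R" if "x \<in> cell L ?m k" for x R
      unfolding cells_def using that cell_unique[OF that] by blast
    have "(LINT x:cell L ?m k|lebesgue. \<bar>step L h N S x - step L h N T x\<bar>) = (LINT x:cell L ?m k|lebesgue. if k \<in> ?U then h else 0)"
      by (rule set_lebesgue_integral_cong) (use h in \<open>auto simp: step_def[OF L h N S] step_def[OF L h N T] indicator_def mem\<close>)
    also have "\<dots> = (if k \<in> ?U then h else 0) * (\<Prod>i\<in>(UNIV :: 'n set). L / real (?m i))"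
      by (rule cell_const_integral[OF L iS m])
    finally show "(LINT x:cell L ?m k|lebesgue. \<bar>step L h N S x - step L h N T x\<bar>) = (if k \<in> ?U then h * (L / real N) ^ CARD('n) else 0)"
      by simp
  qed
  also have "\<dots> = (\<Sum>k\<in>?U. h * (L / real N) ^ CARD('n))"
    using S T by (intro sum.mono_neutral_cong_right) auto
  finally show ?thesis by simp
qed

lemma step_in_BV_class:
  fixes S :: "('n::finite \<Rightarrow> nat) set"
  assumes L: "L > 0" and h: "h > 0" and N: "N > 0" and S: "S \<subseteq> grid (\<lambda>_. N)"
    and M: "h \<le> M" and V: "real CARD('n) * (h * (real N / L * L ^ CARD('n))) \<le> V"
  shows "L1_class (lebesgue_on (closed_cube L)) (step L h N S) \<in> BV_class L M V"
  unfolding BV_class_def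
proof (intro CollectI exI conjI refl)
  let ?s = "step L h N S"
  show i: "integrable (lebesgue_on (closed_cube L)) ?s"
    unfolding integrable_cube_iff by (rule step_set_integrable[OF L h N S cube_lmeasurable(1)])
  show "Linf_norm (lebesgue_on (closed_cube L)) ?s \<le> ereal M"
    unfolding Linf_norm_def
  proof (rule esssup_I)
    show "(\<lambda>x. ereal (norm (?s x))) \<in> borel_measurable (lebesgue_on (closed_cube L))"
      using borel_measurable_integrable[OF i] by simp
    show "AE x in lebesgue_on (closed_cube L). ereal (norm (?s x)) \<le> ereal M"
      using h M by (intro AE_I2) (auto simp: step_def[OF L h N S] indicator_def)
  qed
  show "bounded_variation_on (open_cube L) ?s" by (rule step_bounded_variation[OF L h N S])
  show "total_variation (open_cube L) ?s \<le> ereal V"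
    by (rule order_trans[OF step_total_variation[OF L h N S]]) (use V in simp)
qed simp

lemma covering_card_ge:
  fixes L M V \<epsilon> :: real and C :: "(real^'n::finite \<Rightarrow> real) set set set"
  assumes L: "L > 0" and M: "M > 0" and V: "V > 0" and e: "0 < \<epsilon>" "\<epsilon> < M * L ^ CARD('n) / 8"
    and N: "N > 0" "real N \<le> V * L / (2 ^ (CARD('n) + 2) * \<epsilon>)"
    and C: "finite C" "eps_covering (L1_cube L) \<epsilon> (BV_class L M V) C"
  shows "exp (real (N ^ CARD('n)) / 8) \<le> real (card C)"
proof -
  let ?n = "CARD('n)"
  let ?G = "grid (\<lambda>_ :: 'n. N)"
  let ?mu = "lebesgue_on (closed_cube L) :: (real^'n) measure"
  \<comment> \<open>With this height each differing cell contributes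
    \<open>8 * \<epsilon> / N ^ n\<close> to the distance, so \<open>2 * \<epsilon>\<close> is
    reached at a quarter of the cells.\<close>
  define h where "h = 8 * \<epsilon> / L ^ ?n"
  define c where "c S = L1_class ?mu (step L h N S)" for S :: "('n \<Rightarrow> nat) set"
  have h: "h > 0" using e L by (simp add: h_def)
  have hM: "h \<le> M"
    unfolding h_def using e(2) L by (subst pos_divide_le_eq) auto
  have n2: "real ?n * 2 \<le> 2 ^ ?n"
  proof -
    obtain p where p: "?n = Suc p" using not0_implies_Suc[of ?n] by auto
    have "Suc p \<le> 2 ^ p" using less_exp[of p] by (simp add: Suc_leI)
    then have "real (Suc p) \<le> real (2 ^ p)" by (simp only: of_nat_le_iff)
    then show ?thesis unfolding p by simp
  qed
  \<comment> \<open>The variation requires \<open>8 * n * N * \<epsilon> \<le> V * L\<close>; the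
    power of 2 in the statement enters through \<open>2 * n \<le> 2 ^ n\<close>. For
    \<open>n = 1\<close> and \<open>n = 2\<close> this is an equality, so the factor 2 gained in
    \<open>step_partial_deriv_bound\<close> is essential there.\<close>
  have hV: "real ?n * (h * (real N / L * L ^ ?n)) \<le> V"
  proof -
    have "real ?n * (h * (real N / L * L ^ ?n)) = real ?n * 2 * (4 * \<epsilon> / L) * real N"
      using L by (simp add: h_def)
    also have "\<dots> \<le> 2 ^ ?n * (4 * \<epsilon> / L) * (V * L / (2 ^ (?n + 2) * \<epsilon>))"
      using n2 N e L by (intro mult_mono) auto
    also have "\<dots> = V" using e L by (simp add: power_add)
    finally show ?thesis .
  qed
  have cBV: "c S \<in> BV_class L M V" if "S \<subseteq> ?G" for S
    unfolding c_def by (rule step_in_BV_class[OF L h N(1) that hM hV])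
  define F where "F A = {S. S \<subseteq> ?G \<and> c S \<in> A}" for A
  have Pow: "Pow ?G = (\<Union>A\<in>C. F A)"
  proof (intro equalityI subsetI)
    fix S assume "S \<in> Pow ?G"
    then have S: "S \<subseteq> ?G" by simp
    have "c S \<in> \<Union>C" using C(2) cBV[OF S] unfolding eps_covering_def by (meson subsetD)
    then show "S \<in> (\<Union>A\<in>C. F A)" using S by (auto simp: F_def)
  qed (auto simp: F_def)
  have cardG: "card ?G = N ^ ?n" by (simp add: card_grid)
  have Fbound: "real (card (F A)) \<le> 2 ^ card ?G * exp (- real (card ?G) / 8)" if A: "A \<in> C" for A
  proof (rule small_diameter_family_bound)
    show "finite ?G" by simp
    show "F A \<subseteq> Pow ?G" by (auto simp: F_def)
    fix S T assume "S \<in> F A" "T \<in> F A"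
    then have S: "S \<subseteq> ?G" "c S \<in> A" and T: "T \<subseteq> ?G" "c T \<in> A" by (auto simp: F_def)
    have i: "integrable ?mu (step L h N S)" "integrable ?mu (step L h N T)"
      unfolding integrable_cube_iff
      using step_set_integrable[OF L h N(1) S(1) cube_lmeasurable(1)] step_set_integrable[OF L h N(1) T(1) cube_lmeasurable(1)] .
    have "L1_dist ?mu (c S) (c T) \<le> 2 * \<epsilon>"
      using C(2) A S T unfolding eps_covering_def by simp
    then have "h * (L / real N) ^ ?n * real (card ((S - T) \<union> (T - S))) \<le> 2 * \<epsilon>"
      unfolding c_def L1_dist_class[OF i] integral_cube_eq step_distance[OF L h N(1) S(1) T(1)] .
    moreover have "h * (L / real N) ^ ?n = 8 * \<epsilon> / real (card ?G)"
      using L N by (simp add: h_def cardG power_divide)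
    ultimately have "8 * \<epsilon> / real (card ?G) * real (card ((S - T) \<union> (T - S))) \<le> 2 * \<epsilon>" by simp
    then have "4 * real (card ((S - T) \<union> (T - S))) \<le> real (card ?G)"
      using e N by (simp add: cardG field_simps)
    then show "4 * card ((S - T) \<union> (T - S)) \<le> card ?G" by linarith
  qed
  have "2 ^ card ?G = real (card (Pow ?G))" by (simp add: card_Pow)
  also have "\<dots> \<le> real (\<Sum>A\<in>C. card (F A))"
    unfolding Pow using C(1) by (simp only: of_nat_le_iff card_UN_le)
  also have "\<dots> \<le> (\<Sum>A\<in>C. 2 ^ card ?G * exp (- real (card ?G) / 8))"
    unfolding of_nat_sum by (rule sum_mono[OF Fbound])
  also have "\<dots> = 2 ^ card ?G * (real (card C) * exp (- real (card ?G) / 8))" by simp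
  finally have "1 \<le> real (card C) * exp (- real (card ?G) / 8)" by simp
  then have "1 * exp (real (card ?G) / 8) \<le> real (card C) * exp (- real (card ?G) / 8) * exp (real (card ?G) / 8)"
    by (intro mult_right_mono) auto
  also have "\<dots> = real (card C)" by (simp flip: exp_add)
  finally show ?thesis by (simp add: cardG)
qed

text \<open>Serves the case in which the floor in the lower bound is 0: then the class only has to
  be nonempty. The witness is the zero function, written as a step function over no cells;
  \<open>h\<close> is small because the variation bound in \<open>step_in_BV_class\<close> is
  uniform in the set of cells.\<close>

lemma covering_card_ge_1:
  fixes L M V :: real and C :: "(real^'n::finite \<Rightarrow> real) set set set"
  assumes L: "L > 0" and M: "M > 0" and V: "V > 0"
    and C: "finite C" "eps_covering (L1_cube L) \<epsilon> (BV_class L M V) C"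
  shows "1 \<le> card C"
proof -
  let ?n = "real CARD('n)"
  define h where "h = min M (V * L / (?n * L ^ CARD('n)))"
  have n: "?n > 0" by simp
  have h: "h > 0" using L M V n by (simp add: h_def)
  have "?n * (h * (real 1 / L * L ^ CARD('n))) \<le> ?n * (V * L / (?n * L ^ CARD('n)) * (real 1 / L * L ^ CARD('n)))"
    using L n by (intro mult_left_mono mult_right_mono) (auto simp: h_def)
  also have "\<dots> = V" using L n by simp
  finally have "L1_class (lebesgue_on (closed_cube L)) (step L h 1 {}) \<in> (BV_class L M V :: (real^'n \<Rightarrow> real) set set)"
    using L h by (intro step_in_BV_class) (auto simp: h_def)
  then have "C \<noteq> {}" using C(2) by (auto simp: eps_covering_def)
  then show ?thesis using C(1) by (simp add: Suc_le_eq card_gt_0_iff)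
qed

lemma eps_entropy_lower:
  fixes L M V \<epsilon> :: real
  assumes L: "L > 0" and M: "M > 0" and V: "V > 0"
    and e: "0 < \<epsilon>" "\<epsilon> < M * L ^ CARD('n::finite) / 8"
  shows "ereal (log 2 (exp 1) / 8 * real_of_int \<lfloor>V * L / (2 ^ (CARD('n) + 2) * \<epsilon>)\<rfloor> ^ CARD('n))
    \<le> eps_entropy (L1_cube L) \<epsilon> (BV_class L M V :: (real^'n \<Rightarrow> real) set set)"
proof -
  let ?n = "CARD('n)"
  let ?q = "V * L / (2 ^ (?n + 2) * \<epsilon>)"
  define N where "N = nat \<lfloor>?q\<rfloor>"
  have q: "?q \<ge> 0" using V L e by simp
  then have N: "real_of_int \<lfloor>?q\<rfloor> = real N" by (simp add: N_def)
  have "exp (real (N ^ ?n) / 8) \<le> real (card C)"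
    if C: "finite C" "eps_covering (L1_cube L) \<epsilon> (BV_class L M V :: (real^'n \<Rightarrow> real) set set) C" for C
  proof (cases "N = 0")
    case True
    \<comment> \<open>\<open>0 ^ n\<close> is 0 because \<open>n\<close> is positive.\<close>
    then have "exp (real (N ^ ?n) / 8) = 1" by (simp add: power_0_left)
    moreover have "1 \<le> real (card C)" using covering_card_ge_1[OF L M V C] by simp
    ultimately show ?thesis by (simp only:)
  next
    case False
    moreover have "real N \<le> ?q" using N q by (metis of_int_floor_le)
    ultimately show ?thesis by (intro covering_card_ge[OF L M V e _ _ C]) auto
  qed
  then have "ereal (log 2 (exp (real (N ^ ?n) / 8))) \<le> eps_entropy (L1_cube L) \<epsilon> (BV_class L M V :: (real^'n \<Rightarrow> real) set set)"
    by (intro eps_entropy_ge) auto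
  moreover have "log 2 (exp (real (N ^ ?n) / 8)) = log 2 (exp 1) / 8 * real N ^ ?n"
    by (simp add: log_def)
  ultimately show ?thesis by (simp only: N)
qed

theorem theorem3p1:
  fixes L M V \<epsilon> :: real
  assumes "L > 0" and "M > 0" and "V > 0"
    and "0 < \<epsilon>" and "\<epsilon> < M * L ^ CARD('n::finite) / 8"
  shows "ereal (log 2 (exp 1) / 8 *
            real_of_int \<lfloor>V * L / (2 ^ (CARD('n) + 2) * \<epsilon>)\<rfloor> ^ CARD('n))
           \<le> eps_entropy (L1_cube L) \<epsilon> (BV_class L M V :: (real^'n \<Rightarrow> real) set set)
         \<and> eps_entropy (L1_cube L) \<epsilon> (BV_class L M V :: (real^'n \<Rightarrow> real) set set)
           \<le> ereal (Gamma_const CARD('n) L M V * (1 / \<epsilon> ^ CARD('n)))"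
  using eps_entropy_lower[OF assms] eps_entropy_upper[OF assms] ..

end
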